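(* Let $K \subseteq L$ be a finite Galois extension of fields with Galois group $G$. Let $$B = \{\alpha \in L \mid (\tau(\alpha))_{\tau \in G} \text{ is a basis of } L \text{ over } K\},$$ and let $w$ denote the number of $|G|$-th roots of unity in $K^*$. Then for $\gamma \in L^*$ the following assertions are equivalent: (i) $\gamma B \subseteq B$; (ii) $\gamma B = B$; (iii) $\frac{\tau(\gamma)}{\gamma} \in K^*$ for all $\tau \in G$; (iv) $\gamma^w \in K^*$. Moreover, the set $C$ of all $\gamma \in L^*$ satisfying these conditions is a subgroup of $L^*$ containing $K^*$, and $C/K^*$ is isomorphic to the group of all group homomorphisms $G \to K^*$.
   Context: For a field $F$, $F^*$ denotes its multiplicative group. For $\gamma\in L^*$, $\gamma B=\{\gamma\alpha\mid \alpha\in B\}$. *)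

theory Defs
  imports "HOL-Algebra.Algebra"
begin

text \<open>
  As in \<^theory>\<open>HOL-Algebra.Bij\<close>, automorphisms are taken extensional on the carrier, so that each
  automorphism of \<open>L\<close> is represented by exactly one HOL function.
\<close>

definition field_auts :: "('a, 'm) ring_scheme \<Rightarrow> 'a set \<Rightarrow> ('a \<Rightarrow> 'a) set" where
  "field_auts L K = {\<sigma> \<in> ring_hom L L \<inter> Bij (carrier L). \<forall>x\<in>K. \<sigma> x = x}"

definition galois_group :: "('a, 'm) ring_scheme \<Rightarrow> 'a set \<Rightarrow> ('a \<Rightarrow> 'a) monoid" where
  "galois_group L K = BijGroup (carrier L) \<lparr>carrier := field_auts L K\<rparr>"

locale finite_galois_extension = field L for L (structure) and K +
  assumes subfield: "subfield K L"
    and finite_dim: "finite_dimension K (carrier L)"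
    and fixed_field: "{x \<in> carrier L. \<forall>\<sigma> \<in> carrier (galois_group L K). \<sigma> x = x} = K"

text \<open>
  \<^const>\<open>ring.independent\<close> and \<^const>\<open>ring.Span\<close> work on lists of vectors; an enumeration of the Galois
  group without repetitions turns the family \<open>(\<tau> \<alpha>)\<^sub>\<tau>\<close> into such a list. An independent list has no
  repeated entries, so this is the notion of a basis for families, not merely for their ranges.
\<close>

definition normal_basis_elements :: "('a, 'm) ring_scheme \<Rightarrow> 'a set \<Rightarrow> 'a set" where
  "normal_basis_elements L K =
    {\<alpha> \<in> carrier L. \<exists>\<tau>s. distinct \<tau>s \<and> set \<tau>s = carrier (galois_group L K) \<and>
       ring.independent L K (map (\<lambda>\<tau>. \<tau> \<alpha>) \<tau>s) \<and>
       ring.Span L K (map (\<lambda>\<tau>. \<tau> \<alpha>) \<tau>s) = carrier L}"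

definition hom_group :: "('g, 'm) monoid_scheme \<Rightarrow> ('h, 'n) monoid_scheme \<Rightarrow> ('g \<Rightarrow> 'h) monoid" where
  "hom_group G H =
    \<lparr>carrier = hom G H \<inter> extensional (carrier G),
     monoid.mult = (\<lambda>f g. \<lambda>x\<in>carrier G. f x \<otimes>\<^bsub>H\<^esub> g x),
     one = (\<lambda>x\<in>carrier G. \<one>\<^bsub>H\<^esub>)\<rparr>"

lemma group_hom_group:
  assumes "group G" "comm_group H"
  shows "group (hom_group G H)"
proof -
  interpret G: group G by fact
  interpret H: comm_group H by fact
  show ?thesis
  proof (rule groupI)
    fix f assume f: "f \<in> carrier (hom_group G H)"
    let ?g = "\<lambda>x\<in>carrier G. inv\<^bsub>H\<^esub> (f x)"
    have "?g \<in> carrier (hom_group G H)"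
      using f by (auto simp: hom_group_def hom_def Pi_iff H.inv_mult)
    moreover have "?g \<otimes>\<^bsub>hom_group G H\<^esub> f = \<one>\<^bsub>hom_group G H\<^esub>"
      using f by (auto simp: hom_group_def hom_def Pi_iff fun_eq_iff)
    ultimately show "\<exists>g\<in>carrier (hom_group G H). g \<otimes>\<^bsub>hom_group G H\<^esub> f = \<one>\<^bsub>hom_group G H\<^esub>"
      by blast
  qed (auto simp: hom_group_def hom_def Pi_iff fun_eq_iff extensional_def H.m_ac)
qed

lemma (in field) group_galois_group:
  assumes "K \<subseteq> carrier R"
  shows "group (galois_group R K)"
proof -
  interpret B: group "BijGroup (carrier R)" by (rule group_BijGroup)
  have "subgroup (field_auts R K) (BijGroup (carrier R))"
  proof (rule B.subgroupI)
    show "field_auts R K \<subseteq> carrier (BijGroup (carrier R))"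
      by (auto simp: field_auts_def BijGroup_def)
    have "(\<lambda>x\<in>carrier R. x) \<in> field_auts R K"
      using assms by (auto simp: field_auts_def id_Bij ring_hom_def)
    then show "field_auts R K \<noteq> {}" by blast
  next
    fix f assume f: "f \<in> field_auts R K"
    then have fB: "f \<in> Bij (carrier R)" and fh: "f \<in> ring_hom R R" and fK: "\<forall>x\<in>K. f x = x"
      by (auto simp: field_auts_def)
    have inj: "inj_on f (carrier R)"
      using fB by (auto simp: Bij_def bij_betw_def)
    have one: "inv_into (carrier R) f \<one> = \<one>"
      using inv_into_f_f[OF inj one_closed] ring_hom_one[OF fh] by simp
    have K: "inv_into (carrier R) f x = x" if "x \<in> K" for x
      using inv_into_f_f[OF inj, of x] fK assms that by auto
    have m: "inv_into (carrier R) f (x \<otimes> y) = inv_into (carrier R) f x \<otimes> inv_into (carrier R) f y"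
      if "x \<in> carrier R" "y \<in> carrier R" for x y
      by (rule Bij_inv_into_lemma[OF _ fB]) (use fh that in \<open>auto simp: ring_hom_mult\<close>)
    have a: "inv_into (carrier R) f (x \<oplus> y) = inv_into (carrier R) f x \<oplus> inv_into (carrier R) f y"
      if "x \<in> carrier R" "y \<in> carrier R" for x y
      by (rule Bij_inv_into_lemma[OF _ fB]) (use fh that in \<open>auto simp: ring_hom_add\<close>)
    have "(\<lambda>x\<in>carrier R. inv_into (carrier R) f x) \<in> field_auts R K"
      using assms restrict_inv_into_Bij[OF fB] fB
      by (auto simp: field_auts_def ring_hom_def one K m a Bij_inv_into_mem)
    then show "inv\<^bsub>BijGroup (carrier R)\<^esub> f \<in> field_auts R K"
      by (simp add: inv_BijGroup[OF fB])
  next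
    fix f g assume fg: "f \<in> field_auts R K" "g \<in> field_auts R K"
    then have "f \<in> Bij (carrier R)" "g \<in> Bij (carrier R)" by (auto simp: field_auts_def)
    moreover have "compose (carrier R) f g \<in> field_auts R K"
      using fg assms compose_Bij[of f "carrier R" g]
      by (auto simp: field_auts_def ring_hom_def compose_def Pi_iff)
    ultimately show "f \<otimes>\<^bsub>BijGroup (carrier R)\<^esub> g \<in> field_auts R K"
      by (simp add: BijGroup_def)
  qed
  then show ?thesis
    unfolding galois_group_def by (rule B.subgroup_imp_group)
qed

end

(* Condition (iii) says that tau(gamma) = k_tau gamma with k_tau in K, so multiplication by gamma only
   rescales the conjugates of a normal basis element: (iii) implies (ii). Here tau |-> k_tau is a
   homomorphism from G to the |G|-th roots of unity of K, which gives (iv); conversely the roots of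
   X^w - 1 in L all lie in K. Every homomorphism arises this way by Hilbert 90.

   For (i) ==> (iii), the linear form f = Tr(gamma .) has no zero in B. Identify L with the
   group algebra A = K[G] by a normal basis element x; then B consists of the units of A, and one has
   to show that a hyperplane of A without units is an ideal.
   If K is infinite and ker f is not tau-stable, some v satisfies Tr(gamma v) = 0 and
   Tr(tau(gamma) v) ~= 0. Then, with rho = tau^-1, the element (rho + c)(x + s v) lies in B for all but
   finitely many s and c, while s determines a c for which f vanishes on it.
   If K is finite, A is a finite commutative ring, since the multiplicative group of L is cyclic. The
   powers of an element of A contain an idempotent, and each idempotent e has e or 1 - e in the largest
   ideal contained in ker f.

   The existence of a normal basis is needed in both cases. For infinite K it follows by
   specializing a nonsingular matrix over L to K; for finite K, it holds because A is a finite
   commutative ring in which every principal ideal is its own double annihilator. *)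

theory Submission
  imports Defs
begin

section \<open>Linear algebra over a field\<close>

text \<open>For \<open>x\<close> in B the trace is nonzero, being the combination of the conjugates
  with all coefficients 1. Applied to \<gamma> x this is why (i) keeps Tr(\<gamma> .) away from zero
  on B, and nothing else of (i) is used. Moving an automorphism across the trace form turns
  Tr(\<tau>(\<gamma>) v) into Tr(\<gamma> \<tau>^-1(v)). So stability of the hyperplane under
  \<tau>^-1 makes Tr(\<tau>(\<gamma>) .) vanish on it, and nondegeneracy then gives \<tau>(\<gamma>)
  = k \<gamma>. The case distinction has two sources: specialization needs parameters outside a
  finite bad set, and a small K may have none left; the argument with idempotents needs A finite and
  commutative, which fails in general for infinite K. Determinants are avoided throughout: a matrix
  is nonsingular when its kernel is trivial, and units of A are replaced by elements that are not
  zero divisors.\<close>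

lemma (in abelian_monoid) finsum_remove:
  assumes "finite A" "i \<in> A" "f \<in> A \<rightarrow> carrier G"
  shows "(\<Oplus>j\<in>A. f j) = f i \<oplus> (\<Oplus>j\<in>A - {i}. f j)"
proof -
  have "f \<in> A - {i} \<rightarrow> carrier G" "f i \<in> carrier G" using assms by auto
  then show ?thesis
    using finsum_insert[of "A - {i}" i f] assms by (simp add: insert_absorb)
qed

lemma (in abelian_monoid) finsum_swap:
  assumes "finite A" "finite B" "\<And>i j. i \<in> A \<Longrightarrow> j \<in> B \<Longrightarrow> f i j \<in> carrier G"
  shows "(\<Oplus>i\<in>A. \<Oplus>j\<in>B. f i j) = (\<Oplus>j\<in>B. \<Oplus>i\<in>A. f i j)"
  using assms(1,3)
proof (induction A)
  case empty
  then show ?case by (simp add: finsum_zero)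
next
  case (insert a A)
  have "(\<Oplus>i\<in>insert a A. \<Oplus>j\<in>B. f i j) = (\<Oplus>j\<in>B. f a j) \<oplus> (\<Oplus>j\<in>B. \<Oplus>i\<in>A. f i j)"
    using insert by (subst finsum_insert) (auto intro!: finsum_closed)
  also have "\<dots> = (\<Oplus>j\<in>B. f a j \<oplus> (\<Oplus>i\<in>A. f i j))"
    using insert by (subst finsum_addf) (auto intro!: finsum_closed)
  also have "\<dots> = (\<Oplus>j\<in>B. \<Oplus>i\<in>insert a A. f i j)"
    using insert by (intro finsum_cong') (auto intro!: finsum_closed)
  finally show ?case .
qed

lemma (in ring) finsum_in_subring:
  assumes "subring K R" "f \<in> A \<rightarrow> K"
  shows "(\<Oplus>i\<in>A. f i) \<in> K"
  using assms(2)
proof (induction A rule: infinite_finite_induct)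
  case (insert a A)
  have "f \<in> insert a A \<rightarrow> carrier R" using insert subringE(1)[OF assms(1)] by auto
  then show ?case using insert subringE(7)[OF assms(1)] by auto
qed (use subringE(2)[OF assms(1)] in auto)

text \<open>Bilinearity of the pairing with \<open>p\<close>; it lets the pencil argument apply a
  matrix row to a whole combination of vectors.\<close>

lemma (in cring) finsum_smult_swap:
  assumes "finite S" "finite I" "c \<in> S \<rightarrow> carrier R" "\<And>s j. s \<in> S \<Longrightarrow> j \<in> I \<Longrightarrow> v s j \<in> carrier R"
    and "p \<in> I \<rightarrow> carrier R"
  shows "(\<Oplus>j\<in>I. (\<Oplus>s\<in>S. c s \<otimes> v s j) \<otimes> p j) = (\<Oplus>s\<in>S. c s \<otimes> (\<Oplus>j\<in>I. v s j \<otimes> p j))"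
proof -
  have "(\<Oplus>j\<in>I. (\<Oplus>s\<in>S. c s \<otimes> v s j) \<otimes> p j) = (\<Oplus>j\<in>I. \<Oplus>s\<in>S. c s \<otimes> (v s j \<otimes> p j))"
    using assms by (intro finsum_cong' refl) (auto simp: finsum_ldistr Pi_iff m_assoc intro!: finsum_closed finsum_cong')
  also have "\<dots> = (\<Oplus>s\<in>S. \<Oplus>j\<in>I. c s \<otimes> (v s j \<otimes> p j))"
    using assms by (intro finsum_swap) (auto simp: Pi_iff)
  also have "\<dots> = (\<Oplus>s\<in>S. c s \<otimes> (\<Oplus>j\<in>I. v s j \<otimes> p j))"
    using assms by (intro finsum_cong') (auto simp: finsum_rdistr Pi_iff intro!: finsum_closed)
  finally show ?thesis .
qed

section \<open>Linear functionals and homogeneous systems over a field\<close>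

lemma fun_upd_in_Pi: "f \<in> A \<rightarrow> B \<Longrightarrow> y \<in> B \<Longrightarrow> f(x := y) \<in> insert x A \<rightarrow> B"
  by auto

lemma (in field) separating_functional:
  assumes K: "subfield K R" and I: "finite I"
    and "W \<noteq> {}" "\<And>w. w \<in> W \<Longrightarrow> w \<in> I \<rightarrow> K"
    and "\<And>w w'. w \<in> W \<Longrightarrow> w' \<in> W \<Longrightarrow> (\<lambda>i. w i \<oplus> w' i) \<in> W"
    and "\<And>k w. k \<in> K \<Longrightarrow> w \<in> W \<Longrightarrow> (\<lambda>i. k \<otimes> w i) \<in> W"
    and "v \<in> I \<rightarrow> K" "\<And>w. w \<in> W \<Longrightarrow> \<exists>i\<in>I. v i \<noteq> w i"
  shows "\<exists>b\<in>I \<rightarrow> K. (\<forall>w\<in>W. (\<Oplus>i\<in>I. b i \<otimes> w i) = \<zero>) \<and> (\<Oplus>i\<in>I. b i \<otimes> v i) \<noteq> \<zero>"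
  using I assms(3-)
proof (induction I arbitrary: W v)
  case empty
  then show ?case by auto
next
  case (insert x I)
  note W = insert.prems(2) and Wadd = insert.prems(3) and Wsm = insert.prems(4)
    and v = insert.prems(5) and vW = insert.prems(6)
  note sub = subringE[OF subfieldE(1)[OF K]]
  have KR: "\<And>k. k \<in> K \<Longrightarrow> k \<in> carrier R" using sub(1) by auto
  show ?case
  proof (cases "\<forall>w\<in>W. w x = \<zero>")
    case True
    show ?thesis
    proof (cases "v x = \<zero>")
      case False
      let ?b = "\<lambda>i. if i = x then \<one> else \<zero>"
      have "(\<Oplus>i\<in>insert x I. ?b i \<otimes> w i) = w x" if "w \<in> insert x I \<rightarrow> K" for w
      proof -
        have "(\<Oplus>i\<in>insert x I. ?b i \<otimes> w i) = (\<Oplus>i\<in>insert x I. if i = x then w i else \<zero>)"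
          using that KR by (intro finsum_cong') (auto simp: Pi_iff)
        also have "\<dots> = w x"
          using that KR insert.hyps by (intro add.finprod_singleton_swap) (auto simp: Pi_iff)
        finally show ?thesis .
      qed
      moreover have "?b \<in> insert x I \<rightarrow> K" using sub by auto
      ultimately show ?thesis
        using True False W v by (intro bexI[of _ ?b] conjI ballI) auto
    next
      case vx: True
      have "\<exists>b\<in>I \<rightarrow> K. (\<forall>w\<in>W. (\<Oplus>i\<in>I. b i \<otimes> w i) = \<zero>) \<and> (\<Oplus>i\<in>I. b i \<otimes> v i) \<noteq> \<zero>"
        using insert.prems(1) W Wadd Wsm v vW True vx
        by (intro insert.IH) (auto simp: Pi_iff)
      then obtain b where b: "b \<in> I \<rightarrow> K" "\<And>w. w \<in> W \<Longrightarrow> (\<Oplus>i\<in>I. b i \<otimes> w i) = \<zero>"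
        "(\<Oplus>i\<in>I. b i \<otimes> v i) \<noteq> \<zero>" by blast
      have eq: "(\<Oplus>i\<in>insert x I. (b(x := \<zero>)) i \<otimes> w i) = (\<Oplus>i\<in>I. b i \<otimes> w i)"
        if "w \<in> insert x I \<rightarrow> K" for w
      proof -
        have "(\<Oplus>i\<in>I. (b(x := \<zero>)) i \<otimes> w i) = (\<Oplus>i\<in>I. b i \<otimes> w i)"
          using that KR b(1) insert.hyps by (intro finsum_cong') (auto simp: Pi_iff)
        moreover have "(\<Oplus>i\<in>I. b i \<otimes> w i) \<in> carrier R"
          using that KR b(1) by (intro finsum_closed) (auto simp: Pi_iff)
        ultimately show ?thesis
          using insert.hyps that KR b(1) by (subst finsum_insert) (auto simp: Pi_iff)
      qed
      show ?thesis
        using b(2,3) W v fun_upd_in_Pi[OF b(1) sub(2), of x]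
        by (intro bexI[of _ "b(x := \<zero>)"] conjI ballI) (simp_all add: eq del: fun_upd_apply)
    qed
  next
    case False
    then obtain w0 where w0: "w0 \<in> W" "w0 x \<noteq> \<zero>" by auto
    then have w0x: "w0 x \<in> K - {\<zero>}" using W by auto
    define u where "u = (\<lambda>i. inv (w0 x) \<otimes> w0 i)"
    have uW: "u \<in> W" and ux: "u x = \<one>"
      using subfield_m_inv[OF K w0x] Wsm w0 by (auto simp: u_def)
    have uK: "u \<in> insert x I \<rightarrow> K" using uW W by blast
    \<comment> \<open>Projection along \<open>u\<close> onto the vectors with entry zero at
      \<open>x\<close>; it preserves \<open>W\<close> because \<open>u\<close> lies in it.\<close>
    define pr where "pr = (\<lambda>w i. w i \<oplus> (\<ominus> w x) \<otimes> u i)"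
    have prK: "pr w \<in> insert x I \<rightarrow> K" if "w \<in> insert x I \<rightarrow> K" for w
      using that uK sub by (auto simp: pr_def Pi_iff)
    have prW: "pr w \<in> W" if "w \<in> W" for w
      unfolding pr_def using that uW W[OF that] sub by (intro Wadd Wsm) auto
    have prx: "pr w x = \<zero>" if "w \<in> insert x I \<rightarrow> K" for w
      using that KR by (simp add: pr_def ux Pi_iff r_neg)
    have "\<exists>b\<in>I \<rightarrow> K. (\<forall>w\<in>{w \<in> W. w x = \<zero>}. (\<Oplus>i\<in>I. b i \<otimes> w i) = \<zero>) \<and> (\<Oplus>i\<in>I. b i \<otimes> pr v i) \<noteq> \<zero>"
    proof (rule insert.IH)
      show "{w \<in> W. w x = \<zero>} \<noteq> {}" using prW[OF w0(1)] prx[OF W[OF w0(1)]] by blast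
      fix w assume w: "w \<in> {w \<in> W. w x = \<zero>}"
      \<comment> \<open>If \<open>pr v\<close> agreed with \<open>w\<close>, adding back
        \<open>v x\<close> times \<open>u\<close> would put \<open>v\<close> itself in
        \<open>W\<close>.\<close>
      let ?w = "\<lambda>i. w i \<oplus> v x \<otimes> u i"
      have "?w \<in> W" using w uW v by (intro Wadd Wsm) auto
      then obtain i where i: "i \<in> insert x I" "v i \<noteq> ?w i" using vW by blast
      have "i \<noteq> x" using i w v KR by (auto simp: ux Pi_iff)
      moreover have "pr v i \<noteq> w i"
      proof
        assume "pr v i = w i"
        then have "?w i = v i \<oplus> (\<ominus> v x) \<otimes> u i \<oplus> v x \<otimes> u i" by (simp add: pr_def)
        also have "\<dots> = v i" using v uK KR i(1) by (auto simp: Pi_iff l_minus a_assoc l_neg)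
        finally show False using i by simp
      qed
      ultimately show "\<exists>i\<in>I. pr v i \<noteq> w i" using i by blast
    next
      show "pr v \<in> I \<rightarrow> K" using prK[OF v] by auto
      show "\<And>w. w \<in> {w \<in> W. w x = \<zero>} \<Longrightarrow> w \<in> I \<rightarrow> K" using W by fast
      show "(\<lambda>i. w i \<oplus> w' i) \<in> {w \<in> W. w x = \<zero>}"
        if "w \<in> {w \<in> W. w x = \<zero>}" "w' \<in> {w \<in> W. w x = \<zero>}" for w w'
        using that Wadd by auto
      show "(\<lambda>i. k \<otimes> w i) \<in> {w \<in> W. w x = \<zero>}" if "k \<in> K" "w \<in> {w \<in> W. w x = \<zero>}" for k w
        using that Wsm KR by auto
    qed
    then obtain b where b: "b \<in> I \<rightarrow> K" "\<And>w. w \<in> W \<Longrightarrow> w x = \<zero> \<Longrightarrow> (\<Oplus>i\<in>I. b i \<otimes> w i) = \<zero>"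
      "(\<Oplus>i\<in>I. b i \<otimes> pr v i) \<noteq> \<zero>" by blast
    \<comment> \<open>The entry at \<open>x\<close> is forced by the wish that \<open>b'\<close>
      annihilate \<open>u\<close>; then \<open>b'\<close> takes the same value on \<open>w\<close>
      as \<open>b\<close> on \<open>pr w\<close>.\<close>
    define b' where "b' = b(x := \<ominus> (\<Oplus>i\<in>I. b i \<otimes> u i))"
    have su: "(\<Oplus>i\<in>I. b i \<otimes> u i) \<in> K"
      using b(1) uK sub by (intro finsum_in_subring[OF subfieldE(1)[OF K]]) (auto simp: Pi_iff)
    have b'K: "b' \<in> insert x I \<rightarrow> K"
      unfolding b'_def using b(1) su sub(5) by (intro fun_upd_in_Pi)
    have eq: "(\<Oplus>i\<in>insert x I. b' i \<otimes> w i) = (\<Oplus>i\<in>I. b i \<otimes> pr w i)"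
      if w: "w \<in> insert x I \<rightarrow> K" for w
    proof -
      have sw: "(\<Oplus>i\<in>I. b i \<otimes> w i) \<in> carrier R"
        using b(1) w KR by (intro finsum_closed) (auto simp: Pi_iff)
      have "(\<Oplus>i\<in>I. b i \<otimes> pr w i) = (\<Oplus>i\<in>I. b i \<otimes> w i \<oplus> (\<ominus> w x) \<otimes> (b i \<otimes> u i))"
        using b(1) w uK KR by (intro finsum_cong') (auto simp: pr_def Pi_iff r_distr m_lcomm)
      also have "\<dots> = (\<Oplus>i\<in>I. b i \<otimes> w i) \<oplus> (\<Oplus>i\<in>I. (\<ominus> w x) \<otimes> (b i \<otimes> u i))"
        using b(1) w uK KR by (intro finsum_addf) (auto simp: Pi_iff)
      also have "(\<Oplus>i\<in>I. (\<ominus> w x) \<otimes> (b i \<otimes> u i)) = (\<ominus> w x) \<otimes> (\<Oplus>i\<in>I. b i \<otimes> u i)"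
        using b(1) w uK KR insert.hyps by (intro finsum_rdistr[symmetric]) (auto simp: Pi_iff)
      also have "(\<Oplus>i\<in>I. b i \<otimes> w i) \<oplus> \<dots> = \<ominus> (\<Oplus>i\<in>I. b i \<otimes> u i) \<otimes> w x \<oplus> (\<Oplus>i\<in>I. b i \<otimes> w i)"
        using sw su w KR by (simp add: Pi_iff l_minus r_minus m_comm a_comm)
      also have "(\<Oplus>i\<in>I. b i \<otimes> w i) = (\<Oplus>i\<in>I. b' i \<otimes> w i)"
        using b(1) w KR insert.hyps b'K by (intro finsum_cong') (auto simp: Pi_iff b'_def)
      also have "\<ominus> (\<Oplus>i\<in>I. b i \<otimes> u i) \<otimes> w x \<oplus> \<dots> = (\<Oplus>i\<in>insert x I. b' i \<otimes> w i)"
        using insert.hyps b'K w KR by (subst finsum_insert) (auto simp: b'_def Pi_iff)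
      finally show ?thesis by simp
    qed
    show ?thesis
      using b'K b W v prW prx by (intro bexI[of _ b'] conjI ballI) (auto simp: eq)
  qed
qed

text \<open>Gaussian elimination: an equation with a nonzero entry at \<open>z\<close> expresses the
  unknown \<open>z\<close> by the others, which leaves one equation and one unknown fewer.\<close>

lemma (in field) homogeneous_system:
  assumes "finite I" "finite Y" "card Y < card I" "\<And>i j. i \<in> Y \<Longrightarrow> j \<in> I \<Longrightarrow> M i j \<in> carrier R"
  shows "\<exists>c\<in>I \<rightarrow> carrier R. (\<exists>j\<in>I. c j \<noteq> \<zero>) \<and> (\<forall>i\<in>Y. (\<Oplus>j\<in>I. c j \<otimes> M i j) = \<zero>)"
  using assms(2,1,3,4)
proof (induction Y arbitrary: I M)
  case empty
  then have "I \<noteq> {}" by auto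
  then show ?case by (intro bexI[of _ "\<lambda>_. \<one>"]) auto
next
  case (insert y Y)
  note I = insert.prems(1) and M = insert.prems(3)
  show ?case
  proof (cases "\<forall>j\<in>I. M y j = \<zero>")
    case True
    have "\<exists>c\<in>I \<rightarrow> carrier R. (\<exists>j\<in>I. c j \<noteq> \<zero>) \<and> (\<forall>i\<in>Y. (\<Oplus>j\<in>I. c j \<otimes> M i j) = \<zero>)"
      using insert by (intro insert.IH) auto
    then obtain c where c: "c \<in> I \<rightarrow> carrier R" "\<exists>j\<in>I. c j \<noteq> \<zero>"
      "\<forall>i\<in>Y. (\<Oplus>j\<in>I. c j \<otimes> M i j) = \<zero>" by blast
    moreover have "(\<Oplus>j\<in>I. c j \<otimes> M y j) = \<zero>"
      using True c by (intro add.finprod_one_eqI) (auto simp: Pi_iff)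
    ultimately show ?thesis by (intro bexI[of _ c]) auto
  next
    case False
    then obtain z where z: "z \<in> I" "M y z \<noteq> \<zero>" by auto
    define r where "r = (\<lambda>j. inv (M y z) \<otimes> M y j)"
    have inv: "inv (M y z) \<in> carrier R" "inv (M y z) \<otimes> M y z = \<one>"
      using z M by (auto simp: field_Units)
    have r: "r j \<in> carrier R" if "j \<in> I" for j using that M inv by (auto simp: r_def)
    have My: "M y j = M y z \<otimes> r j" if "j \<in> I" for j
    proof -
      have "M y z \<otimes> r j = inv (M y z) \<otimes> M y z \<otimes> M y j"
        unfolding r_def using M inv(1) z that by (simp add: m_ac)
      then show ?thesis using M inv that by simp
    qed
    \<comment> \<open>The remaining equations after substituting for the unknown \<open>z\<close>
      minus the combination of the others with weights \<open>r\<close>.\<close>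
    define N where "N = (\<lambda>i j. M i j \<oplus> (\<ominus> M i z) \<otimes> r j)"
    have "\<exists>c\<in>I - {z} \<rightarrow> carrier R. (\<exists>j\<in>I - {z}. c j \<noteq> \<zero>) \<and> (\<forall>i\<in>Y. (\<Oplus>j\<in>I - {z}. c j \<otimes> N i j) = \<zero>)"
      using insert z r by (intro insert.IH) (auto simp: N_def)
    then obtain c where c: "c \<in> I - {z} \<rightarrow> carrier R" "\<exists>j\<in>I - {z}. c j \<noteq> \<zero>"
      "\<And>i. i \<in> Y \<Longrightarrow> (\<Oplus>j\<in>I - {z}. c j \<otimes> N i j) = \<zero>" by blast
    define s where "s = (\<Oplus>j\<in>I - {z}. c j \<otimes> r j)"
    have s: "s \<in> carrier R" unfolding s_def using c r by (intro finsum_closed) auto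
    define c' where "c' = c(z := \<ominus> s)"
    have c': "c' \<in> I \<rightarrow> carrier R" using c(1) s by (auto simp: c'_def Pi_iff)
    have split: "(\<Oplus>j\<in>I. c' j \<otimes> M i j) = (\<Oplus>j\<in>I - {z}. c j \<otimes> M i j) \<oplus> (\<ominus> M i z) \<otimes> s"
      if i: "i \<in> insert y Y" for i
    proof -
      have "(\<Oplus>j\<in>I. c' j \<otimes> M i j) = c' z \<otimes> M i z \<oplus> (\<Oplus>j\<in>I - {z}. c' j \<otimes> M i j)"
        using z I c' M i by (intro finsum_remove) auto
      also have "(\<Oplus>j\<in>I - {z}. c' j \<otimes> M i j) = (\<Oplus>j\<in>I - {z}. c j \<otimes> M i j)"
        using c M i by (intro finsum_cong') (auto simp: c'_def)
      moreover have "(\<Oplus>j\<in>I - {z}. c j \<otimes> M i j) \<in> carrier R"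
        using c M i by (intro finsum_closed) auto
      ultimately show ?thesis using z M[OF i z(1)] s by (simp add: c'_def l_minus r_minus m_comm a_comm)
    qed
    have "(\<Oplus>j\<in>I. c' j \<otimes> M i j) = \<zero>" if i: "i \<in> insert y Y" for i
    proof (cases "i = y")
      case True
      have "(\<Oplus>j\<in>I - {z}. c j \<otimes> M y j) = (\<Oplus>j\<in>I - {z}. M y z \<otimes> (c j \<otimes> r j))"
      proof (rule finsum_cong')
        fix j assume j: "j \<in> I - {z}"
        then have "c j \<in> carrier R" using c by auto
        then show "c j \<otimes> M y j = M y z \<otimes> (c j \<otimes> r j)"
          using j r M[of y z] z by (subst My) (auto simp: m_lcomm)
      qed (use c(1) M r z in \<open>auto simp: Pi_iff\<close>)
      also have "\<dots> = M y z \<otimes> s"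
        unfolding s_def using I c M r z by (intro finsum_rdistr[symmetric]) auto
      finally show ?thesis using True split[OF i] M[OF i z(1)] s by (simp add: l_minus r_neg)
    next
      case False
      then have "i \<in> Y" using i by auto
      have "\<zero> = (\<Oplus>j\<in>I - {z}. c j \<otimes> N i j)" using c \<open>i \<in> Y\<close> by simp
      also have "\<dots> = (\<Oplus>j\<in>I - {z}. c j \<otimes> M i j \<oplus> (\<ominus> M i z) \<otimes> (c j \<otimes> r j))"
        using c M[OF i] r z by (intro finsum_cong') (auto simp: N_def Pi_iff r_distr m_lcomm)
      also have "\<dots> = (\<Oplus>j\<in>I - {z}. c j \<otimes> M i j) \<oplus> (\<Oplus>j\<in>I - {z}. (\<ominus> M i z) \<otimes> (c j \<otimes> r j))"
        using c M[OF i] r z by (intro finsum_addf) (auto simp: Pi_iff)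
      also have "(\<Oplus>j\<in>I - {z}. (\<ominus> M i z) \<otimes> (c j \<otimes> r j)) = (\<ominus> M i z) \<otimes> s"
        unfolding s_def using I c M[OF i] r z by (intro finsum_rdistr[symmetric]) auto
      finally show ?thesis using split[OF i] by simp
    qed
    moreover have "\<exists>j\<in>I. c' j \<noteq> \<zero>" using c(2) by (auto simp: c'_def)
    ultimately show ?thesis using c' by blast
  qed
qed

section \<open>Nonsingular matrices and pencils\<close>

definition (in ring) nonsingular :: "'i set \<Rightarrow> ('i \<Rightarrow> 'i \<Rightarrow> 'a) \<Rightarrow> bool" where
  "nonsingular I P \<longleftrightarrow>
    (\<forall>c\<in>I \<rightarrow> carrier R. (\<forall>i\<in>I. (\<Oplus>j\<in>I. c j \<otimes> P i j) = \<zero>) \<longrightarrow> (\<forall>j\<in>I. c j = \<zero>))"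

lemma (in ring) nonsingularI:
  "(\<And>c. c \<in> I \<rightarrow> carrier R \<Longrightarrow> \<forall>i\<in>I. (\<Oplus>j\<in>I. c j \<otimes> P i j) = \<zero> \<Longrightarrow> \<forall>j\<in>I. c j = \<zero>) \<Longrightarrow>
    nonsingular I P"
  unfolding nonsingular_def by blast

lemma (in ring) nonsingularD:
  "nonsingular I P \<Longrightarrow> c \<in> I \<rightarrow> carrier R \<Longrightarrow> (\<And>i. i \<in> I \<Longrightarrow> (\<Oplus>j\<in>I. c j \<otimes> P i j) = \<zero>) \<Longrightarrow> j \<in> I \<Longrightarrow> c j = \<zero>"
  unfolding nonsingular_def by blast

text \<open>If \<open>P + t Q\<close> kills a vector \<open>v\<^sub>t\<close>, then \<open>v\<^sub>t\<close> is an eigenvector of \<open>P\<^sup>-\<^sup>1 Q\<close> for the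
  eigenvalue \<open>- 1 / t\<close>; eigenvectors for distinct eigenvalues are independent.\<close>

lemma (in field) finite_singular_in_pencil:
  assumes I: "finite I"
    and P: "\<And>i j. i \<in> I \<Longrightarrow> j \<in> I \<Longrightarrow> P i j \<in> carrier R"
    and Q: "\<And>i j. i \<in> I \<Longrightarrow> j \<in> I \<Longrightarrow> Q i j \<in> carrier R"
    and nP: "nonsingular I P"
  shows "finite {t \<in> carrier R. \<not> nonsingular I (\<lambda>i j. P i j \<oplus> t \<otimes> Q i j)}" (is "finite ?bad")
proof (rule ccontr)
  assume "infinite ?bad"
  \<comment> \<open>One parameter more than the dimension, so that independence of the vectors
    \<open>v t\<close> is absurd.\<close>
  then obtain T where T: "T \<subseteq> ?bad" "finite T" "card T = Suc (card I)"
    using infinite_arbitrarily_large by blast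
  have "\<forall>t\<in>T. \<exists>v. v \<in> I \<rightarrow> carrier R \<and> (\<forall>i\<in>I. (\<Oplus>j\<in>I. v j \<otimes> (P i j \<oplus> t \<otimes> Q i j)) = \<zero>) \<and> (\<exists>j\<in>I. v j \<noteq> \<zero>)"
    using T(1) unfolding nonsingular_def by blast
  then obtain v where v: "\<And>t. t \<in> T \<Longrightarrow> v t \<in> I \<rightarrow> carrier R"
    and vz: "\<And>t i. t \<in> T \<Longrightarrow> i \<in> I \<Longrightarrow> (\<Oplus>j\<in>I. v t j \<otimes> (P i j \<oplus> t \<otimes> Q i j)) = \<zero>"
    and vnz: "\<And>t. t \<in> T \<Longrightarrow> \<exists>j\<in>I. v t j \<noteq> \<zero>"
    by (auto dest!: bchoice)
  have vc: "v t j \<in> carrier R" if "t \<in> T" "j \<in> I" for t j using v that by auto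
  have TR: "t \<in> carrier R" if "t \<in> T" for t using T(1) that by auto
  have eig: "(\<Oplus>j\<in>I. v t j \<otimes> P i j) \<oplus> t \<otimes> (\<Oplus>j\<in>I. v t j \<otimes> Q i j) = \<zero>" if t: "t \<in> T" and i: "i \<in> I" for t i
  proof -
    have "\<zero> = (\<Oplus>j\<in>I. v t j \<otimes> P i j \<oplus> t \<otimes> (v t j \<otimes> Q i j))"
      unfolding vz[OF t i, symmetric] using vc[OF t] P[OF i] Q[OF i] TR[OF t]
      by (intro finsum_cong') (auto simp: r_distr m_lcomm)
    also have "\<dots> = (\<Oplus>j\<in>I. v t j \<otimes> P i j) \<oplus> (\<Oplus>j\<in>I. t \<otimes> (v t j \<otimes> Q i j))"
      using vc[OF t] P[OF i] Q[OF i] TR[OF t] by (intro finsum_addf) auto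
    also have "(\<Oplus>j\<in>I. t \<otimes> (v t j \<otimes> Q i j)) = t \<otimes> (\<Oplus>j\<in>I. v t j \<otimes> Q i j)"
      using vc[OF t] Q[OF i] TR[OF t] I by (intro finsum_rdistr[symmetric]) auto
    finally show ?thesis by simp
  qed
  \<comment> \<open>Nonsingularity of \<open>P\<close> excludes t = 0, which the eigenvalue - 1 / t
    requires.\<close>
  have T0: "t \<noteq> \<zero>" if t: "t \<in> T" for t
  proof
    assume "t = \<zero>"
    then have "\<forall>i\<in>I. (\<Oplus>j\<in>I. v t j \<otimes> P i j) = \<zero>"
      using eig[OF t] vc[OF t] P Q by (auto intro!: finsum_closed simp: r_zero)
    then show False using nonsingularD[OF nP v[OF t]] vnz[OF t] by blast
  qed
  have indep: "\<forall>t\<in>S. c t = \<zero>"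
    if "finite S" "S \<subseteq> T" "c \<in> S \<rightarrow> carrier R" "\<forall>j\<in>I. (\<Oplus>t\<in>S. c t \<otimes> v t j) = \<zero>" for S c
    using that
  proof (induction S arbitrary: c)
    case empty then show ?case by simp
  next
    case (insert s S)
    note c = insert.prems(2) and ST = insert.prems(1)
    have cc: "c t \<in> carrier R" if "t \<in> insert s S" for t using c that by blast
    have iv: "inv t \<in> carrier R" "inv t \<otimes> t = \<one>" if "t \<in> insert s S" for t
      using that ST TR T0 by (auto simp: field_Units subset_iff)
    \<comment> \<open>Coefficients divided by \<open>t\<close>: \<open>P\<close> sends the
      combination \<open>w\<close> to minus the image under \<open>Q\<close> of the given relation,
      hence to zero. So \<open>w\<close> vanishes, and no inverse of \<open>P\<close> has to be
      formed.\<close>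
    let ?d = "\<lambda>t. inv t \<otimes> c t"
    have dc: "?d \<in> insert s S \<rightarrow> carrier R" using iv cc by auto
    have vS: "v t j \<in> carrier R" if "t \<in> insert s S" "j \<in> I" for t j using vc ST that by blast
    have fin: "finite (insert s S)" using insert.hyps by simp
    define w where "w = (\<lambda>j. \<Oplus>t\<in>insert s S. ?d t \<otimes> v t j)"
    have wc: "w \<in> I \<rightarrow> carrier R"
      unfolding w_def using vS dc by (intro Pi_I finsum_closed) blast
    have "(\<Oplus>j\<in>I. w j \<otimes> P i j) = \<zero>" if i: "i \<in> I" for i
    proof -
      have Pv: "(\<Oplus>j\<in>I. v t j \<otimes> P i j) \<in> carrier R" "(\<Oplus>j\<in>I. v t j \<otimes> Q i j) \<in> carrier R"
        if "t \<in> insert s S" for t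
        using P[OF i] Q[OF i] vS[OF that] by (auto intro!: finsum_closed)
      have "(\<Oplus>j\<in>I. w j \<otimes> P i j) = (\<Oplus>t\<in>insert s S. ?d t \<otimes> (\<Oplus>j\<in>I. v t j \<otimes> P i j))"
        unfolding w_def using fin I dc vS P[OF i] by (intro finsum_smult_swap) auto
      also have "\<dots> = (\<Oplus>t\<in>insert s S. (\<ominus> \<one>) \<otimes> (c t \<otimes> (\<Oplus>j\<in>I. v t j \<otimes> Q i j)))"
      proof (rule finsum_cong')
        fix t assume t: "t \<in> insert s S"
        then have tT: "t \<in> T" using ST by blast
        let ?p = "\<Oplus>j\<in>I. v t j \<otimes> P i j" and ?q = "\<Oplus>j\<in>I. v t j \<otimes> Q i j"
        have "?p = \<ominus> (t \<otimes> ?q)"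
          using eig[OF tT i] Pv[OF t] TR[OF tT] by (metis m_closed minus_equality minus_minus a_inv_closed)
        then have "?d t \<otimes> ?p = (\<ominus> \<one>) \<otimes> (inv t \<otimes> t) \<otimes> (c t \<otimes> ?q)"
          using iv(1)[OF t] TR[OF tT] cc[OF t] Pv[OF t] by (simp add: m_ac l_minus r_minus)
        then show "?d t \<otimes> ?p = (\<ominus> \<one>) \<otimes> (c t \<otimes> ?q)"
          using iv(2)[OF t] by simp
      qed (use Pv cc in auto)
      also have "\<dots> = (\<ominus> \<one>) \<otimes> (\<Oplus>t\<in>insert s S. c t \<otimes> (\<Oplus>j\<in>I. v t j \<otimes> Q i j))"
        using fin Pv cc by (intro finsum_rdistr[symmetric]) auto
      also have "(\<Oplus>t\<in>insert s S. c t \<otimes> (\<Oplus>j\<in>I. v t j \<otimes> Q i j)) = (\<Oplus>j\<in>I. (\<Oplus>t\<in>insert s S. c t \<otimes> v t j) \<otimes> Q i j)"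
        using fin I c vS Q[OF i] by (intro finsum_smult_swap[symmetric]) auto
      also have "\<dots> = \<zero>"
        using insert.prems(3) Q[OF i] by (intro add.finprod_one_eqI) auto
      finally show ?thesis by simp
    qed
    then have w0: "w j = \<zero>" if "j \<in> I" for j
      using nonsingularD[OF nP wc] that by blast
    \<comment> \<open>Subtracting 1/s times the given relation from \<open>w\<close> kills the term
      at \<open>s\<close>; the factors 1/t - 1/s of the other terms are nonzero.\<close>
    let ?e = "\<lambda>t. (inv t \<oplus> \<ominus> (inv s)) \<otimes> c t"
    have e0: "?e t = \<zero>" if "t \<in> S" for t
    proof -
      have "\<forall>t\<in>S. ?e t = \<zero>"
      proof (rule insert.IH)
        show "S \<subseteq> T" using ST by simp
        show "?e \<in> S \<rightarrow> carrier R" using iv cc by auto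
        show "\<forall>j\<in>I. (\<Oplus>t\<in>S. ?e t \<otimes> v t j) = \<zero>"
        proof
          fix j assume j: "j \<in> I"
          have "(\<Oplus>t\<in>insert s S. ?e t \<otimes> v t j) = (\<Oplus>t\<in>insert s S. ?d t \<otimes> v t j \<oplus> (\<ominus> (inv s)) \<otimes> (c t \<otimes> v t j))"
            using iv cc vS j by (intro finsum_cong') (auto simp: l_distr m_assoc)
          also have "\<dots> = (\<Oplus>t\<in>insert s S. ?d t \<otimes> v t j) \<oplus> (\<Oplus>t\<in>insert s S. (\<ominus> (inv s)) \<otimes> (c t \<otimes> v t j))"
            using iv cc vS j by (intro finsum_addf) auto
          also have "(\<Oplus>t\<in>insert s S. (\<ominus> (inv s)) \<otimes> (c t \<otimes> v t j)) = (\<ominus> (inv s)) \<otimes> (\<Oplus>t\<in>insert s S. c t \<otimes> v t j)"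
            using iv cc vS j fin by (intro finsum_rdistr[symmetric]) auto
          also have "(\<Oplus>t\<in>insert s S. ?d t \<otimes> v t j) = \<zero>" using w0[OF j] unfolding w_def .
          finally have "(\<Oplus>t\<in>insert s S. ?e t \<otimes> v t j) = \<zero>" using insert.prems(3) j iv by simp
          moreover have "(\<Oplus>t\<in>insert s S. ?e t \<otimes> v t j) = ?e s \<otimes> v s j \<oplus> (\<Oplus>t\<in>S. ?e t \<otimes> v t j)"
            using iv cc vS j insert.hyps by (intro finsum_insert) auto
          moreover have "(\<Oplus>t\<in>S. ?e t \<otimes> v t j) \<in> carrier R"
            using iv cc vS j by (intro finsum_closed) auto
          ultimately show "(\<Oplus>t\<in>S. ?e t \<otimes> v t j) = \<zero>"
            using iv cc vS j by (simp add: r_neg)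
        qed
      qed
      then show ?thesis using that by blast
    qed
    have c0: "c t = \<zero>" if t: "t \<in> S" for t
    proof (rule ccontr)
      assume "c t \<noteq> \<zero>"
      moreover have "inv t \<oplus> \<ominus> (inv s) \<noteq> \<zero>"
      proof
        assume "inv t \<oplus> \<ominus> (inv s) = \<zero>"
        then have "inv t = inv s" using iv t by (metis insertI1 insertI2 minus_equality minus_minus a_inv_closed)
        moreover have "inv (inv t) = t" "inv (inv s) = s"
          using t ST TR T0 by (auto simp: field_Units subset_iff)
        ultimately have "t = s" by metis
        then show False using t insert.hyps by simp
      qed
      ultimately show False using e0[OF t] iv cc t by (auto simp: integral_iff)
    qed
    obtain j where j: "j \<in> I" "v s j \<noteq> \<zero>" using vnz ST by blast
    have "(\<Oplus>t\<in>insert s S. c t \<otimes> v t j) = c s \<otimes> v s j \<oplus> (\<Oplus>t\<in>S. c t \<otimes> v t j)"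
      using cc vS j insert.hyps by (intro finsum_insert) auto
    moreover have "(\<Oplus>t\<in>S. c t \<otimes> v t j) = \<zero>"
      using c0 vS j by (intro add.finprod_one_eqI) auto
    ultimately have "c s \<otimes> v s j = \<zero>" using insert.prems(3) j cc vS by simp
    then have "c s = \<zero>" using cc vS j by (auto simp: integral_iff)
    then show ?case using c0 by blast
  qed
  obtain c where "c \<in> T \<rightarrow> carrier R" "\<exists>t\<in>T. c t \<noteq> \<zero>" "\<forall>j\<in>I. (\<Oplus>t\<in>T. c t \<otimes> v t j) = \<zero>"
    using homogeneous_system[of T I "\<lambda>j t. v t j"] T I vc by auto
  then show False using indep[OF T(2)] by blast
qed

lemma (in field) card_roots_of_unity_le:
  assumes "d > 0"
  shows "finite {x \<in> carrier R. x [^] d = \<one>}" "card {x \<in> carrier R. x [^] d = \<one>} \<le> d"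
proof -
  \<comment> \<open>Coefficient lists start with the leading term, so this is X^d - 1; for d > 0 the
    two outer coefficients have different positions.\<close>
  define p where "p = (\<one> # replicate (d - 1) \<zero>) @ [\<ominus> \<one>]"
  have p: "p \<in> carrier (poly_ring R)"
    by (auto simp: p_def univ_poly_carrier[symmetric] polynomial_def)
  have ev: "eval p x = x [^] d \<oplus> \<ominus> \<one>" if "x \<in> carrier R" for x
  proof -
    have "p = monom \<one> (d - 1) @ [\<ominus> \<one>]" by (simp add: p_def monom_def)
    moreover have "set (monom \<one> (d - 1)) \<subseteq> carrier R" by (auto simp: monom_def)
    ultimately have "eval p x = eval (monom \<one> (d - 1)) x \<otimes> x \<oplus> \<ominus> \<one>"
      using that by (simp only: eval_append_aux a_inv_closed one_closed)
    also have "eval (monom \<one> (d - 1)) x = x [^] (d - 1)"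
      using that eval_monom[of \<one> x "d - 1"] by simp
    also have "x [^] (d - 1) \<otimes> x = x [^] d"
      using assms by (cases d) auto
    finally show ?thesis .
  qed
  have "{x \<in> carrier R. x [^] d = \<one>} \<subseteq> set_mset (roots p)"
    using ev roots_mem_iff_is_root[OF p] by (auto simp: is_root_def r_neg p_def)
  moreover have "card (set_mset (roots p)) \<le> d"
  proof -
    have "card (set_mset (roots p)) \<le> size (roots p)"
      by (metis card_mono dual_order.trans finite_set_mset set_mset_mset size_mset card_length ex_mset)
    also have "\<dots> \<le> d" using size_roots_le_degree[OF p] assms by (simp add: p_def)
    finally show ?thesis .
  qed
  ultimately show "finite {x \<in> carrier R. x [^] d = \<one>}" "card {x \<in> carrier R. x [^] d = \<one>} \<le> d"
    by (auto intro: finite_subset card_mono[THEN order_trans])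
qed

section \<open>Finite commutative rings\<close>

lemma (in monoid) finite_idempotent_power:
  assumes "finite (carrier G)" "a \<in> carrier G"
  obtains k :: nat where "k > 0" "a [^] k \<otimes> a [^] k = a [^] k"
proof -
  have "finite (range (\<lambda>n::nat. a [^] n))"
    using assms by (auto intro: finite_subset[of _ "carrier G"])
  then have "\<not> inj (\<lambda>n::nat. a [^] n)"
    using finite_imageD infinite_UNIV_nat by blast
  then obtain m n :: nat where mn: "a [^] m = a [^] n" "m < n"
    unfolding inj_def by (metis linorder_neq_iff)
  define p where "p = n - m"
  have p: "p > 0" "n = m + p" using mn by (auto simp: p_def)
  have step: "a [^] (j + p) = a [^] j" if "j \<ge> m" for j
  proof -
    have "j = m + (j - m)" using that by simp
    then have "a [^] (j + p) = a [^] n \<otimes> a [^] (j - m)"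
      using assms p by (simp add: nat_pow_mult) (metis add.assoc add.commute)
    also have "\<dots> = a [^] j"
      using assms that by (simp add: mn(1)[symmetric] nat_pow_mult)
    finally show ?thesis .
  qed
  have steps: "a [^] (j + i * p) = a [^] j" if "j \<ge> m" for i j
  proof (induction i)
    case (Suc i)
    have "j + Suc i * p = (j + i * p) + p" by simp
    then show ?case using Suc step[of "j + i * p"] that by (metis trans_le_add1)
  qed simp
  \<comment> \<open>A multiple of the period \<open>p\<close> that is beyond the preperiod
    \<open>m\<close>; \<open>Suc m\<close> rather than \<open>m\<close> keeps it positive.\<close>
  let ?k = "Suc m * p"
  have "?k \<ge> m" using p(1) by (cases p) auto
  then have "a [^] ?k \<otimes> a [^] ?k = a [^] ?k"
    using steps[of ?k "Suc m"] assms by (simp add: nat_pow_mult)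
  then show ?thesis using that[of ?k] p by simp
qed

section \<open>Non-zero-divisors, and hyperplanes that avoid them\<close>

context cring
begin

text \<open>In a finite ring these are the units; the arguments below only ever cancel such a
  factor.\<close>

definition regular :: "'a \<Rightarrow> bool" where
  "regular u \<longleftrightarrow> u \<in> carrier R \<and> (\<forall>b\<in>carrier R. b \<otimes> u = \<zero> \<longrightarrow> b = \<zero>)"

lemma regularI: "u \<in> carrier R \<Longrightarrow> (\<And>b. b \<in> carrier R \<Longrightarrow> b \<otimes> u = \<zero> \<Longrightarrow> b = \<zero>) \<Longrightarrow> regular u"
  by (simp add: regular_def)

lemma regularD: "regular u \<Longrightarrow> b \<in> carrier R \<Longrightarrow> b \<otimes> u = \<zero> \<Longrightarrow> b = \<zero>"
  by (simp add: regular_def)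

lemma regular_closed: "regular u \<Longrightarrow> u \<in> carrier R"
  by (simp add: regular_def)

text \<open>From b (1 + j) = 0 follows b = -j b, and iterating this \<open>k\<close> times gives
  zero.\<close>

lemma regular_one_plus_nilpotent:
  assumes j: "j \<in> carrier R" "j [^] (k::nat) = \<zero>"
  shows "regular (\<one> \<oplus> j)"
proof (rule regularI)
  fix b assume b: "b \<in> carrier R" "b \<otimes> (\<one> \<oplus> j) = \<zero>"
  have eq: "b = \<ominus> j \<otimes> b"
  proof -
    have "b = b \<otimes> (\<one> \<oplus> j) \<oplus> (\<ominus> j) \<otimes> b" using b(1) j(1) by algebra
    then show ?thesis using b j by simp
  qed
  have "b = (\<ominus> j) [^] i \<otimes> b" for i :: nat
  proof (induction i)
    case (Suc i)
    have "(\<ominus> j) [^] Suc i \<otimes> b = (\<ominus> j) [^] i \<otimes> (\<ominus> j \<otimes> b)"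
      using b(1) j(1) by (simp add: m_assoc)
    then show ?case using eq Suc by simp
  qed (use b in simp)
  then have "b = (\<ominus> j) [^] k \<otimes> b" .
  moreover have "(\<ominus> j) [^] k = \<zero>"
  proof -
    have "(\<ominus> j) [^] k = (\<ominus> \<one> \<otimes> j) [^] k" using j(1) by (simp add: l_minus)
    also have "\<dots> = (\<ominus> \<one>) [^] k \<otimes> j [^] k" using j(1) by (intro nat_pow_distrib) auto
    finally show ?thesis using j by simp
  qed
  ultimately show "b = \<zero>" using b(1) by simp
qed (use j in simp)

text \<open>Each idempotent \<open>e\<close> has \<open>e\<close> or \<open>1 - e\<close> in the largest ideal below \<open>W\<close>, because otherwise
  some regular element \<open>e u + \<kappa> (1 - e) v\<close> lies in \<open>W\<close>. As some power of any element is
  idempotent, every element outside this ideal is regular modulo it.\<close>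

lemma ideal_if_avoids_regular:
  assumes fin: "finite (carrier R)"
    and W: "additive_subgroup W R"
    and avoid: "\<And>u. u \<in> W \<Longrightarrow> \<not> regular u"
    and H: "\<And>u. u \<in> H \<Longrightarrow> regular u"
    and gen: "\<And>a b. a \<in> carrier R \<Longrightarrow> (\<And>u. u \<in> H \<Longrightarrow> a \<otimes> u \<in> W) \<Longrightarrow> b \<in> carrier R \<Longrightarrow> a \<otimes> b \<in> W"
    and line: "\<And>a b. a \<in> carrier R - W \<Longrightarrow> b \<in> carrier R - W \<Longrightarrow> \<exists>\<kappa>. regular \<kappa> \<and> a \<oplus> \<kappa> \<otimes> b \<in> W"
    and a: "a \<in> W" and b: "b \<in> carrier R"
  shows "a \<otimes> b \<in> W"
proof -
  interpret W: additive_subgroup W R by (rule W)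
  \<comment> \<open>The largest ideal contained in \<open>W\<close>; the goal is that it exhausts
    \<open>W\<close>.\<close>
  define J where "J = {x \<in> carrier R. \<forall>y\<in>carrier R. x \<otimes> y \<in> W}"
  have JW: "x \<in> W" if "x \<in> J" for x
  proof -
    have "x \<otimes> \<one> \<in> W" using that unfolding J_def by blast
    then show ?thesis using that by (simp add: J_def)
  qed
  \<comment> \<open>By \<open>gen\<close>, failure to lie in \<open>J\<close> is already visible on
    a regular multiplier from \<open>H\<close>.\<close>
  have outside: "\<exists>u\<in>H. x \<otimes> u \<in> carrier R - W" if "x \<in> carrier R" "x \<notin> J" for x
    using that gen[OF that(1)] H regular_closed unfolding J_def by blast
  have one: "\<one> \<in> carrier R - W"
    using avoid[of \<one>] by (auto simp: regular_def)
  \<comment> \<open>For a nilpotent outside \<open>J\<close>, \<open>line\<close> would place 1 plus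
    a nilpotent, a regular element, in \<open>W\<close>.\<close>
  have nilp: "x \<in> J" if x: "x \<in> carrier R" "x [^] (k::nat) = \<zero>" for x k
  proof (rule ccontr)
    assume "x \<notin> J"
    then obtain u where u: "u \<in> H" "x \<otimes> u \<in> carrier R - W" using outside x by blast
    then obtain \<kappa> where \<kappa>: "regular \<kappa>" "\<one> \<oplus> \<kappa> \<otimes> (x \<otimes> u) \<in> W" using line[OF one] by blast
    have uc: "u \<in> carrier R" "\<kappa> \<in> carrier R" using H u(1) \<kappa> regular_closed by auto
    have "(\<kappa> \<otimes> (x \<otimes> u)) [^] k = \<kappa> [^] k \<otimes> (x [^] k \<otimes> u [^] k)"
      using x(1) uc by (simp add: nat_pow_distrib)
    then have "(\<kappa> \<otimes> (x \<otimes> u)) [^] k = \<zero>" using x uc by simp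
    then have "regular (\<one> \<oplus> \<kappa> \<otimes> (x \<otimes> u))"
      using x(1) uc by (intro regular_one_plus_nilpotent) auto
    then show False using \<kappa> avoid by blast
  qed
  have idem: "e \<in> J \<or> \<one> \<ominus> e \<in> J" if e: "e \<in> carrier R" "e \<otimes> e = e" for e
  proof (rule ccontr)
    assume *: "\<not> ?thesis"
    let ?f = "\<one> \<ominus> e"
    have f: "?f \<in> carrier R" "?f \<otimes> ?f = ?f" "?f \<otimes> e = \<zero>" "e \<otimes> ?f = \<zero>"
    proof -
      show "?f \<in> carrier R" using e by simp
      have "?f \<otimes> ?f = \<one> \<ominus> e \<ominus> e \<oplus> e \<otimes> e" using e(1) by algebra
      also have "\<dots> = ?f" unfolding e(2) using e(1) by algebra
      finally show "?f \<otimes> ?f = ?f" .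
      have "?f \<otimes> e = e \<ominus> e \<otimes> e" using e(1) by algebra
      then show "?f \<otimes> e = \<zero>" using e by (simp add: a_minus_def r_neg)
      then show "e \<otimes> ?f = \<zero>" using e by (simp add: m_comm)
    qed
    have "e \<notin> J" "?f \<notin> J" using * by auto
    then obtain u v where u: "u \<in> H" "e \<otimes> u \<in> carrier R - W" and v: "v \<in> H" "?f \<otimes> v \<in> carrier R - W"
      using outside[OF e(1) \<open>e \<notin> J\<close>] outside[OF f(1) \<open>?f \<notin> J\<close>] by (elim bexE)
    obtain \<kappa> where \<kappa>: "regular \<kappa>" "e \<otimes> u \<oplus> \<kappa> \<otimes> (?f \<otimes> v) \<in> W" using line[OF u(2) v(2)] by (elim exE conjE)
    have c: "u \<in> carrier R" "v \<in> carrier R" "\<kappa> \<in> carrier R"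
      using H u v \<kappa> regular_closed by auto
    \<comment> \<open>Multiplying by \<open>e\<close> and by \<open>?f\<close> separates the two
      summands, after which \<open>u\<close>, \<open>v\<close> and \<kappa> can be
      cancelled.\<close>
    have "regular (e \<otimes> u \<oplus> \<kappa> \<otimes> (?f \<otimes> v))"
    proof (rule regularI)
      fix b assume b: "b \<in> carrier R" "b \<otimes> (e \<otimes> u \<oplus> \<kappa> \<otimes> (?f \<otimes> v)) = \<zero>"
      have "(b \<otimes> e) \<otimes> u = (b \<otimes> (e \<otimes> u \<oplus> \<kappa> \<otimes> (?f \<otimes> v))) \<otimes> e"
      proof -
        have "(b \<otimes> (e \<otimes> u \<oplus> \<kappa> \<otimes> (?f \<otimes> v))) \<otimes> e = b \<otimes> (e \<otimes> e) \<otimes> u \<oplus> b \<otimes> \<kappa> \<otimes> (?f \<otimes> e) \<otimes> v"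
          using b(1) c e(1) f(1) by algebra
        then show ?thesis using e f b(1) c by simp
      qed
      then have "(b \<otimes> e) \<otimes> u = \<zero>" unfolding b(2) using e(1) by simp
      then have be: "b \<otimes> e = \<zero>" using regularD[OF H[OF u(1)]] b(1) e(1) by simp
      have "((b \<otimes> ?f) \<otimes> v) \<otimes> \<kappa> = (b \<otimes> (e \<otimes> u \<oplus> \<kappa> \<otimes> (?f \<otimes> v))) \<otimes> ?f"
      proof -
        have "(b \<otimes> (e \<otimes> u \<oplus> \<kappa> \<otimes> (?f \<otimes> v))) \<otimes> ?f = b \<otimes> (e \<otimes> ?f) \<otimes> u \<oplus> b \<otimes> (?f \<otimes> ?f) \<otimes> v \<otimes> \<kappa>"
          using b(1) c e(1) f(1) by algebra
        then show ?thesis using e f b(1) c by simp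
      qed
      then have "((b \<otimes> ?f) \<otimes> v) \<otimes> \<kappa> = \<zero>" unfolding b(2) using f(1) by simp
      then have "(b \<otimes> ?f) \<otimes> v = \<zero>" using regularD[OF \<kappa>(1)] b(1) f(1) c by simp
      then have bf: "b \<otimes> ?f = \<zero>" using regularD[OF H[OF v(1)]] b(1) f(1) by simp
      have "b = b \<otimes> e \<oplus> b \<otimes> ?f" using b(1) e(1) by algebra
      then show "b = \<zero>" unfolding be bf by simp
    qed (use c e f in simp)
    then show False using \<kappa> avoid by blast
  qed
  have ac: "a \<in> carrier R" using a W.a_subset by blast
  obtain k :: nat where k: "k > 0" "a [^] k \<otimes> a [^] k = a [^] k"
    using finite_idempotent_power[OF fin ac] by blast
  \<comment> \<open>Fitting decomposition: \<open>h\<close> projects onto the part of the ring where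
    \<open>a\<close> is invertible, \<open>f\<close> onto the part where \<open>a\<close> is
    nilpotent.\<close>
  define h where "h = a [^] k"
  define f where "f = \<one> \<ominus> h"
  have h: "h \<in> carrier R" "h \<otimes> h = h" and f: "f \<in> carrier R" using k ac by (auto simp: h_def f_def)
  have ff: "f \<otimes> f = f" "f \<otimes> h = \<zero>"
  proof -
    have "f \<otimes> f = \<one> \<ominus> h \<ominus> h \<oplus> h \<otimes> h" unfolding f_def using h(1) by algebra
    also have "\<dots> = f" unfolding h(2) f_def using h(1) by algebra
    finally show "f \<otimes> f = f" .
    have "f \<otimes> h = h \<ominus> h \<otimes> h" unfolding f_def using h(1) by algebra
    then show "f \<otimes> h = \<zero>" using h by (simp add: a_minus_def r_neg)
  qed
  have fpow: "f [^] Suc i = f" for i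
    by (induction i) (use f ff in auto)
  have "(a \<otimes> f) [^] k = h \<otimes> f"
    using ac f fpow[of "k - 1"] k(1) by (simp add: nat_pow_distrib h_def)
  then have "(a \<otimes> f) [^] k = \<zero>" using ff h(1) f by (simp add: m_comm)
  then have afJ: "a \<otimes> f \<in> J" using nilp ac f by blast
  have asplit: "a = a \<otimes> f \<oplus> h \<otimes> a" unfolding f_def using ac h(1) by algebra
  have "h \<in> J"
  proof (rule ccontr)
    assume "h \<notin> J"
    then have fJ: "f \<in> J" using idem[OF h] f_def by auto
    \<comment> \<open>On the \<open>h\<close>-part this element is \<open>a\<close>, which divides
      \<open>h\<close>; on the \<open>f\<close>-part it is 1.\<close>
    have "regular (h \<otimes> a \<oplus> f)"
    proof (rule regularI)
      fix b assume b: "b \<in> carrier R" "b \<otimes> (h \<otimes> a \<oplus> f) = \<zero>"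
      have "b \<otimes> f = (b \<otimes> (h \<otimes> a \<oplus> f)) \<otimes> f"
      proof -
        have "(b \<otimes> (h \<otimes> a \<oplus> f)) \<otimes> f = b \<otimes> a \<otimes> (f \<otimes> h) \<oplus> b \<otimes> (f \<otimes> f)"
          using b(1) h(1) ac f by algebra
        then show ?thesis using ff b(1) ac f by simp
      qed
      then have bf: "b \<otimes> f = \<zero>" using b f by simp
      have "b \<otimes> (h \<otimes> a \<oplus> f) = b \<otimes> h \<otimes> a \<oplus> b \<otimes> f" using b(1) h(1) ac f by algebra
      then have bha: "b \<otimes> h \<otimes> a = \<zero>" using b(2) bf b(1) h(1) ac by simp
      obtain i where i: "k = Suc i" using k(1) by (cases k) auto
      have "b \<otimes> h = b \<otimes> h \<otimes> h" using h b(1) by (simp add: m_assoc)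
      also have "\<dots> = b \<otimes> h \<otimes> (a [^] i \<otimes> a)" unfolding i h_def by simp
      also have "\<dots> = (b \<otimes> h \<otimes> a) \<otimes> a [^] i" using b(1) h(1) ac by (simp add: m_ac)
      finally have bh: "b \<otimes> h = \<zero>" using bha ac by simp
      have "b = b \<otimes> h \<oplus> b \<otimes> f" unfolding f_def using b(1) h(1) by algebra
      then show "b = \<zero>" unfolding bh bf by simp
    qed (use h ac f in simp)
    moreover have "h \<otimes> a \<oplus> f \<in> W"
    proof -
      \<comment> \<open>It differs from \<open>a\<close> by elements of \<open>J\<close>, so the
        regular element would lie in \<open>W\<close>.\<close>
      have "h \<otimes> a \<oplus> f = (a \<oplus> \<ominus> (a \<otimes> f)) \<oplus> f"
        unfolding f_def using ac h(1) by algebra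
      then show ?thesis using a JW[OF afJ] JW[OF fJ] by (simp add: W.a_closed W.a_inv_closed)
    qed
    ultimately show False using avoid by blast
  qed
  then have "(a \<otimes> f) \<otimes> b \<in> W" "h \<otimes> (a \<otimes> b) \<in> W"
    using afJ ac b by (auto simp: J_def)
  moreover have "a \<otimes> b = (a \<otimes> f) \<otimes> b \<oplus> h \<otimes> (a \<otimes> b)"
    unfolding f_def using ac h(1) b by algebra
  ultimately show ?thesis by (metis W.a_closed)
qed

end

text \<open>Property \<open>ann\<close> says that every principal ideal is its own double annihilator. One
  minimizes the annihilator of \<open>x\<close>; if it is nonzero, replacing the component of \<open>x\<close> along a
  suitable local idempotent makes it smaller.\<close>

lemma (in module) exists_free_element:
  assumes fin: "finite (carrier R)"
    and faithful: "\<And>a. a \<in> carrier R \<Longrightarrow> (\<And>x. x \<in> carrier M \<Longrightarrow> a \<odot>\<^bsub>M\<^esub> x = \<zero>\<^bsub>M\<^esub>) \<Longrightarrow> a = \<zero>"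
    and ann: "\<And>s s'. s \<in> carrier R \<Longrightarrow> s' \<in> carrier R \<Longrightarrow>
      (\<And>b. b \<in> carrier R \<Longrightarrow> s \<otimes> b = \<zero> \<Longrightarrow> s' \<otimes> b = \<zero>) \<Longrightarrow> \<exists>c\<in>carrier R. s' = s \<otimes> c"
  shows "\<exists>x\<in>carrier M. \<forall>a\<in>carrier R. a \<odot>\<^bsub>M\<^esub> x = \<zero>\<^bsub>M\<^esub> \<longrightarrow> a = \<zero>"
proof -
  \<comment> \<open>The ring being finite, cardinalities of annihilators and of principal ideals
    serve to choose minimal ones.\<close>
  define Ann where "Ann = (\<lambda>x. {a \<in> carrier R. a \<odot>\<^bsub>M\<^esub> x = \<zero>\<^bsub>M\<^esub>})"
  define Id where "Id = (\<lambda>a. (\<lambda>c. a \<otimes> c) ` carrier R)"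
  have finI: "finite (Id a)" "finite (Ann x)" for a x using fin by (auto simp: Id_def Ann_def)
  have Idmono: "Id (a \<otimes> c) \<subseteq> Id a" if "a \<in> carrier R" "c \<in> carrier R" for a c
    using that by (auto simp: Id_def m_assoc)
  have Idself: "a \<in> Id a" if "a \<in> carrier R" for a
    using that unfolding Id_def by (metis imageI one_closed r_one)
  obtain x where x: "x \<in> carrier M" and xmin: "\<And>z. z \<in> carrier M \<Longrightarrow> card (Ann x) \<le> card (Ann z)"
    using ex_has_least_nat[of "\<lambda>x. x \<in> carrier M" "\<zero>\<^bsub>M\<^esub>" "\<lambda>x. card (Ann x)"] by auto
  have "Ann x \<subseteq> {\<zero>}"
  proof (rule ccontr)
    assume "\<not> Ann x \<subseteq> {\<zero>}"
    then obtain s0 where s0: "s0 \<in> Ann x - {\<zero>}" by blast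
    \<comment> \<open>A generator of a smallest nonzero principal ideal inside the annihilator of
      \<open>x\<close>.\<close>
    obtain s where s: "s \<in> Ann x" "s \<noteq> \<zero>"
      and smin: "\<And>t. t \<in> Ann x \<Longrightarrow> t \<noteq> \<zero> \<Longrightarrow> card (Id s) \<le> card (Id t)"
      using ex_has_least_nat[of "\<lambda>s. s \<in> Ann x - {\<zero>}", OF s0, of "\<lambda>s. card (Id s)"] by auto
    have sc: "s \<in> carrier R" and sx: "s \<odot>\<^bsub>M\<^esub> x = \<zero>\<^bsub>M\<^esub>" using s by (auto simp: Ann_def)
    obtain y where y: "y \<in> carrier M" "s \<odot>\<^bsub>M\<^esub> y \<noteq> \<zero>\<^bsub>M\<^esub>" using faithful sc s(2) by blast
    \<comment> \<open>The smallest idempotent that fixes \<open>s\<close> cuts out the local factor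
      of the ring in which \<open>s\<close> lives.\<close>
    obtain e where e: "e \<in> carrier R" "e \<otimes> e = e" "e \<otimes> s = s"
      and emin: "\<And>g. g \<in> carrier R \<Longrightarrow> g \<otimes> g = g \<Longrightarrow> g \<otimes> s = s \<Longrightarrow> card (Id e) \<le> card (Id g)"
      using ex_has_least_nat[of "\<lambda>e. e \<in> carrier R \<and> e \<otimes> e = e \<and> e \<otimes> s = s" \<one> "\<lambda>e. card (Id e)"] sc
      by auto
    let ?f = "\<one> \<ominus> e"
    have f: "?f \<in> carrier R" "?f \<otimes> e = \<zero>" "e \<otimes> ?f = \<zero>" "?f \<otimes> ?f = ?f"
    proof -
      show "?f \<in> carrier R" using e by simp
      have "?f \<otimes> ?f = \<one> \<ominus> e \<ominus> e \<oplus> e \<otimes> e" using e(1) by algebra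
      also have "\<dots> = ?f" unfolding e(2) using e(1) by algebra
      finally show "?f \<otimes> ?f = ?f" .
      have "?f \<otimes> e = e \<ominus> e \<otimes> e" using e(1) by algebra
      then show "?f \<otimes> e = \<zero>" using e by (simp add: a_minus_def R.r_neg)
      then show "e \<otimes> ?f = \<zero>" using e by (simp add: m_comm)
    qed
    \<comment> \<open>\<open>x\<close> with its component along \<open>e\<close> replaced by that of
      \<open>y\<close>.\<close>
    define z where "z = ?f \<odot>\<^bsub>M\<^esub> x \<oplus>\<^bsub>M\<^esub> e \<odot>\<^bsub>M\<^esub> y"
    have z: "z \<in> carrier M" unfolding z_def using f e x y by simp
    have act_z: "a \<odot>\<^bsub>M\<^esub> z = (a \<otimes> ?f) \<odot>\<^bsub>M\<^esub> x \<oplus>\<^bsub>M\<^esub> (a \<otimes> e) \<odot>\<^bsub>M\<^esub> y" if "a \<in> carrier R" for a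
      unfolding z_def using that f(1) e(1) x y(1) by (simp add: smult_r_distr smult_assoc1)
    \<comment> \<open>Otherwise \<open>z\<close> would have a strictly smaller annihilator than
      \<open>x\<close>: \<open>s\<close> leaves it and nothing enters.\<close>
    have "\<exists>t. t \<in> carrier R \<and> t \<noteq> \<zero> \<and> e \<otimes> t = t \<and> t \<odot>\<^bsub>M\<^esub> y = \<zero>\<^bsub>M\<^esub>"
    proof (rule ccontr)
      assume "\<not> ?thesis"
      then have none: "\<And>t. t \<in> carrier R \<Longrightarrow> e \<otimes> t = t \<Longrightarrow> t \<odot>\<^bsub>M\<^esub> y = \<zero>\<^bsub>M\<^esub> \<Longrightarrow> t = \<zero>" by blast
      have "Ann z \<subseteq> Ann x"
      proof
        fix a assume "a \<in> Ann z"
        then have a: "a \<in> carrier R" and az: "a \<odot>\<^bsub>M\<^esub> z = \<zero>\<^bsub>M\<^esub>" by (auto simp: Ann_def)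
        have "(e \<otimes> a) \<otimes> ?f = \<zero>" "(e \<otimes> a) \<otimes> e = a \<otimes> e"
        proof -
          have "(e \<otimes> a) \<otimes> ?f = a \<otimes> (e \<otimes> ?f)" using e(1) a by algebra
          then show "(e \<otimes> a) \<otimes> ?f = \<zero>" using f a by simp
          have "(e \<otimes> a) \<otimes> e = a \<otimes> (e \<otimes> e)" using e(1) a by algebra
          then show "(e \<otimes> a) \<otimes> e = a \<otimes> e" using e by simp
        qed
        moreover have "(e \<otimes> a) \<odot>\<^bsub>M\<^esub> z = \<zero>\<^bsub>M\<^esub>" using a e z az by (simp add: smult_assoc1)
        ultimately have "(a \<otimes> e) \<odot>\<^bsub>M\<^esub> y = \<zero>\<^bsub>M\<^esub>"
          using act_z[of "e \<otimes> a"] a e x y by simp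
        moreover have "e \<otimes> (a \<otimes> e) = a \<otimes> e" using a e by (simp add: m_lcomm)
        ultimately have ae: "a \<otimes> e = \<zero>" using none a e by simp
        then have "(a \<otimes> ?f) \<odot>\<^bsub>M\<^esub> x = \<zero>\<^bsub>M\<^esub>" using act_z[OF a] az a f x y by simp
        moreover have "a \<otimes> ?f = a \<ominus> a \<otimes> e" using a e(1) by algebra
        ultimately show "a \<in> Ann x" using ae a by (simp add: Ann_def a_minus_def)
      qed
      moreover have "s \<notin> Ann z"
      proof -
        have se: "s \<otimes> e = s" using e sc by (simp add: m_comm)
        have "s \<otimes> ?f = s \<ominus> s \<otimes> e" using sc e(1) by algebra
        then have "s \<otimes> ?f = \<zero>" using se sc by (simp add: a_minus_def R.r_neg)
        then have "s \<odot>\<^bsub>M\<^esub> z = s \<odot>\<^bsub>M\<^esub> y" using act_z[OF sc] se x y sc by simp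
        then show ?thesis using y by (simp add: Ann_def)
      qed
      ultimately have "Ann z \<subset> Ann x" using s by blast
      then show False using xmin[OF z] finI psubset_card_mono by (metis leD)
    qed
    then obtain t0 where t0: "t0 \<in> carrier R \<and> t0 \<noteq> \<zero> \<and> e \<otimes> t0 = t0 \<and> t0 \<odot>\<^bsub>M\<^esub> y = \<zero>\<^bsub>M\<^esub>"
      by blast
    obtain t where t: "t \<in> carrier R" "t \<noteq> \<zero>" "e \<otimes> t = t" "t \<odot>\<^bsub>M\<^esub> y = \<zero>\<^bsub>M\<^esub>"
      and tmin: "\<And>r. r \<in> carrier R \<Longrightarrow> r \<noteq> \<zero> \<Longrightarrow> e \<otimes> r = r \<Longrightarrow> r \<odot>\<^bsub>M\<^esub> y = \<zero>\<^bsub>M\<^esub> \<Longrightarrow> card (Id t) \<le> card (Id r)"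
      using ex_has_least_nat[of "\<lambda>t. t \<in> carrier R \<and> t \<noteq> \<zero> \<and> e \<otimes> t = t \<and> t \<odot>\<^bsub>M\<^esub> y = \<zero>\<^bsub>M\<^esub>", OF t0, of "\<lambda>t. card (Id t)"]
      by blast
    \<comment> \<open>This is the hypothesis of \<open>ann\<close> for \<open>s\<close> and
      \<open>t\<close>. A \<open>b\<close> that kills \<open>s\<close> is nilpotent on the local
      factor of \<open>e\<close>, because an idempotent power of \<open>b\<close> is killed by
      \<open>e\<close>.\<close>
    have "t \<otimes> b = \<zero>" if b: "b \<in> carrier R" "s \<otimes> b = \<zero>" for b
    proof (rule ccontr)
      assume tb: "t \<otimes> b \<noteq> \<zero>"
      obtain k :: nat where k: "k > 0" "b [^] k \<otimes> b [^] k = b [^] k"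
        using R.finite_idempotent_power[OF fin b(1)] by blast
      define h where "h = b [^] k"
      have h: "h \<in> carrier R" "h \<otimes> h = h" using k b by (auto simp: h_def)
      have "h \<otimes> s = \<zero>"
      proof -
        obtain i where "k = Suc i" using k(1) by (cases k) auto
        then have "h \<otimes> s = b [^] i \<otimes> (s \<otimes> b)" using b(1) sc by (simp add: h_def m_ac)
        then show ?thesis using b by simp
      qed
      \<comment> \<open>An idempotent below \<open>e\<close> that still fixes \<open>s\<close>;
        minimality of \<open>e\<close> makes \<open>e\<close> a multiple of \<open>g\<close>, and
        \<open>g\<close> kills \<open>h\<close>.\<close>
      define g where "g = e \<otimes> (\<one> \<ominus> h)"
      have g: "g \<in> carrier R" unfolding g_def using e h by simp
      have gh: "g \<otimes> h = \<zero>"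
      proof -
        have "g \<otimes> h = e \<otimes> (h \<ominus> h \<otimes> h)" unfolding g_def using e(1) h(1) by algebra
        then show ?thesis using e h by (simp add: a_minus_def R.r_neg)
      qed
      have eg: "e \<otimes> g = g" unfolding g_def using e h by (simp add: m_assoc[symmetric])
      have "g \<otimes> g = e \<otimes> g \<ominus> e \<otimes> (g \<otimes> h)"
      proof -
        have "g \<otimes> g = g \<otimes> (e \<otimes> (\<one> \<ominus> h))" by (subst (2) g_def) (rule refl)
        also have "\<dots> = e \<otimes> g \<ominus> e \<otimes> (g \<otimes> h)" using e(1) h(1) g by algebra
        finally show ?thesis .
      qed
      then have gg: "g \<otimes> g = g" using eg gh e g by (simp add: a_minus_def)
      have "g \<otimes> s = e \<otimes> s \<ominus> e \<otimes> (h \<otimes> s)" unfolding g_def using e(1) h(1) sc by algebra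
      then have gs: "g \<otimes> s = s" using e sc \<open>h \<otimes> s = \<zero>\<close> by (simp add: a_minus_def)
      have "Id g \<subseteq> Id e" using Idmono[of e "\<one> \<ominus> h"] e h by (simp add: g_def)
      then have "Id g = Id e" using emin[OF g gg gs] finI by (simp add: card_seteq)
      then obtain c where c: "c \<in> carrier R" "e = g \<otimes> c" using Idself[OF e(1)] by (auto simp: Id_def)
      have "e \<otimes> h = (g \<otimes> h) \<otimes> c" unfolding c(2) using g h c(1) by (simp add: m_ac)
      then have eh: "e \<otimes> h = \<zero>" using gh c by simp
      \<comment> \<open>\<open>t \<otimes> b\<close> is another candidate in the choice of
        \<open>t\<close>. Minimality makes \<open>t\<close> a multiple of it, and iteration brings
        in the power \<open>h\<close>, which \<open>e\<close> kills.\<close>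
      have "Id (t \<otimes> b) \<subseteq> Id t" using Idmono t b by simp
      moreover have "card (Id t) \<le> card (Id (t \<otimes> b))"
      proof (rule tmin)
        show "e \<otimes> (t \<otimes> b) = t \<otimes> b" using e t b by (simp add: m_assoc[symmetric])
        have "(t \<otimes> b) \<odot>\<^bsub>M\<^esub> y = b \<odot>\<^bsub>M\<^esub> (t \<odot>\<^bsub>M\<^esub> y)" using t(1) b(1) y(1) by (simp add: smult_assoc1[symmetric] m_comm)
        then show "(t \<otimes> b) \<odot>\<^bsub>M\<^esub> y = \<zero>\<^bsub>M\<^esub>" using t b by simp
      qed (use t b tb in auto)
      ultimately have "Id (t \<otimes> b) = Id t" using finI by (simp add: card_seteq)
      then obtain d where d: "d \<in> carrier R" "t = t \<otimes> b \<otimes> d" using Idself[OF t(1)] by (auto simp: Id_def)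
      have "t = t \<otimes> (b [^] i \<otimes> d [^] i)" for i :: nat
      proof (induction i)
        case (Suc i)
        have "t \<otimes> (b [^] Suc i \<otimes> d [^] Suc i) = (t \<otimes> b \<otimes> d) \<otimes> (b [^] i \<otimes> d [^] i)"
          using t b d(1) by (simp add: m_ac)
        then show ?case using d(2) Suc by simp
      qed (use t in simp)
      then have "t = t \<otimes> (h \<otimes> d [^] k)" unfolding h_def .
      then have "t = (e \<otimes> t) \<otimes> (h \<otimes> d [^] k)" using t by simp
      also have "\<dots> = (e \<otimes> h) \<otimes> (t \<otimes> d [^] k)" using e(1) t(1) h(1) d(1) by (simp add: m_ac)
      finally show False using eh t d by simp
    qed
    then obtain c where c: "c \<in> carrier R" "t = s \<otimes> c" using ann[OF sc t(1)] by blast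
    have "t \<odot>\<^bsub>M\<^esub> x = c \<odot>\<^bsub>M\<^esub> (s \<odot>\<^bsub>M\<^esub> x)" unfolding c(2) using c(1) sc x by (simp add: smult_assoc1[symmetric] m_comm)
    then have "t \<in> Ann x" using sx c t by (simp add: Ann_def)
    \<comment> \<open>Minimality of \<open>s\<close> turns the inclusion of ideals into an equality,
      so \<open>s\<close> would kill \<open>y\<close> along with \<open>t\<close>.\<close>
    then have "card (Id s) \<le> card (Id t)" using smin t by blast
    moreover have "Id t \<subseteq> Id s" using Idmono c sc by simp
    ultimately have "Id t = Id s" using finI by (simp add: card_seteq)
    then obtain b where b: "b \<in> carrier R" "s = t \<otimes> b" using Idself[OF sc] by (auto simp: Id_def)
    have "s \<odot>\<^bsub>M\<^esub> y = b \<odot>\<^bsub>M\<^esub> (t \<odot>\<^bsub>M\<^esub> y)" unfolding b(2) using b(1) t(1) y(1) by (simp add: smult_assoc1[symmetric] m_comm)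
    then show False using y t b by simp
  qed
  then show ?thesis using x by (auto simp: Ann_def)
qed

section \<open>Galois conjugates and the trace form\<close>

context finite_galois_extension
begin

abbreviation Gal :: "('a \<Rightarrow> 'a) set" where "Gal \<equiv> carrier (galois_group L K)"

sublocale Gal: group "galois_group L K"
  using group_galois_group subfieldE(3)[OF subfield] .

lemma K_closed [simp]: "k \<in> K \<Longrightarrow> k \<in> carrier L"
  using subfieldE(3)[OF subfield] by auto

lemmas K_subring = subringE[OF subfieldE(1)[OF subfield]]

lemma Gal_hom: "\<tau> \<in> Gal \<Longrightarrow> \<tau> \<in> ring_hom L L"
  and Gal_Bij: "\<tau> \<in> Gal \<Longrightarrow> \<tau> \<in> Bij (carrier L)"
  and Gal_fixes [simp]: "\<tau> \<in> Gal \<Longrightarrow> k \<in> K \<Longrightarrow> \<tau> k = k"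
  by (auto simp: galois_group_def field_auts_def)

lemma Gal_ring_hom_cring: "\<tau> \<in> Gal \<Longrightarrow> ring_hom_cring L L \<tau>"
  by (intro ring_hom_cring.intro ring_hom_cring_axioms.intro is_cring Gal_hom)

lemma Gal_closed [simp]: "\<tau> \<in> Gal \<Longrightarrow> x \<in> carrier L \<Longrightarrow> \<tau> x \<in> carrier L"
  using ring_hom_closed[OF Gal_hom] .

lemma Gal_mult [simp]: "\<tau> \<in> Gal \<Longrightarrow> x \<in> carrier L \<Longrightarrow> y \<in> carrier L \<Longrightarrow> \<tau> (x \<otimes> y) = \<tau> x \<otimes> \<tau> y"
  using ring_hom_mult[OF Gal_hom] .

lemma Gal_add [simp]: "\<tau> \<in> Gal \<Longrightarrow> x \<in> carrier L \<Longrightarrow> y \<in> carrier L \<Longrightarrow> \<tau> (x \<oplus> y) = \<tau> x \<oplus> \<tau> y"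
  using ring_hom_add[OF Gal_hom] .

lemma Gal_one [simp]: "\<tau> \<in> Gal \<Longrightarrow> \<tau> \<one> = \<one>"
  using ring_hom_one[OF Gal_hom] .

lemma Gal_zero [simp]: "\<tau> \<in> Gal \<Longrightarrow> \<tau> \<zero> = \<zero>"
  using Gal_fixes[OF _ K_subring(2)] .

lemma Gal_comp [simp]:
  "\<pi> \<in> Gal \<Longrightarrow> \<tau> \<in> Gal \<Longrightarrow> x \<in> carrier L \<Longrightarrow> (\<pi> \<otimes>\<^bsub>galois_group L K\<^esub> \<tau>) x = \<pi> (\<tau> x)"
proof -
  assume "\<pi> \<in> Gal" "\<tau> \<in> Gal" and x: "x \<in> carrier L"
  then have "\<pi> \<in> Bij (carrier L)" "\<tau> \<in> Bij (carrier L)" by (auto intro: Gal_Bij)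
  then have "\<pi> \<otimes>\<^bsub>galois_group L K\<^esub> \<tau> = compose (carrier L) \<pi> \<tau>"
    by (simp add: galois_group_def BijGroup_def)
  then show ?thesis using x by (simp add: compose_def)
qed

lemma Gal_id [simp]: "x \<in> carrier L \<Longrightarrow> \<one>\<^bsub>galois_group L K\<^esub> x = x"
  by (simp add: galois_group_def BijGroup_def)

lemma Gal_inv_apply [simp]:
  assumes "\<tau> \<in> Gal" "x \<in> carrier L"
  shows "(inv\<^bsub>galois_group L K\<^esub> \<tau>) (\<tau> x) = x" "\<tau> ((inv\<^bsub>galois_group L K\<^esub> \<tau>) x) = x"
  using assms by (simp_all flip: Gal_comp)

lemma Gal_nonzero: "\<tau> \<in> Gal \<Longrightarrow> x \<in> carrier L \<Longrightarrow> x \<noteq> \<zero> \<Longrightarrow> \<tau> x \<noteq> \<zero>"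
  by (metis Gal.inv_closed Gal_inv_apply(1) Gal_zero)

lemma Gal_finsum:
  "\<tau> \<in> Gal \<Longrightarrow> f \<in> A \<rightarrow> carrier L \<Longrightarrow> \<tau> (\<Oplus>i\<in>A. f i) = (\<Oplus>i\<in>A. \<tau> (f i))"
  using ring_hom_cring.hom_finsum[OF Gal_ring_hom_cring] by (simp add: comp_def)

lemma Gal_ext:
  assumes "\<pi> \<in> Gal" "\<tau> \<in> Gal" "\<And>x. x \<in> carrier L \<Longrightarrow> \<pi> x = \<tau> x"
  shows "\<pi> = \<tau>"
  using Gal_Bij[OF assms(1)] Gal_Bij[OF assms(2)] assms(3)
  by (auto simp: Bij_def intro: extensionalityI)

lemma in_K_if_fixed: "x \<in> carrier L \<Longrightarrow> (\<And>\<pi>. \<pi> \<in> Gal \<Longrightarrow> \<pi> x = x) \<Longrightarrow> x \<in> K"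
  using fixed_field by auto

text \<open>Replacing \<open>x\<close> by x y and subtracting \<rho>(y) times the relation removes
  the term at \<rho>; \<open>y\<close> is chosen where \<pi> and \<rho> differ. Evaluation at 1 then
  disposes of the coefficient of \<rho>.\<close>

lemma dedekind_independence:
  assumes "finite S" "S \<subseteq> Gal" "c \<in> S \<rightarrow> carrier L"
    and "\<And>x. x \<in> carrier L \<Longrightarrow> (\<Oplus>\<pi>\<in>S. c \<pi> \<otimes> \<pi> x) = \<zero>"
  shows "\<forall>\<pi>\<in>S. c \<pi> = \<zero>"
  using assms
proof (induction S arbitrary: c)
  case empty
  then show ?case by simp
next
  case (insert \<rho> S)
  have \<rho>: "\<rho> \<in> Gal" and S: "\<And>\<pi>. \<pi> \<in> S \<Longrightarrow> \<pi> \<in> Gal" and c\<rho>: "c \<rho> \<in> carrier L"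
    and cS: "\<And>\<pi>. \<pi> \<in> S \<Longrightarrow> c \<pi> \<in> carrier L"
    using insert.prems(1,2) by auto
  have split: "c \<rho> \<otimes> \<rho> x \<oplus> (\<Oplus>\<pi>\<in>S. c \<pi> \<otimes> \<pi> x) = \<zero>" if "x \<in> carrier L" for x
    using insert.prems(3)[OF that] insert.hyps \<rho> S c\<rho> cS that by (simp add: Pi_iff)
  have c0: "c \<pi> = \<zero>" if \<pi>: "\<pi> \<in> S" for \<pi>
  proof -
    have "\<pi> \<noteq> \<rho>" using \<pi> insert.hyps by auto
    then obtain y where y: "y \<in> carrier L" "\<pi> y \<noteq> \<rho> y" using Gal_ext[OF S[OF \<pi>] \<rho>] by blast
    let ?d = "\<lambda>\<pi>. c \<pi> \<otimes> (\<pi> y \<oplus> \<ominus> \<rho> y)"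
    have "\<forall>\<pi>\<in>S. ?d \<pi> = \<zero>"
    proof (rule insert.IH)
      show "S \<subseteq> Gal" using S by blast
      show "?d \<in> S \<rightarrow> carrier L" using S \<rho> cS y by auto
      fix x assume x: "x \<in> carrier L"
      have cl: "(\<Oplus>\<pi>\<in>S. c \<pi> \<otimes> \<pi> x) \<in> carrier L" "(\<Oplus>\<pi>\<in>S. c \<pi> \<otimes> \<pi> (x \<otimes> y)) \<in> carrier L"
        using x y S cS by (auto intro!: finsum_closed)
      have "(\<Oplus>\<pi>\<in>S. ?d \<pi> \<otimes> \<pi> x) = (\<Oplus>\<pi>\<in>S. c \<pi> \<otimes> \<pi> (x \<otimes> y) \<oplus> (\<ominus> \<rho> y) \<otimes> (c \<pi> \<otimes> \<pi> x))"
        using x y S cS \<rho> by (intro finsum_cong') (auto simp: r_distr l_distr m_ac)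
      also have "\<dots> = (\<Oplus>\<pi>\<in>S. c \<pi> \<otimes> \<pi> (x \<otimes> y)) \<oplus> (\<Oplus>\<pi>\<in>S. (\<ominus> \<rho> y) \<otimes> (c \<pi> \<otimes> \<pi> x))"
        using x y S cS \<rho> by (intro finsum_addf) auto
      also have "(\<Oplus>\<pi>\<in>S. (\<ominus> \<rho> y) \<otimes> (c \<pi> \<otimes> \<pi> x)) = (\<ominus> \<rho> y) \<otimes> (\<Oplus>\<pi>\<in>S. c \<pi> \<otimes> \<pi> x)"
        using x y S cS \<rho> insert.hyps by (intro finsum_rdistr[symmetric]) auto
      also have "(\<Oplus>\<pi>\<in>S. c \<pi> \<otimes> \<pi> x) = \<ominus> (c \<rho> \<otimes> \<rho> x)"
        using split[OF x] cl c\<rho> \<rho> x by (intro minus_equality[symmetric]) (auto simp: a_comm)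
      also have "(\<Oplus>\<pi>\<in>S. c \<pi> \<otimes> \<pi> (x \<otimes> y)) = \<ominus> (c \<rho> \<otimes> \<rho> (x \<otimes> y))"
        using split[of "x \<otimes> y"] cl c\<rho> \<rho> x y by (intro minus_equality[symmetric]) (auto simp: a_comm)
      also have "\<ominus> (c \<rho> \<otimes> \<rho> (x \<otimes> y)) \<oplus> (\<ominus> \<rho> y) \<otimes> \<ominus> (c \<rho> \<otimes> \<rho> x) = \<zero>"
        using c\<rho> \<rho> x y by (simp add: l_minus r_minus m_ac l_neg)
      finally show "(\<Oplus>\<pi>\<in>S. ?d \<pi> \<otimes> \<pi> x) = \<zero>" .
    qed
    then have "c \<pi> \<otimes> (\<pi> y \<oplus> \<ominus> \<rho> y) = \<zero>" using \<pi> by blast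
    moreover have "\<pi> y \<oplus> \<ominus> \<rho> y \<noteq> \<zero>"
      using y S[OF \<pi>] \<rho> by (metis Gal_closed a_inv_closed minus_equality minus_minus)
    ultimately show ?thesis using y S[OF \<pi>] \<rho> cS[OF \<pi>] by (auto simp: integral_iff)
  qed
  moreover have "(\<Oplus>\<pi>\<in>S. c \<pi> \<otimes> \<pi> \<one>) = \<zero>"
    using c0 S by (intro add.finprod_one_eqI) auto
  ultimately show ?case using split[of \<one>] \<rho> c\<rho> by simp
qed

text \<open>Spanning is phrased as an induction rule because it is applied to the zero set of a
  K-linear map, where closure is immediate and coordinates are a burden.\<close>

lemma finite_spanning_set:
  obtains V where "finite V" "V \<subseteq> carrier L"
    "\<And>Z. V \<subseteq> Z \<Longrightarrow> Z \<subseteq> carrier L \<Longrightarrow> \<zero> \<in> Z \<Longrightarrow> (\<And>x y. x \<in> Z \<Longrightarrow> y \<in> Z \<Longrightarrow> x \<oplus> y \<in> Z) \<Longrightarrow>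
      (\<And>k x. k \<in> K \<Longrightarrow> x \<in> Z \<Longrightarrow> k \<otimes> x \<in> Z) \<Longrightarrow> carrier L \<subseteq> Z"
proof -
  obtain n where "dimension n K (carrier L)" using finite_dim by auto
  then obtain vs where vs: "set vs \<subseteq> carrier L" "Span K vs = carrier L"
    using exists_base[OF subfield] by blast
  have comb: "combine Ks Us \<in> Z" if "set Us \<subseteq> Z" "set Ks \<subseteq> K" "\<zero> \<in> Z"
    "\<And>x y. x \<in> Z \<Longrightarrow> y \<in> Z \<Longrightarrow> x \<oplus> y \<in> Z" "\<And>k x. k \<in> K \<Longrightarrow> x \<in> Z \<Longrightarrow> k \<otimes> x \<in> Z" for Ks Us Z
    using that by (induction Ks Us rule: combine.induct) auto
  show thesis
  proof (rule that[of "set vs"])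
    show "carrier L \<subseteq> Z" if Z: "set vs \<subseteq> Z" "Z \<subseteq> carrier L" "\<zero> \<in> Z"
      "\<And>x y. x \<in> Z \<Longrightarrow> y \<in> Z \<Longrightarrow> x \<oplus> y \<in> Z" "\<And>k x. k \<in> K \<Longrightarrow> x \<in> Z \<Longrightarrow> k \<otimes> x \<in> Z" for Z
    proof
      fix x assume "x \<in> carrier L"
      then obtain Ks where "set Ks \<subseteq> K" "x = combine Ks vs"
        using vs Span_eq_combine_set[OF subfield vs(1)] by auto
      then show "x \<in> Z" using comb[of vs Z Ks] Z by simp
    qed
  qed (use vs in auto)
qed

text \<open>The expression is K-linear in \<open>x\<close>, because automorphisms fix K; so
  vanishing on \<open>V\<close> spreads to L, where Dedekind independence applies.\<close>

lemma combination_zero_if_zero_on_spanning_set: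
  assumes V: "V \<subseteq> carrier L" "\<And>Z. V \<subseteq> Z \<Longrightarrow> Z \<subseteq> carrier L \<Longrightarrow> \<zero> \<in> Z \<Longrightarrow>
      (\<And>x y. x \<in> Z \<Longrightarrow> y \<in> Z \<Longrightarrow> x \<oplus> y \<in> Z) \<Longrightarrow>
      (\<And>k x. k \<in> K \<Longrightarrow> x \<in> Z \<Longrightarrow> k \<otimes> x \<in> Z) \<Longrightarrow> carrier L \<subseteq> Z"
    and S: "finite S" "S \<subseteq> Gal" and c: "c \<in> S \<rightarrow> carrier L"
    and zero: "\<And>x. x \<in> V \<Longrightarrow> (\<Oplus>\<pi>\<in>S. c \<pi> \<otimes> \<pi> x) = \<zero>"
  shows "\<forall>\<pi>\<in>S. c \<pi> = \<zero>"
proof (rule dedekind_independence[OF S c])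
  let ?Z = "{x \<in> carrier L. (\<Oplus>\<pi>\<in>S. c \<pi> \<otimes> \<pi> x) = \<zero>}"
  have SG: "\<And>\<pi>. \<pi> \<in> S \<Longrightarrow> \<pi> \<in> Gal" and cc: "\<And>\<pi>. \<pi> \<in> S \<Longrightarrow> c \<pi> \<in> carrier L" using S c by auto
  have "carrier L \<subseteq> ?Z"
  proof (rule V(2))
    show "V \<subseteq> ?Z" using V(1) zero by auto
    show "\<zero> \<in> ?Z" using SG cc by (auto intro!: add.finprod_one_eqI)
    fix x y assume xy: "x \<in> ?Z" "y \<in> ?Z"
    have "(\<Oplus>\<pi>\<in>S. c \<pi> \<otimes> \<pi> (x \<oplus> y)) = (\<Oplus>\<pi>\<in>S. c \<pi> \<otimes> \<pi> x \<oplus> c \<pi> \<otimes> \<pi> y)"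
      using xy SG cc by (intro finsum_cong') (auto simp: r_distr)
    also have "\<dots> = (\<Oplus>\<pi>\<in>S. c \<pi> \<otimes> \<pi> x) \<oplus> (\<Oplus>\<pi>\<in>S. c \<pi> \<otimes> \<pi> y)"
      using xy SG cc by (intro finsum_addf) auto
    finally show "x \<oplus> y \<in> ?Z" using xy by simp
  next
    fix k x assume k: "k \<in> K" and x: "x \<in> ?Z"
    have "(\<Oplus>\<pi>\<in>S. c \<pi> \<otimes> \<pi> (k \<otimes> x)) = (\<Oplus>\<pi>\<in>S. k \<otimes> (c \<pi> \<otimes> \<pi> x))"
      using k x SG cc by (intro finsum_cong') (auto simp: m_lcomm)
    also have "\<dots> = k \<otimes> (\<Oplus>\<pi>\<in>S. c \<pi> \<otimes> \<pi> x)"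
      using k x SG cc S(1) by (intro finsum_rdistr[symmetric]) auto
    finally show "k \<otimes> x \<in> ?Z" using k x by simp
  qed auto
  then show "\<And>x. x \<in> carrier L \<Longrightarrow> (\<Oplus>\<pi>\<in>S. c \<pi> \<otimes> \<pi> x) = \<zero>" by blast
qed

text \<open>More automorphisms than elements of \<open>V\<close> would satisfy a nontrivial relation
  on \<open>V\<close>, by counting equations and unknowns.\<close>

lemma finite_Gal [simp]: "finite Gal"
proof (rule ccontr)
  assume inf: "infinite Gal"
  obtain V where V: "finite V" "V \<subseteq> carrier L"
    and span: "\<And>Z. V \<subseteq> Z \<Longrightarrow> Z \<subseteq> carrier L \<Longrightarrow> \<zero> \<in> Z \<Longrightarrow> (\<And>x y. x \<in> Z \<Longrightarrow> y \<in> Z \<Longrightarrow> x \<oplus> y \<in> Z) \<Longrightarrow>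
      (\<And>k x. k \<in> K \<Longrightarrow> x \<in> Z \<Longrightarrow> k \<otimes> x \<in> Z) \<Longrightarrow> carrier L \<subseteq> Z"
    using finite_spanning_set by metis
  obtain S where S: "S \<subseteq> Gal" "finite S" "card S = Suc (card V)"
    using infinite_arbitrarily_large[OF inf] by blast
  have "\<exists>c\<in>S \<rightarrow> carrier L. (\<exists>\<pi>\<in>S. c \<pi> \<noteq> \<zero>) \<and> (\<forall>x\<in>V. (\<Oplus>\<pi>\<in>S. c \<pi> \<otimes> \<pi> x) = \<zero>)"
    using S V Gal_closed by (intro homogeneous_system) (auto simp: subset_iff)
  then obtain c where c: "c \<in> S \<rightarrow> carrier L" "\<exists>\<pi>\<in>S. c \<pi> \<noteq> \<zero>" "\<And>x. x \<in> V \<Longrightarrow> (\<Oplus>\<pi>\<in>S. c \<pi> \<otimes> \<pi> x) = \<zero>"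
    by blast
  then show False
    using combination_zero_if_zero_on_spanning_set[OF V(2) span S(2,1) c(1) c(3)] by blast
qed

section \<open>Sums over the group and the trace form\<close>

lemma finsum_Gal_mult_left:
  assumes "\<tau> \<in> Gal" "f \<in> Gal \<rightarrow> carrier L"
  shows "(\<Oplus>\<pi>\<in>Gal. f (\<tau> \<otimes>\<^bsub>galois_group L K\<^esub> \<pi>)) = (\<Oplus>\<pi>\<in>Gal. f \<pi>)"
proof -
  have "inj_on (\<lambda>\<pi>. \<tau> \<otimes>\<^bsub>galois_group L K\<^esub> \<pi>) Gal" using assms by (intro inj_onI) simp
  moreover have "(\<lambda>\<pi>. \<tau> \<otimes>\<^bsub>galois_group L K\<^esub> \<pi>) ` Gal = Gal"
    using calculation assms by (intro endo_inj_surj) auto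
  ultimately show ?thesis
    using finsum_reindex[of f "\<lambda>\<pi>. \<tau> \<otimes>\<^bsub>galois_group L K\<^esub> \<pi>" Gal] assms by simp
qed

lemma finsum_Gal_mult_right:
  assumes "\<tau> \<in> Gal" "f \<in> Gal \<rightarrow> carrier L"
  shows "(\<Oplus>\<pi>\<in>Gal. f (\<pi> \<otimes>\<^bsub>galois_group L K\<^esub> \<tau>)) = (\<Oplus>\<pi>\<in>Gal. f \<pi>)"
proof -
  have "inj_on (\<lambda>\<pi>. \<pi> \<otimes>\<^bsub>galois_group L K\<^esub> \<tau>) Gal" using assms by (intro inj_onI) simp
  moreover have "(\<lambda>\<pi>. \<pi> \<otimes>\<^bsub>galois_group L K\<^esub> \<tau>) ` Gal = Gal"
    using calculation assms by (intro endo_inj_surj) auto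
  ultimately show ?thesis
    using finsum_reindex[of f "\<lambda>\<pi>. \<pi> \<otimes>\<^bsub>galois_group L K\<^esub> \<tau>" Gal] assms by simp
qed

definition trace :: "'a \<Rightarrow> 'a" where "trace x = (\<Oplus>\<pi>\<in>Gal. \<pi> x)"

lemma trace_closed [simp]: "x \<in> carrier L \<Longrightarrow> trace x \<in> carrier L"
  unfolding trace_def by (intro finsum_closed) auto

lemma trace_in_K [simp]: assumes x: "x \<in> carrier L" shows "trace x \<in> K"
proof (rule in_K_if_fixed)
  fix \<tau> assume \<tau>: "\<tau> \<in> Gal"
  have "\<tau> (trace x) = (\<Oplus>\<pi>\<in>Gal. \<tau> (\<pi> x))"
    unfolding trace_def using \<tau> x by (intro Gal_finsum) auto
  also have "\<dots> = (\<Oplus>\<pi>\<in>Gal. (\<tau> \<otimes>\<^bsub>galois_group L K\<^esub> \<pi>) x)"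
    using \<tau> x by (intro finsum_cong') auto
  also have "\<dots> = trace x"
    unfolding trace_def using \<tau> x by (intro finsum_Gal_mult_left) auto
  finally show "\<tau> (trace x) = trace x" .
qed (use x in simp)

lemma trace_add: "x \<in> carrier L \<Longrightarrow> y \<in> carrier L \<Longrightarrow> trace (x \<oplus> y) = trace x \<oplus> trace y"
proof -
  assume xy: "x \<in> carrier L" "y \<in> carrier L"
  have "trace (x \<oplus> y) = (\<Oplus>\<pi>\<in>Gal. \<pi> x \<oplus> \<pi> y)"
    unfolding trace_def using xy by (intro finsum_cong') auto
  then show ?thesis unfolding trace_def using xy by (simp add: finsum_addf Pi_iff)
qed

lemma trace_smult: "k \<in> K \<Longrightarrow> x \<in> carrier L \<Longrightarrow> trace (k \<otimes> x) = k \<otimes> trace x"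
proof -
  assume kx: "k \<in> K" "x \<in> carrier L"
  have "trace (k \<otimes> x) = (\<Oplus>\<pi>\<in>Gal. k \<otimes> \<pi> x)"
    unfolding trace_def using kx by (intro finsum_cong') auto
  then show ?thesis unfolding trace_def using kx by (simp add: finsum_rdistr Pi_iff)
qed

lemma trace_Gal: "\<tau> \<in> Gal \<Longrightarrow> x \<in> carrier L \<Longrightarrow> trace (\<tau> x) = trace x"
proof -
  assume \<tau>: "\<tau> \<in> Gal" "x \<in> carrier L"
  have "trace (\<tau> x) = (\<Oplus>\<pi>\<in>Gal. (\<pi> \<otimes>\<^bsub>galois_group L K\<^esub> \<tau>) x)"
    unfolding trace_def using \<tau> by (intro finsum_cong') auto
  also have "\<dots> = trace x" unfolding trace_def using \<tau> by (intro finsum_Gal_mult_right) auto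
  finally show ?thesis .
qed

text \<open>For nonzero \<open>x\<close> the products x y fill L, so the trace would vanish
  identically, against Dedekind independence.\<close>

lemma trace_nondegenerate:
  assumes x: "x \<in> carrier L" and zero: "\<And>y. y \<in> carrier L \<Longrightarrow> trace (x \<otimes> y) = \<zero>"
  shows "x = \<zero>"
proof (rule ccontr)
  assume nz: "x \<noteq> \<zero>"
  have "\<forall>\<pi>\<in>Gal. \<one> = \<zero>"
  proof (rule dedekind_independence)
    fix z assume z: "z \<in> carrier L"
    have "x \<otimes> (inv x \<otimes> z) = z" using x nz z by (simp add: field_Units m_assoc[symmetric])
    moreover have "inv x \<otimes> z \<in> carrier L" using x nz z by (simp add: field_Units)
    ultimately have "trace z = \<zero>" using zero by metis
    moreover have "(\<Oplus>\<pi>\<in>Gal. \<one> \<otimes> \<pi> z) = trace z"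
      unfolding trace_def using z by (intro finsum_cong') auto
    ultimately show "(\<Oplus>\<pi>\<in>Gal. \<one> \<otimes> \<pi> z) = \<zero>" by simp
  qed auto
  then show False using Gal.one_closed one_not_zero by blast
qed

text \<open>A relation over L that holds for all conjugates descends to K: apply \<pi> to the
  relation for its inverse, multiply by \<pi>(l), and sum over \<pi>. The free factor
  \<open>l\<close> allows a chosen coefficient to be kept nonzero.\<close>

lemma trace_descent:
  assumes J: "finite J" and z: "z \<in> J \<rightarrow> carrier L" and c: "c \<in> J \<rightarrow> carrier L"
    and zero: "\<And>\<pi>. \<pi> \<in> Gal \<Longrightarrow> (\<Oplus>j\<in>J. c j \<otimes> \<pi> (z j)) = \<zero>" and l: "l \<in> carrier L"
  shows "(\<Oplus>j\<in>J. trace (c j \<otimes> l) \<otimes> z j) = \<zero>"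
proof -
  have zc: "z j \<in> carrier L" "c j \<in> carrier L" if "j \<in> J" for j using z c that by auto
  have sum0: "(\<Oplus>j\<in>J. \<pi> (c j \<otimes> l) \<otimes> z j) = \<zero>" if \<pi>: "\<pi> \<in> Gal" for \<pi>
  proof -
    let ?\<tau> = "inv\<^bsub>galois_group L K\<^esub> \<pi>"
    have \<tau>: "?\<tau> \<in> Gal" using \<pi> by simp
    have "(\<Oplus>j\<in>J. \<pi> (c j \<otimes> l) \<otimes> z j) = (\<Oplus>j\<in>J. \<pi> l \<otimes> \<pi> (c j \<otimes> ?\<tau> (z j)))"
      using \<pi> \<tau> zc l by (intro finsum_cong') (auto simp: m_ac)
    also have "\<dots> = \<pi> l \<otimes> (\<Oplus>j\<in>J. \<pi> (c j \<otimes> ?\<tau> (z j)))"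
      using \<pi> \<tau> zc l J by (intro finsum_rdistr[symmetric]) auto
    also have "(\<Oplus>j\<in>J. \<pi> (c j \<otimes> ?\<tau> (z j))) = \<pi> (\<Oplus>j\<in>J. c j \<otimes> ?\<tau> (z j))"
      using \<pi> \<tau> zc by (intro Gal_finsum[symmetric]) auto
    finally show ?thesis using zero[OF \<tau>] \<pi> l by simp
  qed
  have "(\<Oplus>j\<in>J. trace (c j \<otimes> l) \<otimes> z j) = (\<Oplus>j\<in>J. \<Oplus>\<pi>\<in>Gal. \<pi> (c j \<otimes> l) \<otimes> z j)"
    unfolding trace_def using zc l by (intro finsum_cong') (auto simp: finsum_ldistr Pi_iff intro!: finsum_closed)
  also have "\<dots> = (\<Oplus>\<pi>\<in>Gal. \<Oplus>j\<in>J. \<pi> (c j \<otimes> l) \<otimes> z j)"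
    using zc l J by (intro finsum_swap) auto
  also have "\<dots> = \<zero>" using sum0 by (rule add.finprod_one_eqI)
  finally show ?thesis .
qed

text \<open>This bounds the degree of L over K by |G|: as many equations as group elements, in more
  unknowns, have a nontrivial solution over L, and traces bring it down to K.\<close>

lemma dependent_if_card_gt:
  assumes J: "finite J" "card Gal < card J" and z: "z \<in> J \<rightarrow> carrier L"
  shows "\<exists>d\<in>J \<rightarrow> K. (\<exists>j\<in>J. d j \<noteq> \<zero>) \<and> (\<Oplus>j\<in>J. d j \<otimes> z j) = \<zero>"
proof -
  have zc: "z j \<in> carrier L" if "j \<in> J" for j using z that by auto
  obtain c i where c: "c \<in> J \<rightarrow> carrier L" "\<And>\<pi>. \<pi> \<in> Gal \<Longrightarrow> (\<Oplus>j\<in>J. c j \<otimes> \<pi> (z j)) = \<zero>"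
    and i: "i \<in> J" "c i \<noteq> \<zero>"
    using homogeneous_system[of J Gal "\<lambda>\<pi> j. \<pi> (z j)"] J zc by auto
  then have ci: "c i \<in> carrier L" by auto
  then obtain l where l: "l \<in> carrier L" "trace (c i \<otimes> l) \<noteq> \<zero>"
    using trace_nondegenerate i by blast
  have "(\<lambda>j. trace (c j \<otimes> l)) \<in> J \<rightarrow> K" using c(1) l by (auto simp: Pi_iff)
  then show ?thesis
    using trace_descent[OF J(1) z c l(1)] i l
    by (intro bexI[of _ "\<lambda>j. trace (c j \<otimes> l)"] conjI bexI[of _ i]) simp_all
qed

text \<open>Independence indexed by the group itself, free of enumerations. Spanning follows from
  the bound on the degree, so this describes the normal basis elements.\<close>

definition conj_independent :: "'a \<Rightarrow> bool" where
  "conj_independent x \<longleftrightarrow> x \<in> carrier L \<and>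
    (\<forall>c\<in>Gal \<rightarrow> K. (\<Oplus>\<tau>\<in>Gal. c \<tau> \<otimes> \<tau> x) = \<zero> \<longrightarrow> (\<forall>\<tau>\<in>Gal. c \<tau> = \<zero>))"

lemma conj_independentI:
  "x \<in> carrier L \<Longrightarrow>
    (\<And>c. c \<in> Gal \<rightarrow> K \<Longrightarrow> (\<Oplus>\<tau>\<in>Gal. c \<tau> \<otimes> \<tau> x) = \<zero> \<Longrightarrow> \<forall>\<tau>\<in>Gal. c \<tau> = \<zero>) \<Longrightarrow> conj_independent x"
  by (simp add: conj_independent_def)

lemma conj_independentD:
  "conj_independent x \<Longrightarrow> c \<in> Gal \<rightarrow> K \<Longrightarrow> (\<Oplus>\<tau>\<in>Gal. c \<tau> \<otimes> \<tau> x) = \<zero> \<Longrightarrow> \<tau> \<in> Gal \<Longrightarrow> c \<tau> = \<zero>"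
  by (simp add: conj_independent_def)

lemma conj_independent_closed: "conj_independent x \<Longrightarrow> x \<in> carrier L"
  by (simp add: conj_independent_def)

text \<open>Turns independence over K into a condition on a matrix over L, to which the pencil lemma
  applies. One direction descends coefficients by traces, the other applies each \<pi> to the
  relation.\<close>

lemma conj_independent_iff_nonsingular:
  assumes x: "x \<in> carrier L"
  shows "conj_independent x \<longleftrightarrow> nonsingular Gal (\<lambda>\<pi> \<tau>. \<pi> (\<tau> x))"
proof
  assume ind: "conj_independent x"
  show "nonsingular Gal (\<lambda>\<pi> \<tau>. \<pi> (\<tau> x))"
  proof (rule nonsingularI)
    fix c assume c: "c \<in> Gal \<rightarrow> carrier L"
      and zero: "\<forall>\<pi>\<in>Gal. (\<Oplus>\<tau>\<in>Gal. c \<tau> \<otimes> \<pi> (\<tau> x)) = \<zero>"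
    show "\<forall>\<tau>\<in>Gal. c \<tau> = \<zero>"
    proof
      fix \<tau> assume \<tau>: "\<tau> \<in> Gal"
      have "trace (c \<tau> \<otimes> l) = \<zero>" if l: "l \<in> carrier L" for l
      proof (rule conj_independentD[OF ind _ _ \<tau>])
        show "(\<lambda>\<tau>. trace (c \<tau> \<otimes> l)) \<in> Gal \<rightarrow> K" using c l by (auto simp: Pi_iff)
        show "(\<Oplus>\<tau>\<in>Gal. trace (c \<tau> \<otimes> l) \<otimes> \<tau> x) = \<zero>"
          using zero c l x by (intro trace_descent) auto
      qed
      moreover have "c \<tau> \<in> carrier L" using c \<tau> by auto
      ultimately show "c \<tau> = \<zero>" using trace_nondegenerate by blast
    qed
  qed
next
  assume ns: "nonsingular Gal (\<lambda>\<pi> \<tau>. \<pi> (\<tau> x))"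
  show "conj_independent x"
  proof (rule conj_independentI[OF x])
    fix c assume c: "c \<in> Gal \<rightarrow> K" and zero: "(\<Oplus>\<tau>\<in>Gal. c \<tau> \<otimes> \<tau> x) = \<zero>"
    have cK: "c \<tau> \<in> K" if "\<tau> \<in> Gal" for \<tau> using c that by auto
    have z: "(\<Oplus>\<tau>\<in>Gal. c \<tau> \<otimes> \<pi> (\<tau> x)) = \<zero>" if \<pi>: "\<pi> \<in> Gal" for \<pi>
    proof -
      have "(\<Oplus>\<tau>\<in>Gal. c \<tau> \<otimes> \<pi> (\<tau> x)) = (\<Oplus>\<tau>\<in>Gal. \<pi> (c \<tau> \<otimes> \<tau> x))"
        using cK \<pi> x by (intro finsum_cong') auto
      also have "\<dots> = \<pi> \<zero>" unfolding zero[symmetric] using cK \<pi> x by (intro Gal_finsum[symmetric]) auto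
      finally show ?thesis using \<pi> by simp
    qed
    have "c \<in> Gal \<rightarrow> carrier L" using cK by auto
    from nonsingularD[OF ns this z] show "\<forall>\<tau>\<in>Gal. c \<tau> = \<zero>" by blast
  qed
qed

lemma conj_independent_spans:
  assumes x: "conj_independent x" and y: "y \<in> carrier L"
  obtains c where "c \<in> Gal \<rightarrow> K" "y = (\<Oplus>\<tau>\<in>Gal. c \<tau> \<otimes> \<tau> x)"
proof -
  have xc: "x \<in> carrier L" using x by (rule conj_independent_closed)
  \<comment> \<open>\<open>None\<close> stands for \<open>y\<close> and \<open>Some \<tau>\<close>
    for a conjugate of \<open>x\<close>; this makes |G| + 1 indices even when \<open>y\<close> is
    itself a conjugate.\<close>
  let ?z = "\<lambda>j. case j of None \<Rightarrow> y | Some \<tau> \<Rightarrow> \<tau> x"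
  let ?J = "insert None (Some ` Gal)"
  have "card Gal < card ?J" by (simp add: card_image)
  moreover have "?z \<in> ?J \<rightarrow> carrier L" using xc y by auto
  ultimately obtain d i where d: "d \<in> ?J \<rightarrow> K" "(\<Oplus>j\<in>?J. d j \<otimes> ?z j) = \<zero>"
    and i: "i \<in> ?J" "d i \<noteq> \<zero>"
    using dependent_if_card_gt[of ?J ?z] by auto
  have dK: "d None \<in> K" "\<And>\<tau>. \<tau> \<in> Gal \<Longrightarrow> d (Some \<tau>) \<in> K" using d(1) by auto
  let ?s = "\<Oplus>\<tau>\<in>Gal. d (Some \<tau>) \<otimes> \<tau> x"
  have sc: "?s \<in> carrier L" using dK xc by (intro finsum_closed) auto
  have "(\<Oplus>j\<in>Some ` Gal. d j \<otimes> ?z j) = ?s"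
    using dK xc by (subst finsum_reindex) auto
  then have eq: "d None \<otimes> y \<oplus> ?s = \<zero>"
    using d(2) dK xc y by (simp add: finsum_insert Pi_iff)
  \<comment> \<open>A relation among the conjugates alone is trivial, so \<open>y\<close> must
    really occur and can be solved for.\<close>
  have d0: "d None \<noteq> \<zero>"
  proof
    assume *: "d None = \<zero>"
    then have s0: "?s = \<zero>" using eq y sc by simp
    have dSome: "(\<lambda>\<tau>. d (Some \<tau>)) \<in> Gal \<rightarrow> K" using dK by simp
    from conj_independentD[OF x dSome s0] have "\<And>\<tau>. \<tau> \<in> Gal \<Longrightarrow> d (Some \<tau>) = \<zero>" .
    then show False using i * by auto
  qed
  let ?k = "\<ominus> (inv (d None))"
  have k: "inv (d None) \<in> K" "?k \<in> K" "inv (d None) \<otimes> d None = \<one>"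
    using subfield_m_inv[OF subfield, of "d None"] d0 dK K_subring by auto
  have "y = ?k \<otimes> ?s"
  proof -
    have "?s = \<ominus> (d None \<otimes> y)"
      using eq sc dK y by (intro minus_equality[symmetric]) (auto simp: a_comm)
    then have "?k \<otimes> ?s = (inv (d None) \<otimes> d None) \<otimes> y"
      using k(1) dK y by (simp add: l_minus r_minus m_assoc)
    then show ?thesis using k y by simp
  qed
  also have "\<dots> = (\<Oplus>\<tau>\<in>Gal. ?k \<otimes> (d (Some \<tau>) \<otimes> \<tau> x))"
    using k dK xc by (intro finsum_rdistr) auto
  also have "\<dots> = (\<Oplus>\<tau>\<in>Gal. (?k \<otimes> d (Some \<tau>)) \<otimes> \<tau> x)"
    using k(2) dK xc by (intro finsum_cong') (auto simp: m_assoc)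
  finally have "y = (\<Oplus>\<tau>\<in>Gal. (?k \<otimes> d (Some \<tau>)) \<otimes> \<tau> x)" .
  moreover have "(\<lambda>\<tau>. ?k \<otimes> d (Some \<tau>)) \<in> Gal \<rightarrow> K" using k(2) dK K_subring by auto
  ultimately show thesis using that by blast
qed

lemma combine_map_eq_finsum:
  assumes "distinct ts" "c \<in> set ts \<rightarrow> carrier L" "u \<in> set ts \<rightarrow> carrier L"
  shows "combine (map c ts) (map u ts) = (\<Oplus>t\<in>set ts. c t \<otimes> u t)"
  using assms by (induction ts) (auto simp: Pi_iff)

text \<open>Independent conjugates span, so an arbitrary enumeration of the group witnesses the
  formulation by lists.\<close>

lemma normal_basis_elements_eq: "normal_basis_elements L K = {x. conj_independent x}"
proof (intro equalityI subsetI)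
  fix x assume "x \<in> normal_basis_elements L K"
  then obtain ts where x: "x \<in> carrier L" and ts: "distinct ts" "set ts = Gal"
    and ind: "independent K (map (\<lambda>\<tau>. \<tau> x) ts)"
    unfolding normal_basis_elements_def by auto
  have "conj_independent x"
  proof (rule conj_independentI[OF x])
    fix c assume c: "c \<in> Gal \<rightarrow> K" and zero: "(\<Oplus>\<tau>\<in>Gal. c \<tau> \<otimes> \<tau> x) = \<zero>"
    have cK: "c \<tau> \<in> K" if "\<tau> \<in> Gal" for \<tau> using c that by auto
    have "combine (map c ts) (map (\<lambda>\<tau>. \<tau> x) ts) = \<zero>"
      using zero ts cK x by (subst combine_map_eq_finsum) auto
    then have "set (take (length ts) (map c ts)) \<subseteq> {\<zero>}"
      using independent_imp_trivial_combine[OF subfield ind, of "map c ts"] ts cK by auto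
    then show "\<forall>\<tau>\<in>Gal. c \<tau> = \<zero>" using ts by auto
  qed
  then show "x \<in> {x. conj_independent x}" by simp
next
  fix x assume "x \<in> {x. conj_independent x}"
  then have ind: "conj_independent x" by simp
  have x: "x \<in> carrier L" using ind by (rule conj_independent_closed)
  obtain ts where ts: "distinct ts" "set ts = Gal" using finite_distinct_list[OF finite_Gal] by blast
  let ?us = "map (\<lambda>\<tau>. \<tau> x) ts"
  have us: "set ?us \<subseteq> carrier L" using ts x by auto
  have "independent K ?us"
  proof (rule ccontr)
    assume "dependent K ?us"
    then obtain Ks where Ks: "length Ks = length ?us" "combine Ks ?us = \<zero>" "set Ks \<subseteq> K" "set Ks \<noteq> {\<zero>}"
      using dependent_imp_non_trivial_combine[OF subfield us] by blast
    \<comment> \<open>The coefficient list read as a function on the group, which is sound because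
      \<open>ts\<close> has no repetitions.\<close>
    define c where "c = (\<lambda>\<tau>. the (map_of (zip ts Ks) \<tau>))"
    have cnth: "c (ts ! i) = Ks ! i" if "i < length ts" for i
      unfolding c_def using map_of_zip_nth[of ts Ks i] Ks(1) ts that by simp
    have map: "map c ts = Ks" using Ks(1) cnth by (intro nth_equalityI) auto
    have cK: "c \<in> Gal \<rightarrow> K" using Ks(3) unfolding map[symmetric] using ts by auto
    have "(\<Oplus>\<tau>\<in>Gal. c \<tau> \<otimes> \<tau> x) = \<zero>"
      using Ks(2) combine_map_eq_finsum[OF ts(1), of c "\<lambda>\<tau>. \<tau> x"] cK x ts map by (auto simp: Pi_iff)
    from conj_independentD[OF ind cK this] have "\<forall>\<tau>\<in>Gal. c \<tau> = \<zero>" by blast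
    moreover have "Gal \<noteq> {}" using Gal.one_closed by blast
    ultimately have "set Ks = {\<zero>}" unfolding map[symmetric] using ts by auto
    then show False using Ks by simp
  qed
  moreover have "Span K ?us = carrier L"
  proof
    show "carrier L \<subseteq> Span K ?us"
    proof
      fix y assume "y \<in> carrier L"
      then obtain c where c: "c \<in> Gal \<rightarrow> K" "y = (\<Oplus>\<tau>\<in>Gal. c \<tau> \<otimes> \<tau> x)"
        using conj_independent_spans[OF ind] by blast
      have "y = combine (map c ts) ?us"
        using c ts x by (subst combine_map_eq_finsum) (auto simp: Pi_iff)
      moreover have "set (map c ts) \<subseteq> K" using c ts by auto
      ultimately show "y \<in> Span K ?us" using Span_eq_combine_set[OF subfield us] by blast
    qed
  qed (use Span_in_carrier us subfieldE(3)[OF subfield] in auto)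
  ultimately show "x \<in> normal_basis_elements L K"
    unfolding normal_basis_elements_def using x ts by blast
qed

end

section \<open>Infinite base field\<close>

lemma (in ring) nonsingular_cong:
  assumes "\<And>i j. i \<in> I \<Longrightarrow> j \<in> I \<Longrightarrow> P i j = Q i j" "\<And>i j. i \<in> I \<Longrightarrow> j \<in> I \<Longrightarrow> Q i j \<in> carrier R"
  shows "nonsingular I P \<longleftrightarrow> nonsingular I Q"
proof -
  have "(\<Oplus>j\<in>I. c j \<otimes> P i j) = (\<Oplus>j\<in>I. c j \<otimes> Q i j)" if "c \<in> I \<rightarrow> carrier R" "i \<in> I" for c i
    using that assms by (intro finsum_cong') auto
  then show ?thesis unfolding nonsingular_def by simp
qed

context finite_galois_extension
begin

text \<open>The \<open>y\<^sub>i\<close> are moved from \<open>L\<close> into \<open>K\<close> one at a time; each time only finitely many values are singular.\<close>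

lemma nonsingular_specialize:
  assumes K: "infinite K" and I: "finite I"
    and y: "\<And>i. i \<in> I \<Longrightarrow> y i \<in> carrier L" and w: "\<And>i. i \<in> I \<Longrightarrow> w i \<in> carrier L"
    and \<phi>: "\<And>\<tau>. \<tau> \<in> Gal \<Longrightarrow> \<phi> \<tau> \<in> carrier L"
    and ns: "nonsingular Gal (\<lambda>\<pi> \<tau>. \<phi> (\<pi> \<otimes>\<^bsub>galois_group L K\<^esub> \<tau>) \<oplus> (\<Oplus>i\<in>I. y i \<otimes> \<pi> (\<tau> (w i))))"
  shows "\<exists>x\<in>carrier L. nonsingular Gal (\<lambda>\<pi> \<tau>. \<phi> (\<pi> \<otimes>\<^bsub>galois_group L K\<^esub> \<tau>) \<oplus> \<pi> (\<tau> x))"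
  using I y w \<phi> ns
proof (induction I arbitrary: \<phi>)
  case empty
  have "nonsingular Gal (\<lambda>\<pi> \<tau>. \<phi> (\<pi> \<otimes>\<^bsub>galois_group L K\<^esub> \<tau>) \<oplus> \<pi> (\<tau> \<zero>)) \<longleftrightarrow>
    nonsingular Gal (\<lambda>\<pi> \<tau>. \<phi> (\<pi> \<otimes>\<^bsub>galois_group L K\<^esub> \<tau>) \<oplus> (\<Oplus>i\<in>{}. y i \<otimes> \<pi> (\<tau> (w i))))"
    using empty.prems(3) by (intro nonsingular_cong) auto
  then show ?case using empty.prems(4) by blast
next
  case (insert a I)
  note y = insert.prems(1) and w = insert.prems(2) and \<phi> = insert.prems(3)
  have ya: "y a \<in> carrier L" and wa: "w a \<in> carrier L" using y w by auto
  have yI: "\<And>i. i \<in> I \<Longrightarrow> y i \<in> carrier L" and wI: "\<And>i. i \<in> I \<Longrightarrow> w i \<in> carrier L" using y w by auto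
  let ?P = "\<lambda>\<pi> \<tau>. \<phi> (\<pi> \<otimes>\<^bsub>galois_group L K\<^esub> \<tau>) \<oplus> (\<Oplus>i\<in>insert a I. y i \<otimes> \<pi> (\<tau> (w i)))"
  let ?Q = "\<lambda>\<pi> \<tau>. \<pi> (\<tau> (w a))"
  let ?s = "\<lambda>\<pi> \<tau>. \<Oplus>i\<in>I. y i \<otimes> \<pi> (\<tau> (w i))"
  have sc: "?s \<pi> \<tau> \<in> carrier L" if "\<pi> \<in> Gal" "\<tau> \<in> Gal" for \<pi> \<tau>
    using that yI wI by (intro finsum_closed) auto
  have Pc: "?P \<pi> \<tau> \<in> carrier L" if "\<pi> \<in> Gal" "\<tau> \<in> Gal" for \<pi> \<tau>
    using that y w \<phi> by (intro a_closed finsum_closed) auto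
  \<comment> \<open>The pencil parameter t = k - y a replaces the coefficient \<open>y a\<close> by
    \<open>k\<close>.\<close>
  let ?bad = "{t \<in> carrier L. \<not> nonsingular Gal (\<lambda>\<pi> \<tau>. ?P \<pi> \<tau> \<oplus> t \<otimes> ?Q \<pi> \<tau>)}"
  have "finite ?bad"
    by (rule finite_singular_in_pencil[OF finite_Gal Pc _ insert.prems(4)]) (use wa in auto)
  moreover have "inj_on (\<lambda>k. k \<oplus> \<ominus> y a) K"
    using ya by (intro inj_onI) (metis K_closed a_inv_closed add.right_cancel)
  ultimately have "\<not> (\<lambda>k. k \<oplus> \<ominus> y a) ` K \<subseteq> ?bad"
    using K finite_subset finite_imageD by blast
  then obtain k where k: "k \<in> K" "k \<oplus> \<ominus> y a \<notin> ?bad" by blast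
  \<comment> \<open>A coefficient in K is fixed by the group, so its term depends only on the
    product of \<pi> and \<tau> and can be absorbed into \<phi>.\<close>
  define \<phi>' where "\<phi>' = (\<lambda>\<tau>. \<phi> \<tau> \<oplus> \<tau> (k \<otimes> w a))"
  have \<phi>': "\<phi>' \<tau> \<in> carrier L" if "\<tau> \<in> Gal" for \<tau> using \<phi> that k wa by (simp add: \<phi>'_def)
  have "nonsingular Gal (\<lambda>\<pi> \<tau>. ?P \<pi> \<tau> \<oplus> (k \<oplus> \<ominus> y a) \<otimes> ?Q \<pi> \<tau>)"
    using k ya by auto
  also have "nonsingular Gal (\<lambda>\<pi> \<tau>. ?P \<pi> \<tau> \<oplus> (k \<oplus> \<ominus> y a) \<otimes> ?Q \<pi> \<tau>) \<longleftrightarrow>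
      nonsingular Gal (\<lambda>\<pi> \<tau>. \<phi>' (\<pi> \<otimes>\<^bsub>galois_group L K\<^esub> \<tau>) \<oplus> ?s \<pi> \<tau>)"
  proof (rule nonsingular_cong)
    fix \<pi> \<tau> assume \<pi>\<tau>: "\<pi> \<in> Gal" "\<tau> \<in> Gal"
    let ?f = "\<phi> (\<pi> \<otimes>\<^bsub>galois_group L K\<^esub> \<tau>)" and ?q = "\<pi> (\<tau> (w a))"
    have P: "?P \<pi> \<tau> = ?f \<oplus> (y a \<otimes> ?q \<oplus> ?s \<pi> \<tau>)"
      using \<pi>\<tau> y w insert.hyps by (subst finsum_insert) auto
    have id: "A \<oplus> (B \<otimes> D \<oplus> E) \<oplus> (k \<oplus> \<ominus> B) \<otimes> D = A \<oplus> k \<otimes> D \<oplus> E"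
      if "A \<in> carrier L" "B \<in> carrier L" "D \<in> carrier L" "E \<in> carrier L" "k \<in> carrier L" for A B D E k
      using that by algebra
    have "?P \<pi> \<tau> \<oplus> (k \<oplus> \<ominus> y a) \<otimes> ?q = ?f \<oplus> k \<otimes> ?q \<oplus> ?s \<pi> \<tau>"
      unfolding P using \<pi>\<tau> \<phi> ya wa k sc by (intro id) auto
    then show "?P \<pi> \<tau> \<oplus> (k \<oplus> \<ominus> y a) \<otimes> ?q = \<phi>' (\<pi> \<otimes>\<^bsub>galois_group L K\<^esub> \<tau>) \<oplus> ?s \<pi> \<tau>"
      using \<pi>\<tau> k wa by (simp add: \<phi>'_def)
    show "\<phi>' (\<pi> \<otimes>\<^bsub>galois_group L K\<^esub> \<tau>) \<oplus> ?s \<pi> \<tau> \<in> carrier L" using \<phi>' sc \<pi>\<tau> by simp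
  qed
  finally have "\<exists>x\<in>carrier L. nonsingular Gal (\<lambda>\<pi> \<tau>. \<phi>' (\<pi> \<otimes>\<^bsub>galois_group L K\<^esub> \<tau>) \<oplus> \<pi> (\<tau> x))"
    using yI wI \<phi>' by (intro insert.IH)
  then obtain x where x: "x \<in> carrier L"
    and nsx: "nonsingular Gal (\<lambda>\<pi> \<tau>. \<phi>' (\<pi> \<otimes>\<^bsub>galois_group L K\<^esub> \<tau>) \<oplus> \<pi> (\<tau> x))" by blast
  have "nonsingular Gal (\<lambda>\<pi> \<tau>. \<phi>' (\<pi> \<otimes>\<^bsub>galois_group L K\<^esub> \<tau>) \<oplus> \<pi> (\<tau> x)) \<longleftrightarrow>
    nonsingular Gal (\<lambda>\<pi> \<tau>. \<phi> (\<pi> \<otimes>\<^bsub>galois_group L K\<^esub> \<tau>) \<oplus> \<pi> (\<tau> (k \<otimes> w a \<oplus> x)))"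
    using x k wa \<phi> by (intro nonsingular_cong) (auto simp: \<phi>'_def a_assoc)
  then show ?case using nsx x k wa by (intro bexI[of _ "k \<otimes> w a \<oplus> x"]) auto
qed

text \<open>Dedekind independence gives coefficients \<open>b\<close> in L for which the sum of b x
  \<rho>(x) over \<open>V\<close> vanishes exactly for \<rho> other than the identity. The matrix
  with entries the sums of b x \<pi>(\<tau>(x)) is then a nonzero multiple of a permutation matrix,
  and \<open>b\<close> is specialized to K.\<close>

lemma exists_conj_independent_infinite:
  assumes K: "infinite K"
  shows "\<exists>x. conj_independent x"
proof -
  let ?G = "galois_group L K"
  obtain V where V: "finite V" "V \<subseteq> carrier L"
    and span: "\<And>Z. V \<subseteq> Z \<Longrightarrow> Z \<subseteq> carrier L \<Longrightarrow> \<zero> \<in> Z \<Longrightarrow> (\<And>x y. x \<in> Z \<Longrightarrow> y \<in> Z \<Longrightarrow> x \<oplus> y \<in> Z) \<Longrightarrow>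
      (\<And>k x. k \<in> K \<Longrightarrow> x \<in> Z \<Longrightarrow> k \<otimes> x \<in> Z) \<Longrightarrow> carrier L \<subseteq> Z"
    using finite_spanning_set by metis
  have Vc: "x \<in> carrier L" if "x \<in> V" for x using V that by auto
  \<comment> \<open>Restrictions to \<open>V\<close> of L-combinations of the automorphisms other
    than the identity; the identity is to be separated from them.\<close>
  define W where "W = {w. \<exists>d\<in>Gal \<rightarrow> carrier L. d \<one>\<^bsub>?G\<^esub> = \<zero> \<and> (\<forall>x\<in>V. w x = (\<Oplus>\<tau>\<in>Gal. d \<tau> \<otimes> \<tau> x))}"
  have "\<exists>b\<in>V \<rightarrow> carrier L. (\<forall>w\<in>W. (\<Oplus>x\<in>V. b x \<otimes> w x) = \<zero>) \<and> (\<Oplus>x\<in>V. b x \<otimes> x) \<noteq> \<zero>"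
  proof (rule separating_functional[OF carrier_is_subfield V(1)])
    have "(\<lambda>x. \<Oplus>\<tau>\<in>Gal. \<zero> \<otimes> \<tau> x) \<in> W" unfolding W_def by (auto intro!: bexI[of _ "\<lambda>_. \<zero>"])
    then show "W \<noteq> {}" by blast
    show "w \<in> V \<rightarrow> carrier L" if "w \<in> W" for w
    proof
      fix x assume x: "x \<in> V"
      then obtain d where d: "d \<in> Gal \<rightarrow> carrier L" "w x = (\<Oplus>\<tau>\<in>Gal. d \<tau> \<otimes> \<tau> x)"
        using \<open>w \<in> W\<close> unfolding W_def by blast
      show "w x \<in> carrier L" unfolding d(2) using d(1) Vc[OF x] by (intro finsum_closed) (auto simp: Pi_iff)
    qed
    show "(\<lambda>i. w i \<oplus> w' i) \<in> W" if "w \<in> W" "w' \<in> W" for w w'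
    proof -
      obtain d where d: "d \<in> Gal \<rightarrow> carrier L" "d \<one>\<^bsub>?G\<^esub> = \<zero>" "\<forall>x\<in>V. w x = (\<Oplus>\<tau>\<in>Gal. d \<tau> \<otimes> \<tau> x)"
        using \<open>w \<in> W\<close>[unfolded W_def mem_Collect_eq] by (elim bexE conjE) (rule that)
      obtain d' where d': "d' \<in> Gal \<rightarrow> carrier L" "d' \<one>\<^bsub>?G\<^esub> = \<zero>" "\<forall>x\<in>V. w' x = (\<Oplus>\<tau>\<in>Gal. d' \<tau> \<otimes> \<tau> x)"
        using \<open>w' \<in> W\<close>[unfolded W_def mem_Collect_eq] by (elim bexE conjE) (rule that)
      have "w x \<oplus> w' x = (\<Oplus>\<tau>\<in>Gal. (d \<tau> \<oplus> d' \<tau>) \<otimes> \<tau> x)" if x: "x \<in> V" for x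
      proof -
        have "(\<Oplus>\<tau>\<in>Gal. (d \<tau> \<oplus> d' \<tau>) \<otimes> \<tau> x) = (\<Oplus>\<tau>\<in>Gal. d \<tau> \<otimes> \<tau> x \<oplus> d' \<tau> \<otimes> \<tau> x)"
          using d(1) d'(1) Vc[OF x] by (intro finsum_cong') (auto simp: Pi_iff l_distr)
        also have "\<dots> = w x \<oplus> w' x"
          using d d' Vc[OF x] x by (subst finsum_addf) (auto simp: Pi_iff)
        finally show ?thesis by simp
      qed
      then show ?thesis
        unfolding W_def using d(1,2) d'(1,2) by (auto intro!: bexI[of _ "\<lambda>\<tau>. d \<tau> \<oplus> d' \<tau>"] simp: Pi_iff)
    qed
    show "(\<lambda>i. k \<otimes> w i) \<in> W" if k: "k \<in> carrier L" and w: "w \<in> W" for k w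
    proof -
      obtain d where d: "d \<in> Gal \<rightarrow> carrier L" "d \<one>\<^bsub>?G\<^esub> = \<zero>" "\<forall>x\<in>V. w x = (\<Oplus>\<tau>\<in>Gal. d \<tau> \<otimes> \<tau> x)"
        using w[unfolded W_def mem_Collect_eq] by (elim bexE conjE) (rule that)
      have "k \<otimes> w x = (\<Oplus>\<tau>\<in>Gal. (k \<otimes> d \<tau>) \<otimes> \<tau> x)" if x: "x \<in> V" for x
      proof -
        have "k \<otimes> w x = (\<Oplus>\<tau>\<in>Gal. k \<otimes> (d \<tau> \<otimes> \<tau> x))"
          using d k Vc[OF x] x by (simp add: finsum_rdistr Pi_iff)
        also have "\<dots> = (\<Oplus>\<tau>\<in>Gal. (k \<otimes> d \<tau>) \<otimes> \<tau> x)"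
          using d(1) k Vc[OF x] by (intro finsum_cong') (auto simp: Pi_iff m_assoc)
        finally show ?thesis .
      qed
      then show ?thesis
        unfolding W_def using d(1,2) k by (auto intro!: bexI[of _ "\<lambda>\<tau>. k \<otimes> d \<tau>"] simp: Pi_iff)
    qed
    show "(\<lambda>x. x) \<in> V \<rightarrow> carrier L" using Vc by simp
    show "\<exists>i\<in>V. i \<noteq> w i" if w: "w \<in> W" for w
    proof (rule ccontr)
      assume *: "\<not> ?thesis"
      obtain d where d: "d \<in> Gal \<rightarrow> carrier L" "d \<one>\<^bsub>?G\<^esub> = \<zero>" "\<forall>x\<in>V. w x = (\<Oplus>\<tau>\<in>Gal. d \<tau> \<otimes> \<tau> x)"
        using w[unfolded W_def mem_Collect_eq] by (elim bexE conjE) (rule that)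
      \<comment> \<open>With coefficient -1 at the identity, agreement on \<open>V\<close> becomes a
        relation that independence forbids.\<close>
      let ?e = "\<lambda>\<tau>. if \<tau> = \<one>\<^bsub>?G\<^esub> then \<ominus> \<one> else d \<tau>"
      have ec: "?e \<in> Gal \<rightarrow> carrier L" using d(1) by (auto simp: Pi_iff)
      have "(\<Oplus>\<tau>\<in>Gal. ?e \<tau> \<otimes> \<tau> x) = \<zero>" if x: "x \<in> V" for x
      proof -
        have dc: "d \<tau> \<otimes> \<tau> x \<in> carrier L" if "\<tau> \<in> Gal" for \<tau> using d(1) Vc[OF x] that by auto
        have rest: "(\<Oplus>\<tau>\<in>Gal - {\<one>\<^bsub>?G\<^esub>}. d \<tau> \<otimes> \<tau> x) \<in> carrier L"
          using dc by (intro finsum_closed) auto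
        have "x = (\<Oplus>\<tau>\<in>Gal. d \<tau> \<otimes> \<tau> x)" using * x d(3) by auto
        also have "\<dots> = d \<one>\<^bsub>?G\<^esub> \<otimes> \<one>\<^bsub>?G\<^esub> x \<oplus> (\<Oplus>\<tau>\<in>Gal - {\<one>\<^bsub>?G\<^esub>}. d \<tau> \<otimes> \<tau> x)"
          using dc by (intro finsum_remove) auto
        also have "\<dots> = (\<Oplus>\<tau>\<in>Gal - {\<one>\<^bsub>?G\<^esub>}. d \<tau> \<otimes> \<tau> x)"
          using d(2) Vc[OF x] rest by simp
        also have "\<dots> = (\<Oplus>\<tau>\<in>Gal - {\<one>\<^bsub>?G\<^esub>}. ?e \<tau> \<otimes> \<tau> x)"
          using dc by (intro finsum_cong') auto
        finally have xs: "(\<Oplus>\<tau>\<in>Gal - {\<one>\<^bsub>?G\<^esub>}. ?e \<tau> \<otimes> \<tau> x) = x" by simp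
        have "(\<Oplus>\<tau>\<in>Gal. ?e \<tau> \<otimes> \<tau> x) = ?e \<one>\<^bsub>?G\<^esub> \<otimes> \<one>\<^bsub>?G\<^esub> x \<oplus> (\<Oplus>\<tau>\<in>Gal - {\<one>\<^bsub>?G\<^esub>}. ?e \<tau> \<otimes> \<tau> x)"
          using ec Vc[OF x] by (intro finsum_remove) (auto simp: Pi_iff)
        then show ?thesis unfolding xs using Vc[OF x] by (simp add: l_minus l_neg)
      qed
      then have "\<forall>\<tau>\<in>Gal. ?e \<tau> = \<zero>"
        by (intro combination_zero_if_zero_on_spanning_set[OF V(2) span finite_Gal _ ec]) auto
      then have "\<ominus> \<one> = \<zero>" by (metis Gal.one_closed)
      then show False by (metis minus_minus minus_zero one_closed one_not_zero)
    qed
  qed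
  then obtain b where b: "b \<in> V \<rightarrow> carrier L" "\<And>w. w \<in> W \<Longrightarrow> (\<Oplus>x\<in>V. b x \<otimes> w x) = \<zero>"
    and k0: "(\<Oplus>x\<in>V. b x \<otimes> x) \<noteq> \<zero>" by blast
  define \<kappa> where "\<kappa> = (\<Oplus>x\<in>V. b x \<otimes> x)"
  have \<kappa>: "\<kappa> \<in> carrier L" "\<kappa> \<noteq> \<zero>"
    using k0 b(1) Vc unfolding \<kappa>_def by (auto intro!: finsum_closed simp: Pi_iff)
  have other: "(\<Oplus>x\<in>V. b x \<otimes> \<rho> x) = \<zero>" if \<rho>: "\<rho> \<in> Gal" "\<rho> \<noteq> \<one>\<^bsub>?G\<^esub>" for \<rho>
  proof (rule b(2))
    let ?d = "\<lambda>\<tau>. if \<tau> = \<rho> then \<one> else \<zero>"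
    have "\<rho> x = (\<Oplus>\<tau>\<in>Gal. ?d \<tau> \<otimes> \<tau> x)" if x: "x \<in> V" for x
    proof -
      have "(\<Oplus>\<tau>\<in>Gal. ?d \<tau> \<otimes> \<tau> x) = (\<Oplus>\<tau>\<in>Gal. if \<tau> = \<rho> then \<tau> x else \<zero>)"
        using Vc[OF x] by (intro finsum_cong') auto
      also have "\<dots> = \<rho> x" using Vc[OF x] \<rho> by (intro add.finprod_singleton_swap) auto
      finally show ?thesis by simp
    qed
    then show "\<rho> \<in> W" unfolding W_def using \<rho> by (auto intro!: bexI[of _ ?d])
  qed
  \<comment> \<open>The leading zero is the initial value of the absorbed part \<phi> in the
    specialization lemma.\<close>
  let ?P = "\<lambda>\<pi> \<tau>. \<zero> \<oplus> (\<Oplus>x\<in>V. b x \<otimes> \<pi> (\<tau> x))"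
  have P: "?P \<pi> \<tau> = (if \<tau> = inv\<^bsub>?G\<^esub> \<pi> then \<kappa> else \<zero>)" if \<pi>\<tau>: "\<pi> \<in> Gal" "\<tau> \<in> Gal" for \<pi> \<tau>
  proof -
    have bc: "(\<Oplus>x\<in>V. b x \<otimes> \<pi> (\<tau> x)) \<in> carrier L"
      using \<pi>\<tau> Vc b(1) by (intro finsum_closed) (auto simp: Pi_iff)
    have eq: "(\<Oplus>x\<in>V. b x \<otimes> \<pi> (\<tau> x)) = (\<Oplus>x\<in>V. b x \<otimes> (\<pi> \<otimes>\<^bsub>?G\<^esub> \<tau>) x)"
      using \<pi>\<tau> Vc b(1) by (intro finsum_cong') (auto simp: Pi_iff)
    show ?thesis
    proof (cases "\<tau> = inv\<^bsub>?G\<^esub> \<pi>")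
      case True
      have "(\<Oplus>x\<in>V. b x \<otimes> \<pi> (\<tau> x)) = \<kappa>"
        unfolding \<kappa>_def True using \<pi>\<tau> Vc b(1) by (intro finsum_cong') (auto simp: Pi_iff)
      then show ?thesis using True \<kappa> by simp
    next
      case False
      then have "\<pi> \<otimes>\<^bsub>?G\<^esub> \<tau> \<noteq> \<one>\<^bsub>?G\<^esub>" using \<pi>\<tau> by (metis Gal.inv_equality Gal.inv_inv Gal.inv_closed)
      then show ?thesis using False other[of "\<pi> \<otimes>\<^bsub>?G\<^esub> \<tau>"] \<pi>\<tau> eq by simp
    qed
  qed
  have "nonsingular Gal ?P"
  proof (rule nonsingularI)
    fix c assume c: "c \<in> Gal \<rightarrow> carrier L" and zero: "\<forall>\<pi>\<in>Gal. (\<Oplus>\<tau>\<in>Gal. c \<tau> \<otimes> ?P \<pi> \<tau>) = \<zero>"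
    show "\<forall>\<tau>\<in>Gal. c \<tau> = \<zero>"
    proof
      fix \<rho> assume \<rho>: "\<rho> \<in> Gal"
      let ?\<pi> = "inv\<^bsub>?G\<^esub> \<rho>"
      have cc: "\<And>\<tau>. \<tau> \<in> Gal \<Longrightarrow> c \<tau> \<in> carrier L" using c by auto
      have "(\<Oplus>\<tau>\<in>Gal. c \<tau> \<otimes> ?P ?\<pi> \<tau>) = (\<Oplus>\<tau>\<in>Gal. if \<tau> = \<rho> then c \<tau> \<otimes> \<kappa> else \<zero>)"
        using cc \<kappa> \<rho> P[of ?\<pi>] by (intro finsum_cong') auto
      also have "\<dots> = c \<rho> \<otimes> \<kappa>" using cc \<kappa> \<rho> by (intro add.finprod_singleton_swap) auto
      finally have "c \<rho> \<otimes> \<kappa> = \<zero>" using zero \<rho> by simp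
      then show "c \<rho> = \<zero>" using cc[OF \<rho>] \<kappa> by (auto simp: integral_iff)
    qed
  qed
  then have "\<exists>x\<in>carrier L. nonsingular Gal (\<lambda>\<pi> \<tau>. (\<lambda>_. \<zero>) (\<pi> \<otimes>\<^bsub>?G\<^esub> \<tau>) \<oplus> \<pi> (\<tau> x))"
    using b(1) Vc by (intro nonsingular_specialize[OF K V(1)]) auto
  then obtain x where x: "x \<in> carrier L" "nonsingular Gal (\<lambda>\<pi> \<tau>. \<zero> \<oplus> \<pi> (\<tau> x))" by blast
  have "nonsingular Gal (\<lambda>\<pi> \<tau>. \<zero> \<oplus> \<pi> (\<tau> x)) \<longleftrightarrow> nonsingular Gal (\<lambda>\<pi> \<tau>. \<pi> (\<tau> x))"
    using x(1) by (intro nonsingular_cong) auto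
  then show ?thesis using x conj_independent_iff_nonsingular by blast
qed

text \<open>Since \<rho>^|G| = 1, the element \<rho> + c divides the scalar 1 - (-c)^|G| in K[G] and
  is a unit when that scalar is nonzero. On the coefficients of a relation this is a recursion along
  the powers of the inverse of \<rho>.\<close>

lemma conj_independent_shift:
  assumes x: "conj_independent x" and \<rho>: "\<rho> \<in> Gal" and c: "c \<in> K"
    and nroot: "(\<ominus> c) [^] order (galois_group L K) \<noteq> \<one>"
  shows "conj_independent (\<rho> x \<oplus> c \<otimes> x)"
proof -
  let ?G = "galois_group L K"
  have xc: "x \<in> carrier L" using x by (rule conj_independent_closed)
  let ?r = "inv\<^bsub>?G\<^esub> \<rho>"
  show ?thesis
  proof (rule conj_independentI)
    fix b assume b: "b \<in> Gal \<rightarrow> K" and zero: "(\<Oplus>\<tau>\<in>Gal. b \<tau> \<otimes> \<tau> (\<rho> x \<oplus> c \<otimes> x)) = \<zero>"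
    have bK: "b \<tau> \<in> K" if "\<tau> \<in> Gal" for \<tau> using b that by auto
    have "(\<Oplus>\<tau>\<in>Gal. b \<tau> \<otimes> \<tau> (\<rho> x \<oplus> c \<otimes> x)) = (\<Oplus>\<tau>\<in>Gal. b \<tau> \<otimes> \<tau> (\<rho> x) \<oplus> (c \<otimes> b \<tau>) \<otimes> \<tau> x)"
      using bK \<rho> c xc by (intro finsum_cong') (auto simp: r_distr m_ac)
    also have "\<dots> = (\<Oplus>\<tau>\<in>Gal. b \<tau> \<otimes> \<tau> (\<rho> x)) \<oplus> (\<Oplus>\<tau>\<in>Gal. (c \<otimes> b \<tau>) \<otimes> \<tau> x)"
      using bK \<rho> c xc by (intro finsum_addf) auto
    also have "(\<Oplus>\<tau>\<in>Gal. b \<tau> \<otimes> \<tau> (\<rho> x)) = (\<Oplus>\<tau>\<in>Gal. (\<lambda>\<tau>. b (\<tau> \<otimes>\<^bsub>?G\<^esub> ?r) \<otimes> \<tau> x) (\<tau> \<otimes>\<^bsub>?G\<^esub> \<rho>))"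
      using bK \<rho> xc by (intro finsum_cong') (auto simp: Gal.m_assoc)
    also have "\<dots> = (\<Oplus>\<tau>\<in>Gal. b (\<tau> \<otimes>\<^bsub>?G\<^esub> ?r) \<otimes> \<tau> x)"
      using bK \<rho> xc by (intro finsum_Gal_mult_right) auto
    also have "\<dots> \<oplus> (\<Oplus>\<tau>\<in>Gal. (c \<otimes> b \<tau>) \<otimes> \<tau> x) = (\<Oplus>\<tau>\<in>Gal. b (\<tau> \<otimes>\<^bsub>?G\<^esub> ?r) \<otimes> \<tau> x \<oplus> (c \<otimes> b \<tau>) \<otimes> \<tau> x)"
      using bK \<rho> c xc by (intro finsum_addf[symmetric]) auto
    also have "\<dots> = (\<Oplus>\<tau>\<in>Gal. (b (\<tau> \<otimes>\<^bsub>?G\<^esub> ?r) \<oplus> c \<otimes> b \<tau>) \<otimes> \<tau> x)"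
      using bK \<rho> c xc by (intro finsum_cong') (auto simp: l_distr)
    finally have "(\<Oplus>\<tau>\<in>Gal. (b (\<tau> \<otimes>\<^bsub>?G\<^esub> ?r) \<oplus> c \<otimes> b \<tau>) \<otimes> \<tau> x) = \<zero>" using zero by simp
    moreover have "(\<lambda>\<tau>. b (\<tau> \<otimes>\<^bsub>?G\<^esub> ?r) \<oplus> c \<otimes> b \<tau>) \<in> Gal \<rightarrow> K"
      using bK \<rho> c K_subring by auto
    ultimately have coeff: "b (\<tau> \<otimes>\<^bsub>?G\<^esub> ?r) \<oplus> c \<otimes> b \<tau> = \<zero>" if "\<tau> \<in> Gal" for \<tau>
      using x that unfolding conj_independent_def by fast
    have step: "b (\<tau> \<otimes>\<^bsub>?G\<^esub> ?r) = (\<ominus> c) \<otimes> b \<tau>" if "\<tau> \<in> Gal" for \<tau>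
    proof -
      have "b (\<tau> \<otimes>\<^bsub>?G\<^esub> ?r) = \<ominus> (c \<otimes> b \<tau>)"
        using coeff[OF that] bK[OF that] bK[of "\<tau> \<otimes>\<^bsub>?G\<^esub> ?r"] c that \<rho> by (intro minus_equality[symmetric]) auto
      then show ?thesis using bK[OF that] c by (simp add: l_minus)
    qed
    have steps: "b (\<tau> \<otimes>\<^bsub>?G\<^esub> ?r [^]\<^bsub>?G\<^esub> i) = (\<ominus> c) [^] i \<otimes> b \<tau>" if \<tau>: "\<tau> \<in> Gal" for \<tau> and i :: nat
    proof (induction i)
      case 0
      then show ?case using bK[OF \<tau>] \<tau> by simp
    next
      case (Suc i)
      have "b (\<tau> \<otimes>\<^bsub>?G\<^esub> ?r [^]\<^bsub>?G\<^esub> Suc i) = b ((\<tau> \<otimes>\<^bsub>?G\<^esub> ?r [^]\<^bsub>?G\<^esub> i) \<otimes>\<^bsub>?G\<^esub> ?r)"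
        using \<tau> \<rho> by (simp add: Gal.m_assoc)
      also have "\<dots> = (\<ominus> c) \<otimes> ((\<ominus> c) [^] i \<otimes> b \<tau>)"
        using step[of "\<tau> \<otimes>\<^bsub>?G\<^esub> ?r [^]\<^bsub>?G\<^esub> i"] \<tau> \<rho> Suc by simp
      finally show ?case using bK[OF \<tau>] c by (simp add: m_ac)
    qed
    show "\<forall>\<tau>\<in>Gal. b \<tau> = \<zero>"
    proof
      fix \<tau> assume \<tau>: "\<tau> \<in> Gal"
      let ?e = "(\<ominus> c) [^] order ?G"
      have ec: "?e \<in> carrier L" using c by simp
      have "?r [^]\<^bsub>?G\<^esub> order ?G = \<one>\<^bsub>?G\<^esub>" using \<rho> by (simp add: Gal.pow_order_eq_1)
      then have "b \<tau> = ?e \<otimes> b \<tau>" using steps[OF \<tau>, of "order ?G"] \<tau> by simp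
      then have "(?e \<oplus> \<ominus> \<one>) \<otimes> b \<tau> = \<zero>"
        using ec bK[OF \<tau>] by (simp add: l_distr l_minus r_neg)
      moreover have "?e \<oplus> \<ominus> \<one> \<noteq> \<zero>"
        using nroot ec by (metis a_inv_closed minus_equality minus_minus one_closed)
      ultimately show "b \<tau> = \<zero>" using ec bK[OF \<tau>] by (auto simp: integral_iff)
    qed
  qed (use xc \<rho> c in simp)
qed

text \<open>Linear forms with nested kernels are proportional; nondegeneracy of the trace form
  carries the factor over to \<delta> and \<gamma>.\<close>

lemma proportional_if_trace_kernel_subset:
  assumes \<gamma>: "\<gamma> \<in> carrier L" "\<gamma> \<noteq> \<zero>" and \<delta>: "\<delta> \<in> carrier L"
    and ker: "\<And>v. v \<in> carrier L \<Longrightarrow> trace (\<gamma> \<otimes> v) = \<zero> \<Longrightarrow> trace (\<delta> \<otimes> v) = \<zero>"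
  shows "\<exists>k\<in>K. \<delta> = k \<otimes> \<gamma>"
proof -
  obtain u where u: "u \<in> carrier L" "trace (\<gamma> \<otimes> u) \<noteq> \<zero>" using trace_nondegenerate \<gamma> by blast
  let ?g = "trace (\<gamma> \<otimes> u)" and ?d = "trace (\<delta> \<otimes> u)"
  have gK: "?g \<in> K - {\<zero>}" and dK: "?d \<in> K" using u \<gamma> \<delta> by auto
  have ig: "inv ?g \<in> K" "inv ?g \<otimes> ?g = \<one>" using subfield_m_inv[OF subfield gK] by auto
  have "?g \<otimes> \<delta> \<oplus> \<ominus> (?d \<otimes> \<gamma>) = \<zero>"
  proof (rule trace_nondegenerate)
    fix v assume v: "v \<in> carrier L"
    let ?t = "trace (\<gamma> \<otimes> v)"
    have tK: "?t \<in> K" using v \<gamma> by simp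
    \<comment> \<open>The multiple of \<open>u\<close> is chosen to place \<open>?w\<close> in the
      kernel of Tr(\<gamma> .).\<close>
    let ?w = "?g \<otimes> v \<oplus> (\<ominus> ?t) \<otimes> u"
    have wc: "?w \<in> carrier L" using v u gK tK by simp
    have lin: "trace (\<epsilon> \<otimes> ?w) = ?g \<otimes> trace (\<epsilon> \<otimes> v) \<oplus> (\<ominus> ?t) \<otimes> trace (\<epsilon> \<otimes> u)" if \<epsilon>: "\<epsilon> \<in> carrier L" for \<epsilon>
    proof -
      have "\<epsilon> \<otimes> ?w = ?g \<otimes> (\<epsilon> \<otimes> v) \<oplus> (\<ominus> ?t) \<otimes> (\<epsilon> \<otimes> u)"
        using \<epsilon> v u gK tK by (simp add: r_distr m_lcomm)
      moreover have "\<ominus> ?t \<in> K" using tK K_subring by simp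
      ultimately show ?thesis using \<epsilon> v u gK tK by (simp only: trace_add trace_smult m_closed K_closed Diff_iff)
    qed
    have "trace (\<gamma> \<otimes> ?w) = \<zero>" using lin[OF \<gamma>(1)] gK tK by (simp add: l_minus r_minus m_comm r_neg)
    then have "trace (\<delta> \<otimes> ?w) = \<zero>" using ker wc by blast
    then have eq: "?g \<otimes> trace (\<delta> \<otimes> v) \<oplus> (\<ominus> ?t) \<otimes> ?d = \<zero>" using lin[OF \<delta>] by simp
    have "(?g \<otimes> \<delta> \<oplus> \<ominus> (?d \<otimes> \<gamma>)) \<otimes> v = ?g \<otimes> (\<delta> \<otimes> v) \<oplus> (\<ominus> ?d) \<otimes> (\<gamma> \<otimes> v)"
      using \<gamma> \<delta> v gK dK by (simp add: l_distr l_minus m_assoc)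
    moreover have "\<ominus> ?d \<in> K" using dK K_subring by simp
    ultimately have "trace ((?g \<otimes> \<delta> \<oplus> \<ominus> (?d \<otimes> \<gamma>)) \<otimes> v) = ?g \<otimes> trace (\<delta> \<otimes> v) \<oplus> (\<ominus> ?d) \<otimes> ?t"
      using \<gamma> \<delta> v gK dK by (simp only: trace_add trace_smult m_closed K_closed Diff_iff)
    also have "(\<ominus> ?d) \<otimes> ?t = (\<ominus> ?t) \<otimes> ?d" using dK tK by (simp add: l_minus r_minus m_comm)
    finally show "trace ((?g \<otimes> \<delta> \<oplus> \<ominus> (?d \<otimes> \<gamma>)) \<otimes> v) = \<zero>" using eq by simp
  qed (use \<gamma> \<delta> gK dK in simp)
  then have eq: "?g \<otimes> \<delta> = ?d \<otimes> \<gamma>"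
    using \<gamma> \<delta> gK dK by (metis Diff_iff K_closed a_inv_closed m_closed minus_equality minus_minus)
  have "\<delta> = (inv ?g \<otimes> ?g) \<otimes> \<delta>" using ig \<delta> by simp
  also have "\<dots> = (inv ?g \<otimes> ?d) \<otimes> \<gamma>" using ig(1) gK dK \<gamma> \<delta> by (simp add: m_assoc eq)
  finally show ?thesis using K_subring(6)[OF ig(1) dK] by blast
qed

lemma trace_mult_Gal:
  assumes "\<tau> \<in> Gal" "\<gamma> \<in> carrier L" "x \<in> carrier L"
  shows "trace (\<gamma> \<otimes> (inv\<^bsub>galois_group L K\<^esub> \<tau>) x) = trace (\<tau> \<gamma> \<otimes> x)"
  using trace_Gal[of \<tau> "\<gamma> \<otimes> (inv\<^bsub>galois_group L K\<^esub> \<tau>) x"] assms by simp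

lemma proportional_conjugate_infinite:
  assumes K: "infinite K" and \<gamma>: "\<gamma> \<in> carrier L" "\<gamma> \<noteq> \<zero>"
    and nz: "\<And>x. conj_independent x \<Longrightarrow> trace (\<gamma> \<otimes> x) \<noteq> \<zero>" and \<tau>: "\<tau> \<in> Gal"
  shows "\<exists>k\<in>K. \<tau> \<gamma> = k \<otimes> \<gamma>"
proof (rule proportional_if_trace_kernel_subset[OF \<gamma>])
  let ?G = "galois_group L K"
  let ?\<rho> = "inv\<^bsub>?G\<^esub> \<tau>"
  have \<rho>: "?\<rho> \<in> Gal" using \<tau> by simp
  fix v assume v: "v \<in> carrier L" "trace (\<gamma> \<otimes> v) = \<zero>"
  show "trace (\<tau> \<gamma> \<otimes> v) = \<zero>"
  proof (rule ccontr)
    assume nzv: "trace (\<tau> \<gamma> \<otimes> v) \<noteq> \<zero>"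
    obtain x where x: "conj_independent x" using exists_conj_independent_infinite[OF K] by blast
    have xc: "x \<in> carrier L" using x by (rule conj_independent_closed)
    define a where "a = trace (\<gamma> \<otimes> x)"
    define e where "e = trace (\<tau> \<gamma> \<otimes> v)"
    define f where "f = trace (\<tau> \<gamma> \<otimes> x)"
    have aK: "a \<in> K - {\<zero>}" and eK: "e \<in> K - {\<zero>}" and fK: "f \<in> K"
      using nz[OF x] nzv xc v \<gamma> \<tau> by (auto simp: a_def e_def f_def)
    have ia: "inv a \<in> K - {\<zero>}" "inv a \<otimes> a = \<one>" using subfield_m_inv[OF subfield aK] by auto
    \<comment> \<open>As Tr(\<gamma> v) = 0, the form takes the value f + s e + c a at (\<rho> +
      c)(x + s v); this \<open>c\<close> makes it vanish.\<close>
    define c where "c = (\<lambda>s. \<ominus> (inv a \<otimes> (f \<oplus> s \<otimes> e)))"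
    have cK: "c s \<in> K" if "s \<in> K" for s
      unfolding c_def using that aK eK fK ia K_subring by simp
    have mc: "\<ominus> c s = inv a \<otimes> (f \<oplus> s \<otimes> e)" if "s \<in> K" for s
      unfolding c_def using that eK fK ia by simp
    \<comment> \<open>The values of \<open>s\<close> for which x + s v yields no normal basis,
      finitely many by the pencil lemma.\<close>
    let ?bad1 = "{s \<in> carrier L. \<not> nonsingular Gal (\<lambda>\<pi> \<tau>. \<pi> (\<tau> x) \<oplus> s \<otimes> \<pi> (\<tau> v))}"
    have "finite ?bad1"
      using x xc v conj_independent_iff_nonsingular by (intro finite_singular_in_pencil[OF finite_Gal]) auto
    \<comment> \<open>The map is affine in \<open>s\<close> with nonzero slope e / a, so each root
      of unity is hit at most once.\<close>
    moreover have "finite {s \<in> K. (\<ominus> c s) [^] order ?G = \<one>}"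
    proof (rule finite_imageD)
      show "inj_on (\<lambda>s. \<ominus> c s) {s \<in> K. (\<ominus> c s) [^] order ?G = \<one>}"
      proof (rule inj_onI)
        fix s t assume "s \<in> {s \<in> K. (\<ominus> c s) [^] order ?G = \<one>}" "t \<in> {s \<in> K. (\<ominus> c s) [^] order ?G = \<one>}"
          and eq: "\<ominus> c s = \<ominus> c t"
        then have st: "s \<in> K" "t \<in> K" by auto
        have "f \<oplus> s \<otimes> e = f \<oplus> t \<otimes> e"
          using eq mc[OF st(1)] mc[OF st(2)] st ia(1) eK fK by (simp add: m_lcancel)
        then have "s \<otimes> e \<oplus> f = t \<otimes> e \<oplus> f"
          using a_comm[of f "s \<otimes> e"] a_comm[of f "t \<otimes> e"] st eK fK by simp
        then have "s \<otimes> e = t \<otimes> e" using st eK fK add.right_cancel[of f "s \<otimes> e" "t \<otimes> e"] by simp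
        then show "s = t" using st eK m_rcancel[of e s t] by simp
      qed
      have "order ?G > 0" using Gal.order_gt_0_iff_finite by simp
      from card_roots_of_unity_le(1)[OF this]
      show "finite ((\<lambda>s. \<ominus> c s) ` {s \<in> K. (\<ominus> c s) [^] order ?G = \<one>})"
        by (rule rev_finite_subset) (auto intro: cK K_closed)
    qed
    ultimately have "\<not> K \<subseteq> ?bad1 \<union> {s \<in> K. (\<ominus> c s) [^] order ?G = \<one>}"
      using K finite_subset by blast
    then obtain s where s: "s \<in> K" "s \<notin> ?bad1" "(\<ominus> c s) [^] order ?G \<noteq> \<one>" by blast
    let ?y = "x \<oplus> s \<otimes> v"
    have yc: "?y \<in> carrier L" using xc s v by simp
    have "nonsingular Gal (\<lambda>\<pi> \<tau>. \<pi> (\<tau> x) \<oplus> s \<otimes> \<pi> (\<tau> v)) \<longleftrightarrow> nonsingular Gal (\<lambda>\<pi> \<tau>. \<pi> (\<tau> ?y))"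
      using xc s(1) v by (intro nonsingular_cong) auto
    then have y: "conj_independent ?y"
      using s conj_independent_iff_nonsingular[OF yc] by auto
    have "conj_independent (?\<rho> ?y \<oplus> c s \<otimes> ?y)"
      using conj_independent_shift[OF y \<rho> cK[OF s(1)] s(3)] .
    then have "trace (\<gamma> \<otimes> (?\<rho> ?y \<oplus> c s \<otimes> ?y)) \<noteq> \<zero>" by (rule nz)
    moreover have "trace (\<gamma> \<otimes> (?\<rho> ?y \<oplus> c s \<otimes> ?y)) = \<zero>"
    proof -
      have c: "c s \<in> carrier L" using cK s by simp
      have "trace (\<gamma> \<otimes> (?\<rho> ?y \<oplus> c s \<otimes> ?y)) = trace (\<gamma> \<otimes> ?\<rho> ?y \<oplus> c s \<otimes> (\<gamma> \<otimes> ?y))"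
        using \<gamma> \<rho> yc c by (simp only: r_distr m_lcomm Gal_closed m_closed)
      also have "\<dots> = trace (\<gamma> \<otimes> ?\<rho> ?y) \<oplus> trace (c s \<otimes> (\<gamma> \<otimes> ?y))"
        using \<gamma>(1) \<rho> yc c by (intro trace_add) auto
      also have "\<dots> = trace (\<tau> \<gamma> \<otimes> ?y) \<oplus> c s \<otimes> trace (\<gamma> \<otimes> ?y)"
        using trace_mult_Gal[OF \<tau> \<gamma>(1) yc] trace_smult[OF cK[OF s(1)], of "\<gamma> \<otimes> ?y"] \<gamma>(1) yc by simp
      also have "trace (\<tau> \<gamma> \<otimes> ?y) = f \<oplus> s \<otimes> e"
      proof -
        have "\<tau> \<gamma> \<otimes> ?y = \<tau> \<gamma> \<otimes> x \<oplus> s \<otimes> (\<tau> \<gamma> \<otimes> v)"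
          using \<gamma> \<tau> xc s(1) v(1) by (simp add: r_distr m_lcomm)
        then show ?thesis unfolding f_def e_def
          using \<gamma>(1) \<tau> xc s(1) v(1) by (simp add: trace_add trace_smult)
      qed
      also have "trace (\<gamma> \<otimes> ?y) = a"
      proof -
        have "\<gamma> \<otimes> ?y = \<gamma> \<otimes> x \<oplus> s \<otimes> (\<gamma> \<otimes> v)"
          using \<gamma> xc s(1) v(1) by (simp add: r_distr m_lcomm)
        then have "trace (\<gamma> \<otimes> ?y) = a \<oplus> s \<otimes> trace (\<gamma> \<otimes> v)" unfolding a_def
          using \<gamma>(1) xc s(1) v(1) by (simp add: trace_add trace_smult)
        then show ?thesis using v(2) s(1) aK by simp
      qed
      also have "c s \<otimes> a = \<ominus> ((inv a \<otimes> a) \<otimes> (f \<oplus> s \<otimes> e))"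
        unfolding c_def using ia(1) aK eK fK s(1) by (simp add: l_minus r_minus m_ac)
      also have "(f \<oplus> s \<otimes> e) \<oplus> \<ominus> ((inv a \<otimes> a) \<otimes> (f \<oplus> s \<otimes> e)) = \<zero>"
        unfolding ia(2) using eK fK s(1) by (simp add: r_neg)
      finally show ?thesis .
    qed
    ultimately show False by simp
  qed
qed (use \<gamma> \<tau> in simp)

end

section \<open>Finite base field and the group algebra\<close>

context finite_galois_extension
begin

text \<open>The group algebra \<open>K[G]\<close> is realized by the operators \<open>x \<mapsto> \<Sum>\<^sub>\<tau> a\<^sub>\<tau> \<tau>(x)\<close>; by Dedekind
  independence an operator determines its coefficients.\<close>

definition group_op :: "(('a \<Rightarrow> 'a) \<Rightarrow> 'a) \<Rightarrow> 'a \<Rightarrow> 'a" where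
  "group_op a = (\<lambda>x\<in>carrier L. \<Oplus>\<tau>\<in>Gal. a \<tau> \<otimes> \<tau> x)"

text \<open>With composition as product the ring laws hold pointwise; convolution of coefficients is
  what shows closure under products.\<close>

definition KG :: "('a \<Rightarrow> 'a) ring" where
  "KG = \<lparr>carrier = group_op ` (Gal \<rightarrow> K), monoid.mult = compose (carrier L), one = (\<lambda>x\<in>carrier L. x),
    ring.zero = (\<lambda>x\<in>carrier L. \<zero>), add = (\<lambda>f g. \<lambda>x\<in>carrier L. f x \<oplus> g x)\<rparr>"

abbreviation "E \<equiv> carrier KG"

definition convolution :: "(('a \<Rightarrow> 'a) \<Rightarrow> 'a) \<Rightarrow> (('a \<Rightarrow> 'a) \<Rightarrow> 'a) \<Rightarrow> ('a \<Rightarrow> 'a) \<Rightarrow> 'a" where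
  "convolution a b \<rho> = (\<Oplus>\<pi>\<in>Gal. a \<pi> \<otimes> b (inv\<^bsub>galois_group L K\<^esub> \<pi> \<otimes>\<^bsub>galois_group L K\<^esub> \<rho>))"

section \<open>Operators and their coefficients\<close>

lemma group_op_apply: "x \<in> carrier L \<Longrightarrow> group_op a x = (\<Oplus>\<tau>\<in>Gal. a \<tau> \<otimes> \<tau> x)"
  by (simp add: group_op_def)

lemma group_op_extensional: "group_op a \<in> extensional (carrier L)"
  by (simp add: group_op_def)

lemma coeff_closed: "a \<in> Gal \<rightarrow> K \<Longrightarrow> \<tau> \<in> Gal \<Longrightarrow> a \<tau> \<in> carrier L"
  by (auto simp: Pi_iff)

lemma group_op_closed:
  assumes "a \<in> Gal \<rightarrow> K" "x \<in> carrier L" shows "group_op a x \<in> carrier L"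
  unfolding group_op_apply[OF assms(2)] using assms(2) coeff_closed[OF assms(1)]
  by (intro finsum_closed) auto

lemma group_op_cong:
  assumes "a \<in> Gal \<rightarrow> K" "\<And>\<tau>. \<tau> \<in> Gal \<Longrightarrow> b \<tau> = a \<tau>" shows "group_op b = group_op a"
  unfolding group_op_def
  by (intro restrict_ext finsum_cong') (use assms coeff_closed[OF assms(1)] in auto)

lemma group_op_add_arg:
  assumes "a \<in> Gal \<rightarrow> K" "x \<in> carrier L" "y \<in> carrier L"
  shows "group_op a (x \<oplus> y) = group_op a x \<oplus> group_op a y"
proof -
  have "(\<Oplus>\<tau>\<in>Gal. a \<tau> \<otimes> \<tau> (x \<oplus> y)) = (\<Oplus>\<tau>\<in>Gal. a \<tau> \<otimes> \<tau> x \<oplus> a \<tau> \<otimes> \<tau> y)"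
    using assms coeff_closed[OF assms(1)] by (intro finsum_cong') (auto simp: r_distr)
  also have "\<dots> = (\<Oplus>\<tau>\<in>Gal. a \<tau> \<otimes> \<tau> x) \<oplus> (\<Oplus>\<tau>\<in>Gal. a \<tau> \<otimes> \<tau> y)"
    using assms coeff_closed[OF assms(1)] by (intro finsum_addf) auto
  finally show ?thesis using assms by (simp add: group_op_apply)
qed

lemma group_op_smult_arg:
  assumes "a \<in> Gal \<rightarrow> K" "k \<in> K" "x \<in> carrier L"
  shows "group_op a (k \<otimes> x) = k \<otimes> group_op a x"
proof -
  have "(\<Oplus>\<tau>\<in>Gal. a \<tau> \<otimes> \<tau> (k \<otimes> x)) = (\<Oplus>\<tau>\<in>Gal. k \<otimes> (a \<tau> \<otimes> \<tau> x))"
    using assms coeff_closed[OF assms(1)] by (intro finsum_cong') (auto simp: m_lcomm)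
  also have "\<dots> = k \<otimes> (\<Oplus>\<tau>\<in>Gal. a \<tau> \<otimes> \<tau> x)"
    using assms coeff_closed[OF assms(1)] by (intro finsum_rdistr[symmetric]) auto
  finally show ?thesis using assms by (simp add: group_op_apply)
qed

lemma group_op_add:
  assumes "a \<in> Gal \<rightarrow> K" "b \<in> Gal \<rightarrow> K" "x \<in> carrier L"
  shows "group_op (\<lambda>\<tau>. a \<tau> \<oplus> b \<tau>) x = group_op a x \<oplus> group_op b x"
proof -
  have "(\<Oplus>\<tau>\<in>Gal. (a \<tau> \<oplus> b \<tau>) \<otimes> \<tau> x) = (\<Oplus>\<tau>\<in>Gal. a \<tau> \<otimes> \<tau> x \<oplus> b \<tau> \<otimes> \<tau> x)"
    using assms coeff_closed[OF assms(1)] coeff_closed[OF assms(2)] by (intro finsum_cong') (auto simp: l_distr)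
  also have "\<dots> = (\<Oplus>\<tau>\<in>Gal. a \<tau> \<otimes> \<tau> x) \<oplus> (\<Oplus>\<tau>\<in>Gal. b \<tau> \<otimes> \<tau> x)"
    using assms coeff_closed[OF assms(1)] coeff_closed[OF assms(2)] by (intro finsum_addf) auto
  finally show ?thesis using assms by (simp add: group_op_apply)
qed

lemma group_op_smult:
  assumes "a \<in> Gal \<rightarrow> K" "k \<in> K" "x \<in> carrier L"
  shows "group_op (\<lambda>\<tau>. k \<otimes> a \<tau>) x = k \<otimes> group_op a x"
proof -
  have "(\<Oplus>\<tau>\<in>Gal. (k \<otimes> a \<tau>) \<otimes> \<tau> x) = (\<Oplus>\<tau>\<in>Gal. k \<otimes> (a \<tau> \<otimes> \<tau> x))"
    using assms coeff_closed[OF assms(1)] by (intro finsum_cong') (auto simp: m_assoc)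
  also have "\<dots> = k \<otimes> (\<Oplus>\<tau>\<in>Gal. a \<tau> \<otimes> \<tau> x)"
    using assms coeff_closed[OF assms(1)] by (intro finsum_rdistr[symmetric]) auto
  finally show ?thesis using assms by (simp add: group_op_apply)
qed

lemma group_op_delta:
  assumes "\<rho> \<in> Gal" "k \<in> K" "x \<in> carrier L"
  shows "group_op (\<lambda>\<tau>. if \<tau> = \<rho> then k else \<zero>) x = k \<otimes> \<rho> x"
proof -
  have "(\<Oplus>\<tau>\<in>Gal. (if \<tau> = \<rho> then k else \<zero>) \<otimes> \<tau> x) = (\<Oplus>\<tau>\<in>Gal. if \<tau> = \<rho> then k \<otimes> \<tau> x else \<zero>)"
    using assms by (intro finsum_cong') auto
  also have "\<dots> = k \<otimes> \<rho> x" using assms by (intro add.finprod_singleton_swap) auto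
  finally show ?thesis using assms by (simp add: group_op_apply)
qed

lemma coeff_zero:
  assumes "a \<in> Gal \<rightarrow> K" "\<And>x. x \<in> carrier L \<Longrightarrow> group_op a x = \<zero>"
  shows "\<forall>\<tau>\<in>Gal. a \<tau> = \<zero>"
proof (rule dedekind_independence)
  show "a \<in> Gal \<rightarrow> carrier L" using coeff_closed[OF assms(1)] by simp
  show "(\<Oplus>\<tau>\<in>Gal. a \<tau> \<otimes> \<tau> x) = \<zero>" if "x \<in> carrier L" for x
    using assms(2)[OF that] that by (simp add: group_op_apply)
qed auto

lemma convolution_in_K:
  assumes "a \<in> Gal \<rightarrow> K" "b \<in> Gal \<rightarrow> K"
  shows "convolution a b \<in> Gal \<rightarrow> K"
proof
  fix \<rho> assume \<rho>: "\<rho> \<in> Gal"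
  have "a \<pi> \<in> K" "b \<pi> \<in> K" if "\<pi> \<in> Gal" for \<pi> using assms that by auto
  then show "convolution a b \<rho> \<in> K"
    unfolding convolution_def using \<rho> K_subring
    by (intro finsum_in_subring[OF subfieldE(1)[OF subfield]]) auto
qed

text \<open>The values of \<open>b\<close> are fixed by \<pi>, so the inner sum can be reindexed by
  the product of \<pi> and \<tau>: composition of operators is the product of K[G].\<close>

lemma group_op_convolution:
  assumes a: "a \<in> Gal \<rightarrow> K" and b: "b \<in> Gal \<rightarrow> K" and x: "x \<in> carrier L"
  shows "group_op (convolution a b) x = group_op a (group_op b x)"
proof -
  let ?G = "galois_group L K"
  note ac = coeff_closed[OF a] and bc = coeff_closed[OF b]
  have bK: "b \<tau> \<in> K" if "\<tau> \<in> Gal" for \<tau> using b that by auto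
  have "group_op a (group_op b x) = (\<Oplus>\<pi>\<in>Gal. a \<pi> \<otimes> \<pi> (group_op b x))"
    using group_op_closed[OF b x] by (simp add: group_op_apply)
  also have "\<dots> = (\<Oplus>\<pi>\<in>Gal. \<Oplus>\<rho>\<in>Gal. a \<pi> \<otimes> b (inv\<^bsub>?G\<^esub> \<pi> \<otimes>\<^bsub>?G\<^esub> \<rho>) \<otimes> \<rho> x)"
  proof (rule finsum_cong')
    fix \<pi> assume \<pi>: "\<pi> \<in> Gal"
    have "\<pi> (group_op b x) = (\<Oplus>\<tau>\<in>Gal. \<pi> (b \<tau> \<otimes> \<tau> x))"
      unfolding group_op_apply[OF x] using bc x \<pi> by (intro Gal_finsum) auto
    also have "\<dots> = (\<Oplus>\<tau>\<in>Gal. (\<lambda>\<rho>. b (inv\<^bsub>?G\<^esub> \<pi> \<otimes>\<^bsub>?G\<^esub> \<rho>) \<otimes> \<rho> x) (\<pi> \<otimes>\<^bsub>?G\<^esub> \<tau>))"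
      using bK x \<pi> by (intro finsum_cong') (auto simp: Gal.m_assoc[symmetric])
    also have "\<dots> = (\<Oplus>\<rho>\<in>Gal. b (inv\<^bsub>?G\<^esub> \<pi> \<otimes>\<^bsub>?G\<^esub> \<rho>) \<otimes> \<rho> x)"
      using bc x \<pi> by (intro finsum_Gal_mult_left) auto
    finally have "a \<pi> \<otimes> \<pi> (group_op b x) = (\<Oplus>\<rho>\<in>Gal. a \<pi> \<otimes> (b (inv\<^bsub>?G\<^esub> \<pi> \<otimes>\<^bsub>?G\<^esub> \<rho>) \<otimes> \<rho> x))"
      using ac[OF \<pi>] bc x \<pi> by (simp add: finsum_rdistr Pi_iff)
    also have "\<dots> = (\<Oplus>\<rho>\<in>Gal. a \<pi> \<otimes> b (inv\<^bsub>?G\<^esub> \<pi> \<otimes>\<^bsub>?G\<^esub> \<rho>) \<otimes> \<rho> x)"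
      using ac[OF \<pi>] bc x \<pi> by (intro finsum_cong') (auto simp: m_assoc)
    finally show "a \<pi> \<otimes> \<pi> (group_op b x) = (\<Oplus>\<rho>\<in>Gal. a \<pi> \<otimes> b (inv\<^bsub>?G\<^esub> \<pi> \<otimes>\<^bsub>?G\<^esub> \<rho>) \<otimes> \<rho> x)" .
  qed (use ac bc x in \<open>auto intro!: finsum_closed\<close>)
  also have "\<dots> = (\<Oplus>\<rho>\<in>Gal. \<Oplus>\<pi>\<in>Gal. a \<pi> \<otimes> b (inv\<^bsub>?G\<^esub> \<pi> \<otimes>\<^bsub>?G\<^esub> \<rho>) \<otimes> \<rho> x)"
    using ac bc x by (intro finsum_swap) auto
  also have "\<dots> = (\<Oplus>\<rho>\<in>Gal. convolution a b \<rho> \<otimes> \<rho> x)"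
    unfolding convolution_def
    using ac bc x by (intro finsum_cong') (auto simp: finsum_ldistr Pi_iff intro!: finsum_closed)
  finally show ?thesis using x by (simp add: group_op_apply)
qed

section \<open>Ring operations on the operators\<close>

lemma E_cases:
  assumes "f \<in> E" obtains a where "a \<in> Gal \<rightarrow> K" "f = group_op a"
  using assms by (auto simp: KG_def)

lemma E_memI: "a \<in> Gal \<rightarrow> K \<Longrightarrow> f \<in> extensional (carrier L) \<Longrightarrow>
    (\<And>x. x \<in> carrier L \<Longrightarrow> f x = group_op a x) \<Longrightarrow> f \<in> E"
proof -
  assume a: "a \<in> Gal \<rightarrow> K" and f: "f \<in> extensional (carrier L)" "\<And>x. x \<in> carrier L \<Longrightarrow> f x = group_op a x"
  have "f = group_op a" using f group_op_extensional by (intro extensionalityI) auto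
  then show "f \<in> E" using a by (auto simp: KG_def)
qed

lemma E_extensional: "f \<in> E \<Longrightarrow> f \<in> extensional (carrier L)"
  by (erule E_cases) (simp add: group_op_extensional)

lemma E_eqI: "f \<in> E \<Longrightarrow> g \<in> E \<Longrightarrow> (\<And>x. x \<in> carrier L \<Longrightarrow> f x = g x) \<Longrightarrow> f = g"
  using E_extensional by (intro extensionalityI) auto

lemma E_closed [simp]: "f \<in> E \<Longrightarrow> x \<in> carrier L \<Longrightarrow> f x \<in> carrier L"
  by (erule E_cases) (simp add: group_op_closed)

lemma E_add_arg [simp]: "f \<in> E \<Longrightarrow> x \<in> carrier L \<Longrightarrow> y \<in> carrier L \<Longrightarrow> f (x \<oplus> y) = f x \<oplus> f y"
  by (erule E_cases) (simp add: group_op_add_arg)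

lemma E_smult_arg [simp]: "f \<in> E \<Longrightarrow> k \<in> K \<Longrightarrow> x \<in> carrier L \<Longrightarrow> f (k \<otimes> x) = k \<otimes> f x"
  by (erule E_cases) (simp add: group_op_smult_arg)

lemma E_zero_arg [simp]: "f \<in> E \<Longrightarrow> f \<zero> = \<zero>"
  using E_smult_arg[of f \<zero> \<zero>] K_subring(2) by simp

lemma mult_apply [simp]: "x \<in> carrier L \<Longrightarrow> (f \<otimes>\<^bsub>KG\<^esub> g) x = f (g x)"
  and add_apply [simp]: "x \<in> carrier L \<Longrightarrow> (f \<oplus>\<^bsub>KG\<^esub> g) x = f x \<oplus> g x"
  and one_apply [simp]: "x \<in> carrier L \<Longrightarrow> \<one>\<^bsub>KG\<^esub> x = x"
  and zero_apply [simp]: "x \<in> carrier L \<Longrightarrow> \<zero>\<^bsub>KG\<^esub> x = \<zero>"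
  by (simp_all add: KG_def compose_def)

lemma E_mult: assumes "f \<in> E" "g \<in> E" shows "f \<otimes>\<^bsub>KG\<^esub> g \<in> E"
proof -
  obtain a b where ab: "a \<in> Gal \<rightarrow> K" "f = group_op a" "b \<in> Gal \<rightarrow> K" "g = group_op b"
    using assms by (metis E_cases)
  show ?thesis
    by (rule E_memI[of "convolution a b"])
      (use ab in \<open>simp_all add: convolution_in_K group_op_convolution\<close>, simp add: KG_def compose_def)
qed

lemma E_add: assumes "f \<in> E" "g \<in> E" shows "f \<oplus>\<^bsub>KG\<^esub> g \<in> E"
proof -
  obtain a b where ab: "a \<in> Gal \<rightarrow> K" "f = group_op a" "b \<in> Gal \<rightarrow> K" "g = group_op b"
    using assms by (metis E_cases)
  show ?thesis
  proof (rule E_memI[of "\<lambda>\<tau>. a \<tau> \<oplus> b \<tau>"])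
    show "(\<lambda>\<tau>. a \<tau> \<oplus> b \<tau>) \<in> Gal \<rightarrow> K" using ab K_subring by (auto simp: Pi_iff)
    show "f \<oplus>\<^bsub>KG\<^esub> g \<in> extensional (carrier L)" by (simp add: KG_def)
  qed (use ab in \<open>simp add: group_op_add\<close>)
qed

definition scalar_op :: "'a \<Rightarrow> 'a \<Rightarrow> 'a" where "scalar_op k = (\<lambda>x\<in>carrier L. k \<otimes> x)"

lemma scalar_op_apply [simp]: "x \<in> carrier L \<Longrightarrow> scalar_op k x = k \<otimes> x"
  by (simp add: scalar_op_def)

lemma scalar_op_in_E: assumes k: "k \<in> K" shows "scalar_op k \<in> E"
proof (rule E_memI[of "\<lambda>\<tau>. if \<tau> = \<one>\<^bsub>galois_group L K\<^esub> then k else \<zero>"])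
  show "(\<lambda>\<tau>. if \<tau> = \<one>\<^bsub>galois_group L K\<^esub> then k else \<zero>) \<in> Gal \<rightarrow> K" using k K_subring by auto
  show "scalar_op k \<in> extensional (carrier L)" by (simp add: scalar_op_def)
qed (use k group_op_delta[OF Gal.one_closed k] in auto)

lemma Gal_in_E: assumes \<rho>: "\<rho> \<in> Gal" shows "\<rho> \<in> E"
proof (rule E_memI[of "\<lambda>\<tau>. if \<tau> = \<rho> then \<one> else \<zero>"])
  show "(\<lambda>\<tau>. if \<tau> = \<rho> then \<one> else \<zero>) \<in> Gal \<rightarrow> K" using K_subring by auto
  show "\<rho> \<in> extensional (carrier L)" using Gal_Bij[OF \<rho>] by (simp add: Bij_def)
qed (use \<rho> group_op_delta[OF \<rho> K_subring(3)] in auto)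

lemma E_one: "\<one>\<^bsub>KG\<^esub> \<in> E"
proof -
  have "\<one>\<^bsub>KG\<^esub> = scalar_op \<one>" by (auto simp: KG_def scalar_op_def)
  then show ?thesis using scalar_op_in_E K_subring by metis
qed

lemma E_zero: "\<zero>\<^bsub>KG\<^esub> \<in> E"
proof -
  have "\<zero>\<^bsub>KG\<^esub> = scalar_op \<zero>" by (auto simp: KG_def scalar_op_def)
  then show ?thesis using scalar_op_in_E K_subring by metis
qed

section \<open>Finiteness and commutativity over a finite field\<close>

lemma finite_carrier:
  assumes "finite K" shows "finite (carrier L)"
proof -
  obtain n where "dimension n K (carrier L)" using finite_dim by auto
  then obtain vs where vs: "set vs \<subseteq> carrier L" "Span K vs = carrier L"
    using exists_base[OF subfield] by blast
  have eq: "carrier L = (\<lambda>Ks. combine Ks vs) ` {Ks. set Ks \<subseteq> K \<and> length Ks = length vs}"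
    using Span_eq_combine_set_length_version[OF subfield vs(1)] vs(2) by auto
  show ?thesis
    unfolding eq using finite_lists_length_eq[OF assms, of "length vs"] by (rule finite_imageI)
qed

text \<open>An automorphism raises a generator of the cyclic multiplicative group to some power,
  hence acts on every nonzero element as that power map, and power maps commute.\<close>

lemma Gal_commute:
  assumes "finite K" "\<pi> \<in> Gal" "\<tau> \<in> Gal" "x \<in> carrier L"
  shows "\<pi> (\<tau> x) = \<tau> (\<pi> x)"
proof (cases "x = \<zero>")
  case False
  obtain a where a: "a \<in> carrier (Multiplicative_Group.mult_of L)" "carrier (Multiplicative_Group.mult_of L) = {a [^] i | i::nat. i \<in> UNIV}"
    using finite_field_mult_group_has_gen[OF finite_carrier[OF assms(1)]] by blast
  have ac: "a \<in> carrier L" "a \<noteq> \<zero>" using a(1) by auto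
  have pow: "\<rho> (z [^] i) = (\<rho> z) [^] i" if "\<rho> \<in> Gal" "z \<in> carrier L" for \<rho> z and i :: nat
    using that by (induction i) auto
  have "\<pi> a \<in> carrier (Multiplicative_Group.mult_of L)" "\<tau> a \<in> carrier (Multiplicative_Group.mult_of L)" "x \<in> carrier (Multiplicative_Group.mult_of L)"
    using ac assms False Gal_nonzero by auto
  then have "\<exists>i::nat. \<pi> a = a [^] i" "\<exists>i::nat. \<tau> a = a [^] i" "\<exists>i::nat. x = a [^] i"
    unfolding a(2) by simp_all
  then obtain i j k :: nat where ijk: "\<pi> a = a [^] i" "\<tau> a = a [^] j" "x = a [^] k"
    by (elim exE)
  show ?thesis
    using assms ac by (simp add: ijk pow nat_pow_pow mult.commute mult.left_commute)
qed (use assms in simp)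

lemma E_commute:
  assumes K: "finite K" and f: "f \<in> E" and g: "g \<in> E" and x: "x \<in> carrier L"
  shows "f (g x) = g (f x)"
proof -
  obtain a where a: "a \<in> Gal \<rightarrow> K" "f = group_op a" using f by (rule E_cases)
  obtain b where b: "b \<in> Gal \<rightarrow> K" "g = group_op b" using g by (rule E_cases)
  have ac: "a \<tau> \<in> K" and bc: "b \<tau> \<in> K" if "\<tau> \<in> Gal" for \<tau> using a b that by auto
  have "f (g x) = (\<Oplus>\<pi>\<in>Gal. a \<pi> \<otimes> \<pi> (\<Oplus>\<tau>\<in>Gal. b \<tau> \<otimes> \<tau> x))"
    using a b x group_op_closed[OF b(1) x] by (simp add: group_op_apply)
  also have "\<dots> = (\<Oplus>\<pi>\<in>Gal. \<Oplus>\<tau>\<in>Gal. a \<pi> \<otimes> (b \<tau> \<otimes> \<pi> (\<tau> x)))"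
    using ac bc x by (intro finsum_cong') (auto simp: Gal_finsum finsum_rdistr Pi_iff intro!: finsum_closed finsum_cong')
  also have "\<dots> = (\<Oplus>\<tau>\<in>Gal. \<Oplus>\<pi>\<in>Gal. a \<pi> \<otimes> (b \<tau> \<otimes> \<pi> (\<tau> x)))"
    using ac bc x by (intro finsum_swap) auto
  also have "\<dots> = (\<Oplus>\<tau>\<in>Gal. \<Oplus>\<pi>\<in>Gal. b \<tau> \<otimes> (a \<pi> \<otimes> \<tau> (\<pi> x)))"
  proof (rule finsum_cong')
    fix \<tau> assume \<tau>: "\<tau> \<in> Gal"
    show "(\<Oplus>\<pi>\<in>Gal. a \<pi> \<otimes> (b \<tau> \<otimes> \<pi> (\<tau> x))) = (\<Oplus>\<pi>\<in>Gal. b \<tau> \<otimes> (a \<pi> \<otimes> \<tau> (\<pi> x)))"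
      using ac bc x \<tau> by (intro finsum_cong') (auto simp: Gal_commute[OF K \<tau>] m_lcomm)
  qed (use ac bc x in \<open>auto intro!: finsum_closed\<close>)
  also have "\<dots> = (\<Oplus>\<tau>\<in>Gal. b \<tau> \<otimes> \<tau> (\<Oplus>\<pi>\<in>Gal. a \<pi> \<otimes> \<pi> x))"
    using ac bc x by (intro finsum_cong') (auto simp: Gal_finsum finsum_rdistr Pi_iff intro!: finsum_closed finsum_cong')
  also have "\<dots> = g (f x)"
    using a b x group_op_closed[OF a(1) x] by (simp add: group_op_apply)
  finally show ?thesis .
qed

lemma finite_E:
  assumes "finite K" shows "finite E"
proof -
  \<comment> \<open>Coefficients matter only on the group, so extensional ones represent every
    operator, and there are finitely many of these.\<close>
  have "E \<subseteq> group_op ` (Gal \<rightarrow>\<^sub>E K)"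
  proof
    fix f assume "f \<in> E"
    then obtain a where a: "a \<in> Gal \<rightarrow> K" "f = group_op a" by (rule E_cases)
    then have "f = group_op (restrict a Gal)" using group_op_cong[OF a(1), of "restrict a Gal"] by simp
    moreover have "restrict a Gal \<in> Gal \<rightarrow>\<^sub>E K" using a(1) by auto
    ultimately show "f \<in> group_op ` (Gal \<rightarrow>\<^sub>E K)" by blast
  qed
  moreover have "finite (Gal \<rightarrow>\<^sub>E K)" using assms by (intro finite_PiE) auto
  ultimately show ?thesis by (meson finite_imageI finite_subset)
qed

text \<open>Finiteness of K enters through commutativity of the product; the other laws are
  pointwise.\<close>

lemma cring_KG:
  assumes K: "finite K" shows "cring KG"
proof (rule cringI)
  show "abelian_group KG"
  proof (rule abelian_groupI)
    fix f assume f: "f \<in> E"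
    let ?g = "scalar_op (\<ominus> \<one>) \<otimes>\<^bsub>KG\<^esub> f"
    have s: "scalar_op (\<ominus> \<one>) \<in> E" using scalar_op_in_E K_subring by simp
    have "?g \<oplus>\<^bsub>KG\<^esub> f = \<zero>\<^bsub>KG\<^esub>"
      using f s by (intro E_eqI E_add E_mult E_zero) (auto simp: l_minus l_neg)
    then show "\<exists>g\<in>E. g \<oplus>\<^bsub>KG\<^esub> f = \<zero>\<^bsub>KG\<^esub>" using E_mult f s by blast
  next
    fix f g assume fg: "f \<in> E" "g \<in> E"
    then show "f \<oplus>\<^bsub>KG\<^esub> g = g \<oplus>\<^bsub>KG\<^esub> f"
      by (intro E_eqI E_add) (auto simp: a_comm)
    fix h assume "h \<in> E"
    then show "f \<oplus>\<^bsub>KG\<^esub> g \<oplus>\<^bsub>KG\<^esub> h = f \<oplus>\<^bsub>KG\<^esub> (g \<oplus>\<^bsub>KG\<^esub> h)"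
      using fg by (intro E_eqI E_add) (auto simp: a_assoc)
  next
    fix f assume "f \<in> E"
    then show "\<zero>\<^bsub>KG\<^esub> \<oplus>\<^bsub>KG\<^esub> f = f" by (intro E_eqI E_add E_zero) auto
  qed (auto intro: E_add E_zero)
  show "comm_monoid KG"
  proof (rule comm_monoidI)
    fix f g assume fg: "f \<in> E" "g \<in> E"
    then show "f \<otimes>\<^bsub>KG\<^esub> g = g \<otimes>\<^bsub>KG\<^esub> f"
      using E_commute[OF K] by (intro E_eqI E_mult) auto
    fix h assume "h \<in> E"
    then show "f \<otimes>\<^bsub>KG\<^esub> g \<otimes>\<^bsub>KG\<^esub> h = f \<otimes>\<^bsub>KG\<^esub> (g \<otimes>\<^bsub>KG\<^esub> h)"
      using fg by (intro E_eqI E_mult) auto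
  next
    fix f assume "f \<in> E"
    then show "\<one>\<^bsub>KG\<^esub> \<otimes>\<^bsub>KG\<^esub> f = f" by (intro E_eqI E_mult E_one) auto
  qed (auto intro: E_mult E_one)
  fix f g h assume "f \<in> E" "g \<in> E" "h \<in> E"
  then show "(f \<oplus>\<^bsub>KG\<^esub> g) \<otimes>\<^bsub>KG\<^esub> h =
      f \<otimes>\<^bsub>KG\<^esub> h \<oplus>\<^bsub>KG\<^esub> g \<otimes>\<^bsub>KG\<^esub> h"
    by (intro E_eqI E_mult E_add) auto
qed

text \<open>The coefficient at the identity is a linear form on \<open>K[G]\<close> whose kernel contains no nonzero
  ideal, so linear forms on \<open>K[G]\<close> are given by multiplications; hence the double annihilator
  property.\<close>

lemma KG_double_annihilator:
  assumes K: "finite K" and s: "s \<in> E" and s': "s' \<in> E"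
    and ann: "\<And>b. b \<in> E \<Longrightarrow> s \<otimes>\<^bsub>KG\<^esub> b = \<zero>\<^bsub>KG\<^esub> \<Longrightarrow> s' \<otimes>\<^bsub>KG\<^esub> b = \<zero>\<^bsub>KG\<^esub>"
  shows "\<exists>c\<in>E. s' = s \<otimes>\<^bsub>KG\<^esub> c"
proof (rule ccontr)
  assume no: "\<not> ?thesis"
  let ?G = "galois_group L K"
  obtain w0 where w0: "w0 \<in> Gal \<rightarrow> K" "s = group_op w0" using s by (rule E_cases)
  obtain v where v: "v \<in> Gal \<rightarrow> K" "s' = group_op v" using s' by (rule E_cases)
  \<comment> \<open>Coefficient functions of the ideal generated by \<open>s\<close>; as
    \<open>s'\<close> lies outside, some functional kills them but not \<open>v\<close>.\<close>
  define W where "W = {w \<in> Gal \<rightarrow> K. \<exists>c\<in>E. group_op w = s \<otimes>\<^bsub>KG\<^esub> c}"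
  have WI: "w \<in> W" if "w \<in> Gal \<rightarrow> K" "c \<in> E" "\<And>x. x \<in> carrier L \<Longrightarrow> group_op w x = s (c x)" for w c
  proof -
    have "group_op w \<in> E" using that(1) group_op_extensional by (intro E_memI) auto
    then have "group_op w = s \<otimes>\<^bsub>KG\<^esub> c"
      using that s by (intro E_eqI E_mult) auto
    then show ?thesis unfolding W_def using that by blast
  qed
  have WD: "\<exists>c\<in>E. \<forall>x\<in>carrier L. group_op w x = s (c x)" if w: "w \<in> W" for w
  proof -
    obtain c where "c \<in> E" "group_op w = s \<otimes>\<^bsub>KG\<^esub> c" using w unfolding W_def by blast
    then show ?thesis by (intro bexI[of _ c]) simp_all
  qed
  have WK: "w \<in> Gal \<rightarrow> K" if "w \<in> W" for w using that unfolding W_def by blast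
  have "\<exists>b\<in>Gal \<rightarrow> K. (\<forall>w\<in>W. (\<Oplus>\<tau>\<in>Gal. b \<tau> \<otimes> w \<tau>) = \<zero>) \<and> (\<Oplus>\<tau>\<in>Gal. b \<tau> \<otimes> v \<tau>) \<noteq> \<zero>"
  proof (rule separating_functional[OF subfield finite_Gal])
    have "w0 \<in> W" using w0 E_one by (intro WI[of w0 "\<one>\<^bsub>KG\<^esub>"]) auto
    then show "W \<noteq> {}" by blast
    show "w \<in> Gal \<rightarrow> K" if "w \<in> W" for w using that by (rule WK)
    show "(\<lambda>i. w i \<oplus> w' i) \<in> W" if w: "w \<in> W" "w' \<in> W" for w w'
    proof -
      obtain c c' where c: "c \<in> E" "\<forall>x\<in>carrier L. group_op w x = s (c x)"
        and c': "c' \<in> E" "\<forall>x\<in>carrier L. group_op w' x = s (c' x)"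
        using WD[OF w(1)] WD[OF w(2)] by blast
      show ?thesis
      proof (rule WI[of _ "c \<oplus>\<^bsub>KG\<^esub> c'"])
        show "(\<lambda>i. w i \<oplus> w' i) \<in> Gal \<rightarrow> K" using WK[OF w(1)] WK[OF w(2)] K_subring by (auto simp: Pi_iff)
        show "c \<oplus>\<^bsub>KG\<^esub> c' \<in> E" using c c' by (intro E_add)
      qed (use c c' s WK w in \<open>simp add: group_op_add\<close>)
    qed
    show "(\<lambda>i. k \<otimes> w i) \<in> W" if k: "k \<in> K" and w: "w \<in> W" for k w
    proof -
      obtain c where c: "c \<in> E" "\<forall>x\<in>carrier L. group_op w x = s (c x)" using WD[OF w] by blast
      show ?thesis
      proof (rule WI[of _ "scalar_op k \<otimes>\<^bsub>KG\<^esub> c"])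
        show "(\<lambda>i. k \<otimes> w i) \<in> Gal \<rightarrow> K" using WK[OF w] k K_subring by (auto simp: Pi_iff)
        show "scalar_op k \<otimes>\<^bsub>KG\<^esub> c \<in> E" using c k by (intro E_mult scalar_op_in_E)
      qed (use c k s WK w in \<open>simp add: group_op_smult\<close>)
    qed
    show "v \<in> Gal \<rightarrow> K" by (rule v)
    show "\<exists>i\<in>Gal. v i \<noteq> w i" if w: "w \<in> W" for w
    proof (rule ccontr)
      assume "\<not> ?thesis"
      then have "group_op v = group_op w" using WK[OF w] by (intro group_op_cong) auto
      then show False using no w v(2) unfolding W_def by auto
    qed
  qed
  then obtain b where b: "b \<in> Gal \<rightarrow> K" "\<And>w. w \<in> W \<Longrightarrow> (\<Oplus>\<tau>\<in>Gal. b \<tau> \<otimes> w \<tau>) = \<zero>"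
    and bv: "(\<Oplus>\<tau>\<in>Gal. b \<tau> \<otimes> v \<tau>) \<noteq> \<zero>" by blast
  \<comment> \<open>The inversion turns the pairing with \<open>b\<close> into the coefficient at
    the identity of a product in K[G].\<close>
  define b' where "b' = (\<lambda>\<tau>. b (inv\<^bsub>?G\<^esub> \<tau>))"
  have b': "b' \<in> Gal \<rightarrow> K" using b(1) by (auto simp: b'_def Pi_iff)
  have b'E: "group_op b' \<in> E" using b' group_op_extensional by (intro E_memI) auto
  \<comment> \<open>Each coefficient of the product is the pairing of \<open>b\<close> with a
    translate of \<open>w0\<close>, and the translate belongs to a multiple of
    \<open>s\<close>.\<close>
  have conv0: "convolution w0 b' \<rho> = \<zero>" if \<rho>: "\<rho> \<in> Gal" for \<rho>
  proof -
    let ?w = "\<lambda>\<pi>. w0 (\<rho> \<otimes>\<^bsub>?G\<^esub> \<pi>)"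
    have wK: "?w \<in> Gal \<rightarrow> K" using w0(1) \<rho> by (auto simp: Pi_iff)
    have "?w \<in> W"
    proof (rule WI[OF wK])
      show "inv\<^bsub>?G\<^esub> \<rho> \<in> E" using \<rho> by (intro Gal_in_E) simp
      fix x assume x: "x \<in> carrier L"
      let ?r = "inv\<^bsub>?G\<^esub> \<rho>"
      have r: "?r \<in> Gal" using \<rho> by simp
      have "group_op ?w x = (\<Oplus>\<pi>\<in>Gal. (\<lambda>\<pi>. w0 \<pi> \<otimes> ?r (\<pi> x)) (\<rho> \<otimes>\<^bsub>?G\<^esub> \<pi>))"
        unfolding group_op_apply[OF x] using coeff_closed[OF w0(1)] \<rho> x by (intro finsum_cong') auto
      also have "\<dots> = (\<Oplus>\<pi>\<in>Gal. w0 \<pi> \<otimes> ?r (\<pi> x))"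
        using coeff_closed[OF w0(1)] \<rho> x by (intro finsum_Gal_mult_left) auto
      also have "\<dots> = group_op w0 (?r x)"
        using coeff_closed[OF w0(1)] \<rho> r x Gal_commute[OF K r]
        by (subst group_op_apply) (auto intro!: finsum_cong')
      finally show "group_op ?w x = s (?r x)" using w0(2) by simp
    qed
    have "convolution w0 b' \<rho> = (\<Oplus>\<pi>\<in>Gal. (\<lambda>\<pi>. w0 \<pi> \<otimes> b' (inv\<^bsub>?G\<^esub> \<pi> \<otimes>\<^bsub>?G\<^esub> \<rho>)) (\<rho> \<otimes>\<^bsub>?G\<^esub> \<pi>))"
      unfolding convolution_def
      using coeff_closed[OF w0(1)] coeff_closed[OF b'] \<rho> by (intro finsum_Gal_mult_left[symmetric]) auto
    also have "\<dots> = (\<Oplus>\<pi>\<in>Gal. b \<pi> \<otimes> ?w \<pi>)"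
    proof (rule finsum_cong')
      fix \<pi> assume \<pi>: "\<pi> \<in> Gal"
      have "inv\<^bsub>?G\<^esub> (\<rho> \<otimes>\<^bsub>?G\<^esub> \<pi>) \<otimes>\<^bsub>?G\<^esub> \<rho> = inv\<^bsub>?G\<^esub> \<pi>"
        using \<pi> \<rho> by (simp add: Gal.inv_mult_group Gal.m_assoc)
      then show "(\<lambda>\<pi>. w0 \<pi> \<otimes> b' (inv\<^bsub>?G\<^esub> \<pi> \<otimes>\<^bsub>?G\<^esub> \<rho>)) (\<rho> \<otimes>\<^bsub>?G\<^esub> \<pi>) = b \<pi> \<otimes> ?w \<pi>"
        using \<pi> \<rho> coeff_closed[OF w0(1)] coeff_closed[OF b(1)] by (simp add: b'_def m_comm)
    qed (use \<rho> coeff_closed[OF w0(1)] coeff_closed[OF b(1)] in auto)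
    also have "\<dots> = \<zero>" using b(2)[OF \<open>?w \<in> W\<close>] .
    finally show ?thesis .
  qed
  have "s \<otimes>\<^bsub>KG\<^esub> group_op b' = \<zero>\<^bsub>KG\<^esub>"
  proof (rule E_eqI)
    fix x assume x: "x \<in> carrier L"
    have "group_op (convolution w0 b') x = \<zero>"
      unfolding group_op_apply[OF x] using conv0 x by (intro add.finprod_one_eqI) auto
    then show "(s \<otimes>\<^bsub>KG\<^esub> group_op b') x = \<zero>\<^bsub>KG\<^esub> x"
      using x w0 b' by (simp add: group_op_convolution)
  qed (use s b'E in \<open>auto intro: E_mult E_zero\<close>)
  then have z: "s' \<otimes>\<^bsub>KG\<^esub> group_op b' = \<zero>\<^bsub>KG\<^esub>" using ann b'E by blast
  have "\<forall>\<tau>\<in>Gal. convolution v b' \<tau> = \<zero>"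
  proof (rule coeff_zero)
    fix x assume x: "x \<in> carrier L"
    have "group_op (convolution v b') x = (s' \<otimes>\<^bsub>KG\<^esub> group_op b') x"
      using x v b' by (simp add: group_op_convolution)
    then show "group_op (convolution v b') x = \<zero>" using x z by simp
  qed (use convolution_in_K v b' in auto)
  then have "convolution v b' \<one>\<^bsub>?G\<^esub> = \<zero>" by blast
  moreover have "convolution v b' \<one>\<^bsub>?G\<^esub> = (\<Oplus>\<tau>\<in>Gal. b \<tau> \<otimes> v \<tau>)"
    unfolding convolution_def using coeff_closed[OF v(1)] coeff_closed[OF b(1)]
    by (intro finsum_cong') (auto simp: b'_def m_comm)
  ultimately show False using bv by simp
qed

text \<open>L is a faithful module over the finite commutative ring \<open>KG\<close>, which acts by
  application; an element with zero annihilator is one with independent conjugates.\<close>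

lemma exists_conj_independent_finite:
  assumes K: "finite K" shows "\<exists>x. conj_independent x"
proof -
  define M :: "('a \<Rightarrow> 'a, 'a) module" where
    "M = \<lparr>carrier = carrier L, monoid.mult = (\<otimes>), one = \<one>, ring.zero = \<zero>, add = (\<oplus>),
      smult = (\<lambda>f x. f x)\<rparr>"
  have M: "carrier M = carrier L" "add M = (\<oplus>)" "\<zero>\<^bsub>M\<^esub> = \<zero>" "smult M = (\<lambda>f x. f x)"
    by (simp_all add: M_def)
  have "abelian_group M"
    by (rule abelian_groupI) (auto simp: M a_ac intro: bexI[of _ "\<ominus> _"] l_neg)
  then have "module KG M"
    by (intro moduleI cring_KG K) (auto simp: M E_add)
  then have "\<exists>x\<in>carrier M. \<forall>a\<in>E. a \<odot>\<^bsub>M\<^esub> x = \<zero>\<^bsub>M\<^esub> \<longrightarrow> a = \<zero>\<^bsub>KG\<^esub>"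
  proof (rule module.exists_free_element[OF _ finite_E[OF K]])
    show "a = \<zero>\<^bsub>KG\<^esub>" if "a \<in> E" "\<And>x. x \<in> carrier M \<Longrightarrow> a \<odot>\<^bsub>M\<^esub> x = \<zero>\<^bsub>M\<^esub>" for a
      using that by (intro E_eqI E_zero) (auto simp: M)
  qed (rule KG_double_annihilator[OF K])
  then obtain x where x: "x \<in> carrier L" and free: "\<And>a. a \<in> E \<Longrightarrow> a x = \<zero> \<Longrightarrow> a = \<zero>\<^bsub>KG\<^esub>"
    by (auto simp: M)
  have "conj_independent x"
  proof (rule conj_independentI[OF x])
    fix c assume c: "c \<in> Gal \<rightarrow> K" "(\<Oplus>\<tau>\<in>Gal. c \<tau> \<otimes> \<tau> x) = \<zero>"
    have "group_op c \<in> E" using c(1) group_op_extensional by (intro E_memI) auto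
    then have "group_op c = \<zero>\<^bsub>KG\<^esub>" using c x free by (simp add: group_op_apply)
    then show "\<forall>\<tau>\<in>Gal. c \<tau> = \<zero>" using c(1) by (intro coeff_zero) auto
  qed
  then show ?thesis by blast
qed

text \<open>Evaluation at a normal basis element is injective on \<open>KG\<close>; this is one half
  of identifying L with the group algebra.\<close>

lemma E_conj_independent:
  assumes x: "conj_independent x" and f: "f \<in> E" "f x = \<zero>"
  shows "f = \<zero>\<^bsub>KG\<^esub>"
proof -
  have xc: "x \<in> carrier L" using x by (rule conj_independent_closed)
  obtain a where a: "a \<in> Gal \<rightarrow> K" "f = group_op a" using f(1) by (rule E_cases)
  then have "(\<Oplus>\<tau>\<in>Gal. a \<tau> \<otimes> \<tau> x) = \<zero>" using f(2) xc by (simp add: group_op_apply)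
  from conj_independentD[OF x a(1) this] have "\<And>\<tau>. \<tau> \<in> Gal \<Longrightarrow> a \<tau> = \<zero>" .
  then have "f y = \<zero>" if "y \<in> carrier L" for y
    unfolding a(2) group_op_apply[OF that] using that by (intro add.finprod_one_eqI) auto
  then show ?thesis using f(1) by (intro E_eqI E_zero) auto
qed

lemma trace_finsum:
  assumes "finite A" "f \<in> A \<rightarrow> carrier L"
  shows "trace (\<Oplus>i\<in>A. f i) = (\<Oplus>i\<in>A. trace (f i))"
proof -
  have "trace (\<Oplus>i\<in>A. f i) = (\<Oplus>\<pi>\<in>Gal. \<Oplus>i\<in>A. \<pi> (f i))"
    unfolding trace_def using assms by (intro finsum_cong') (auto simp: Gal_finsum Pi_iff intro!: finsum_closed)
  also have "\<dots> = (\<Oplus>i\<in>A. \<Oplus>\<pi>\<in>Gal. \<pi> (f i))" using assms by (intro finsum_swap) (auto simp: Pi_iff)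
  finally show ?thesis unfolding trace_def .
qed

lemma proportional_conjugate_finite:
  assumes K: "finite K" and \<gamma>: "\<gamma> \<in> carrier L" "\<gamma> \<noteq> \<zero>"
    and nz: "\<And>x. conj_independent x \<Longrightarrow> trace (\<gamma> \<otimes> x) \<noteq> \<zero>" and \<tau>: "\<tau> \<in> Gal"
  shows "\<exists>k\<in>K. \<tau> \<gamma> = k \<otimes> \<gamma>"
proof -
  interpret A: cring KG by (rule cring_KG[OF K])
  obtain x where x: "conj_independent x" using exists_conj_independent_finite[OF K] by blast
  have xc: "x \<in> carrier L" using x by (rule conj_independent_closed)
  \<comment> \<open>The form Tr(\<gamma> .) pulled back to \<open>KG\<close> along evaluation at
    \<open>x\<close>.\<close>
  define f where "f = (\<lambda>a. trace (\<gamma> \<otimes> a x))"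
  have fK: "f a \<in> K" if "a \<in> E" for a using that xc \<gamma> by (simp add: f_def)
  have fadd: "f (a \<oplus>\<^bsub>KG\<^esub> b) = f a \<oplus> f b" if "a \<in> E" "b \<in> E" for a b
    using that xc \<gamma> by (simp add: f_def r_distr trace_add)
  have fsm: "f (scalar_op k \<otimes>\<^bsub>KG\<^esub> a) = k \<otimes> f a" if "k \<in> K" "a \<in> E" for k a
  proof -
    have "\<gamma> \<otimes> (k \<otimes> a x) = k \<otimes> (\<gamma> \<otimes> a x)" using that xc \<gamma> by (simp add: m_lcomm)
    then show ?thesis using that xc \<gamma> by (simp add: f_def trace_smult)
  qed
  define W where "W = {a \<in> E. f a = \<zero>}"
  have "subgroup W (add_monoid KG)"
  proof (rule A.add.subgroupI)
    have "f \<zero>\<^bsub>KG\<^esub> = \<zero> \<otimes> f \<zero>\<^bsub>KG\<^esub>"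
      using fsm[OF K_subring(2) E_zero] A.zero_closed by (simp add: f_def xc \<gamma> scalar_op_def)
    then show "W \<noteq> {}" using fK[OF E_zero] E_zero by (auto simp: W_def)
    show "\<ominus>\<^bsub>KG\<^esub> a \<in> W" if a: "a \<in> W" for a
    proof -
      have aE: "a \<in> E" "f a = \<zero>" using a by (auto simp: W_def)
      have "f (a \<oplus>\<^bsub>KG\<^esub> \<ominus>\<^bsub>KG\<^esub> a) = f \<zero>\<^bsub>KG\<^esub>" using aE by (simp add: A.r_neg)
      moreover have "f \<zero>\<^bsub>KG\<^esub> = \<zero>"
        using fadd[OF E_zero E_zero] fK[OF E_zero] by simp
      ultimately show ?thesis using fadd[OF aE(1), of "\<ominus>\<^bsub>KG\<^esub> a"] aE fK[of "\<ominus>\<^bsub>KG\<^esub> a"]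
        by (simp add: W_def)
    qed
  qed (auto simp: W_def fadd E_add)
  then have W: "additive_subgroup W KG" by (rule additive_subgroup.intro)
  have regGal: "A.regular \<rho>" if \<rho>: "\<rho> \<in> Gal" for \<rho>
  proof (rule A.regularI[OF Gal_in_E[OF \<rho>]])
    fix b assume b: "b \<in> E" "b \<otimes>\<^bsub>KG\<^esub> \<rho> = \<zero>\<^bsub>KG\<^esub>"
    show "b = \<zero>\<^bsub>KG\<^esub>"
    proof (rule E_eqI[OF b(1) E_zero])
      fix y assume y: "y \<in> carrier L"
      let ?z = "(inv\<^bsub>galois_group L K\<^esub> \<rho>) y"
      have z: "?z \<in> carrier L" using \<rho> y by simp
      have "b y = (b \<otimes>\<^bsub>KG\<^esub> \<rho>) ?z" using \<rho> y z by simp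
      then show "b y = \<zero>\<^bsub>KG\<^esub> y" unfolding b(2) using y z by simp
    qed
  qed
  have regscalar: "A.regular (scalar_op k)" if k: "k \<in> K" "k \<noteq> \<zero>" for k
  proof (rule A.regularI[OF scalar_op_in_E[OF k(1)]])
    fix b assume b: "b \<in> E" "b \<otimes>\<^bsub>KG\<^esub> scalar_op k = \<zero>\<^bsub>KG\<^esub>"
    show "b = \<zero>\<^bsub>KG\<^esub>"
    proof (rule E_eqI[OF b(1) E_zero])
      fix y assume y: "y \<in> carrier L"
      have "k \<otimes> b y = (b \<otimes>\<^bsub>KG\<^esub> scalar_op k) y" using b(1) k y by simp
      then have "k \<otimes> b y = \<zero>" unfolding b(2) using y by simp
      then show "b y = \<zero>\<^bsub>KG\<^esub> y" using k y b(1) by (simp add: integral_iff)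
    qed
  qed
  \<comment> \<open>Group elements, which span \<open>KG\<close>, serve as the regular multipliers
    \<open>H\<close>, and nonzero scalars as the factors \<kappa>.\<close>
  have ideal: "a \<otimes>\<^bsub>KG\<^esub> b \<in> W" if a: "a \<in> W" and b: "b \<in> E" for a b
  proof (rule A.ideal_if_avoids_regular[OF finite_E[OF K] W _ regGal _ _ a b])
    fix u assume u: "u \<in> W"
    show "\<not> A.regular u"
    proof
      assume reg: "A.regular u"
      have uE: "u \<in> E" "f u = \<zero>" using u by (auto simp: W_def)
      \<comment> \<open>A regular operator takes one normal basis element to another, where the form
        cannot vanish.\<close>
      have "conj_independent (u x)"
      proof (rule conj_independentI)
        fix c assume c: "c \<in> Gal \<rightarrow> K" "(\<Oplus>\<tau>\<in>Gal. c \<tau> \<otimes> \<tau> (u x)) = \<zero>"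
        have cE: "group_op c \<in> E" using c(1) group_op_extensional by (intro E_memI) auto
        have "(group_op c \<otimes>\<^bsub>KG\<^esub> u) x = \<zero>"
          using c(2) uE xc by (simp add: group_op_apply)
        then have "group_op c \<otimes>\<^bsub>KG\<^esub> u = \<zero>\<^bsub>KG\<^esub>"
          using E_conj_independent[OF x] E_mult[OF cE uE(1)] by blast
        then have "group_op c = \<zero>\<^bsub>KG\<^esub>" using A.regularD[OF reg cE] by blast
        then show "\<forall>\<tau>\<in>Gal. c \<tau> = \<zero>" using c(1) by (intro coeff_zero) auto
      qed (use uE xc in simp)
      then show False using nz uE by (auto simp: f_def)
    qed
  next
    fix a b assume a: "a \<in> E" and b: "b \<in> E"
      and au: "\<And>u. u \<in> Gal \<Longrightarrow> a \<otimes>\<^bsub>KG\<^esub> u \<in> W"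
    obtain c where c: "c \<in> Gal \<rightarrow> K" "b = group_op c" using b by (rule E_cases)
    have cK: "c \<rho> \<in> K" if "\<rho> \<in> Gal" for \<rho> using c that by auto
    have ax: "a x \<in> carrier L" using a xc by simp
    have t0: "trace (\<gamma> \<otimes> \<rho> (a x)) = \<zero>" if \<rho>: "\<rho> \<in> Gal" for \<rho>
      using au[OF \<rho>] xc E_commute[OF K a Gal_in_E[OF \<rho>] xc] by (simp add: W_def f_def)
    have "f (a \<otimes>\<^bsub>KG\<^esub> b) = trace (\<gamma> \<otimes> b (a x))"
      using xc E_commute[OF K a b xc] by (simp add: f_def)
    also have "\<gamma> \<otimes> b (a x) = (\<Oplus>\<rho>\<in>Gal. c \<rho> \<otimes> (\<gamma> \<otimes> \<rho> (a x)))"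
    proof -
      have "\<gamma> \<otimes> b (a x) = (\<Oplus>\<rho>\<in>Gal. \<gamma> \<otimes> (c \<rho> \<otimes> \<rho> (a x)))"
        unfolding c(2) group_op_apply[OF ax] using cK ax \<gamma> by (intro finsum_rdistr) auto
      also have "\<dots> = (\<Oplus>\<rho>\<in>Gal. c \<rho> \<otimes> (\<gamma> \<otimes> \<rho> (a x)))"
        using cK ax \<gamma> by (intro finsum_cong') (auto simp: m_lcomm)
      finally show ?thesis .
    qed
    also have "trace \<dots> = (\<Oplus>\<rho>\<in>Gal. trace (c \<rho> \<otimes> (\<gamma> \<otimes> \<rho> (a x))))"
      using cK ax \<gamma> by (intro trace_finsum) auto
    also have "\<dots> = \<zero>"
      using cK ax \<gamma> t0 by (intro add.finprod_one_eqI) (auto simp: trace_smult)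
    finally show "a \<otimes>\<^bsub>KG\<^esub> b \<in> W" using a b by (simp add: W_def E_mult)
  next
    fix a b assume "a \<in> E - W" "b \<in> E - W"
    then have a: "a \<in> E" "f a \<noteq> \<zero>" and b: "b \<in> E" "f b \<noteq> \<zero>" by (auto simp: W_def)
    have fb: "f b \<in> K - {\<zero>}" and fa: "f a \<in> K" using a b fK by auto
    have ib: "inv (f b) \<in> K - {\<zero>}" "inv (f b) \<otimes> f b = \<one>" using subfield_m_inv[OF subfield fb] by auto
    \<comment> \<open>The scalar that moves \<open>a\<close> along \<open>b\<close> into the
      hyperplane; it is nonzero because \<open>f a\<close> is.\<close>
    define k where "k = \<ominus> (f a \<otimes> inv (f b))"
    have k: "k \<in> K" using fa ib K_subring by (simp add: k_def)
    have kb: "k \<otimes> f b = \<ominus> f a"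
      using fa fb ib by (simp add: k_def l_minus m_assoc)
    then have "k \<noteq> \<zero>" using a fa fb by (metis DiffD1 K_closed l_null minus_minus minus_zero)
    moreover have "a \<oplus>\<^bsub>KG\<^esub> scalar_op k \<otimes>\<^bsub>KG\<^esub> b \<in> W"
      using a b k fa by (simp add: W_def fadd fsm kb r_neg E_add E_mult scalar_op_in_E)
    ultimately show "\<exists>\<kappa>. A.regular \<kappa> \<and> a \<oplus>\<^bsub>KG\<^esub> \<kappa> \<otimes>\<^bsub>KG\<^esub> b \<in> W"
      using regscalar[OF k] by blast
  qed
  let ?\<rho> = "inv\<^bsub>galois_group L K\<^esub> \<tau>"
  have \<rho>: "?\<rho> \<in> Gal" using \<tau> by simp
  have f1: "f \<one>\<^bsub>KG\<^esub> \<in> K - {\<zero>}" using nz[OF x] xc fK[OF E_one] by (simp add: f_def)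
  have i1: "inv (f \<one>\<^bsub>KG\<^esub>) \<in> K" "inv (f \<one>\<^bsub>KG\<^esub>) \<otimes> f \<one>\<^bsub>KG\<^esub> = \<one>"
    using subfield_m_inv[OF subfield f1] by auto
  \<comment> \<open>The scalar that corrects the inverse of \<tau> into the kernel; it exists
    because f takes the nonzero value Tr(\<gamma> x) at the identity.\<close>
  define k where "k = \<ominus> (f ?\<rho> \<otimes> inv (f \<one>\<^bsub>KG\<^esub>))"
  have f\<rho>: "f ?\<rho> \<in> K" using fK Gal_in_E[OF \<rho>] by blast
  have k: "k \<in> K" using f\<rho> i1 K_subring by (simp add: k_def)
  let ?a = "?\<rho> \<oplus>\<^bsub>KG\<^esub> scalar_op k \<otimes>\<^bsub>KG\<^esub> \<one>\<^bsub>KG\<^esub>"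
  have k1: "k \<otimes> f \<one>\<^bsub>KG\<^esub> = \<ominus> f ?\<rho>"
    using f\<rho> f1 i1 by (simp add: k_def l_minus m_assoc)
  have aW: "?a \<in> W"
    using k f\<rho> Gal_in_E[OF \<rho>] E_one
    by (simp only: W_def mem_Collect_eq fadd fsm k1 r_neg E_add E_mult scalar_op_in_E K_closed simp_thms)
  show ?thesis
  proof (rule proportional_if_trace_kernel_subset[OF \<gamma>])
    fix y assume y: "y \<in> carrier L" "trace (\<gamma> \<otimes> y) = \<zero>"
    obtain c where c: "c \<in> Gal \<rightarrow> K" "y = (\<Oplus>\<tau>\<in>Gal. c \<tau> \<otimes> \<tau> x)"
      using conj_independent_spans[OF x y(1)] by blast
    have bE: "group_op c \<in> E" using c(1) group_op_extensional by (intro E_memI) auto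
    have bx: "group_op c x = y" using c xc by (simp add: group_op_apply)
    \<comment> \<open>Evaluated at \<open>x\<close> this reads Tr(\<gamma> (\<rho>(y) + k y)) = 0,
      and the second term drops out for \<open>y\<close> in the kernel.\<close>
    have "f (?a \<otimes>\<^bsub>KG\<^esub> group_op c) = \<zero>" using ideal[OF aW bE] by (simp add: W_def)
    then have "trace (\<gamma> \<otimes> (?\<rho> y \<oplus> k \<otimes> y)) = \<zero>" using xc y by (simp add: f_def bx)
    moreover have "\<gamma> \<otimes> (?\<rho> y \<oplus> k \<otimes> y) = \<gamma> \<otimes> ?\<rho> y \<oplus> k \<otimes> (\<gamma> \<otimes> y)"
      using \<gamma> \<rho> y(1) k by (simp add: r_distr m_lcomm)
    moreover have "trace (\<gamma> \<otimes> ?\<rho> y \<oplus> k \<otimes> (\<gamma> \<otimes> y)) = trace (\<gamma> \<otimes> ?\<rho> y) \<oplus> k \<otimes> trace (\<gamma> \<otimes> y)"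
      using \<gamma>(1) \<rho> y(1) k by (simp add: trace_add trace_smult)
    ultimately have "trace (\<gamma> \<otimes> ?\<rho> y) = \<zero>" using y(2) k \<gamma>(1) \<rho> y(1) by simp
    then show "trace (\<tau> \<gamma> \<otimes> y) = \<zero>" using trace_mult_Gal[OF \<tau> \<gamma>(1) y(1)] by simp
  qed (use \<gamma> \<tau> in simp)
qed

end

section \<open>The Kummer group\<close>

context finite_galois_extension
begin

abbreviation "Lx \<equiv> Multiplicative_Group.mult_of L"
abbreviation "Kx \<equiv> Multiplicative_Group.mult_of (L\<lparr>carrier := K\<rparr>)"

sublocale Lx: group Lx by (rule field_mult_group)

lemma comm_group_Kx: "comm_group Kx"
proof -
  interpret F: field "L\<lparr>carrier := K\<rparr>" using subfield_iff(2)[OF subfield] .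
  interpret group Kx by (rule F.field_mult_group)
  show ?thesis
    by (rule group_comm_groupI) (auto simp: m_comm)
qed

sublocale Kx: comm_group Kx by (rule comm_group_Kx)

lemma trace_nonzero: assumes x: "conj_independent x" shows "trace x \<noteq> \<zero>"
proof
  have xc: "x \<in> carrier L" using x by (rule conj_independent_closed)
  assume "trace x = \<zero>"
  moreover have "trace x = (\<Oplus>\<tau>\<in>Gal. \<one> \<otimes> \<tau> x)"
    unfolding trace_def using xc by (intro finsum_cong') auto
  ultimately have "(\<Oplus>\<tau>\<in>Gal. \<one> \<otimes> \<tau> x) = \<zero>" by simp
  moreover have "(\<lambda>_. \<one>) \<in> Gal \<rightarrow> K" using K_subring by simp
  ultimately have "\<one> = \<zero>" using conj_independentD[OF x _ _ Gal.one_closed, of "\<lambda>_. \<one>"] by simp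
  then show False by simp
qed

text \<open>The coboundary of \<gamma> in the sense of group cohomology; on \<open>kummer\<close> it
  is a character of G with values in K.\<close>

definition ratio :: "'a \<Rightarrow> ('a \<Rightarrow> 'a) \<Rightarrow> 'a" where
  "ratio \<gamma> \<tau> = \<tau> \<gamma> \<otimes> inv \<gamma>"

text \<open>Condition (iii); each of the other conditions is shown equivalent to membership
  here.\<close>

definition kummer :: "'a set" where
  "kummer = {\<gamma> \<in> carrier L - {\<zero>}. \<forall>\<tau>\<in>Gal. ratio \<gamma> \<tau> \<in> K - {\<zero>}}"

lemma inv_L [simp]:
  assumes "\<gamma> \<in> carrier L" "\<gamma> \<noteq> \<zero>"
  shows "inv \<gamma> \<in> carrier L" "inv \<gamma> \<noteq> \<zero>" "inv \<gamma> \<otimes> \<gamma> = \<one>" "\<gamma> \<otimes> inv \<gamma> = \<one>"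
proof -
  have u: "\<gamma> \<in> Units L" using assms field_Units by simp
  then show "inv \<gamma> \<in> carrier L" "inv \<gamma> \<otimes> \<gamma> = \<one>" "\<gamma> \<otimes> inv \<gamma> = \<one>" by simp_all
  then show "inv \<gamma> \<noteq> \<zero>" using assms by auto
qed

lemma ratio_closed:
  assumes "\<gamma> \<in> carrier L - {\<zero>}" "\<tau> \<in> Gal" shows "ratio \<gamma> \<tau> \<in> carrier L - {\<zero>}"
  using assms Gal_nonzero by (auto simp: ratio_def integral_iff)

lemma ratio_mult_self:
  assumes "\<gamma> \<in> carrier L - {\<zero>}" "\<tau> \<in> Gal" shows "ratio \<gamma> \<tau> \<otimes> \<gamma> = \<tau> \<gamma>"
  using assms by (simp add: ratio_def m_assoc)

lemma ratio_eqI: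
  assumes "\<gamma> \<in> carrier L - {\<zero>}" "\<tau> \<in> Gal" "k \<in> carrier L" "\<tau> \<gamma> = k \<otimes> \<gamma>" shows "ratio \<gamma> \<tau> = k"
  using assms by (simp add: ratio_def m_assoc)

lemma ratio_mult:
  assumes "\<gamma> \<in> carrier L - {\<zero>}" "\<delta> \<in> carrier L - {\<zero>}" "\<tau> \<in> Gal"
  shows "ratio (\<gamma> \<otimes> \<delta>) \<tau> = ratio \<gamma> \<tau> \<otimes> ratio \<delta> \<tau>"
proof (rule ratio_eqI)
  have r: "ratio \<gamma> \<tau> \<in> carrier L" "ratio \<delta> \<tau> \<in> carrier L" using ratio_closed assms by auto
  then show "ratio \<gamma> \<tau> \<otimes> ratio \<delta> \<tau> \<in> carrier L" by simp
  have "\<tau> (\<gamma> \<otimes> \<delta>) = (ratio \<gamma> \<tau> \<otimes> \<gamma>) \<otimes> (ratio \<delta> \<tau> \<otimes> \<delta>)"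
    using assms ratio_mult_self by simp
  also have "\<dots> = ratio \<gamma> \<tau> \<otimes> ratio \<delta> \<tau> \<otimes> (\<gamma> \<otimes> \<delta>)" using r assms by (simp add: m_ac)
  finally show "\<tau> (\<gamma> \<otimes> \<delta>) = ratio \<gamma> \<tau> \<otimes> ratio \<delta> \<tau> \<otimes> (\<gamma> \<otimes> \<delta>)" .
qed (use assms in \<open>auto simp: integral_iff\<close>)

lemma kummerI:
  "\<gamma> \<in> carrier L - {\<zero>} \<Longrightarrow> (\<And>\<tau>. \<tau> \<in> Gal \<Longrightarrow> ratio \<gamma> \<tau> \<in> K) \<Longrightarrow> \<gamma> \<in> kummer"
  using ratio_closed by (auto simp: kummer_def)

lemma kummer_closed: "\<gamma> \<in> kummer \<Longrightarrow> \<gamma> \<in> carrier L - {\<zero>}"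
  and kummer_ratio: "\<gamma> \<in> kummer \<Longrightarrow> \<tau> \<in> Gal \<Longrightarrow> ratio \<gamma> \<tau> \<in> K - {\<zero>}"
  by (auto simp: kummer_def)

lemma ratio_K: "k \<in> K - {\<zero>} \<Longrightarrow> \<tau> \<in> Gal \<Longrightarrow> ratio k \<tau> = \<one>"
  by (intro ratio_eqI) auto

lemma K_subset_kummer: "K - {\<zero>} \<subseteq> kummer"
  using ratio_K K_subring(3) by (auto intro!: kummerI)

lemma subgroup_kummer: "subgroup kummer Lx"
proof (rule Lx.subgroupI)
  show "kummer \<subseteq> carrier Lx" using kummer_closed by auto
  show "kummer \<noteq> {}" using K_subset_kummer K_subring(3) by auto
next
  fix \<gamma> assume \<gamma>: "\<gamma> \<in> kummer"
  then have \<gamma>c: "\<gamma> \<in> carrier L - {\<zero>}" by (rule kummer_closed)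
  have "inv \<gamma> \<in> kummer"
  proof (rule kummerI)
    fix \<tau> assume \<tau>: "\<tau> \<in> Gal"
    have "ratio \<gamma> \<tau> \<otimes> ratio (inv \<gamma>) \<tau> = ratio (\<gamma> \<otimes> inv \<gamma>) \<tau>"
      using \<gamma>c \<tau> by (intro ratio_mult[symmetric]) auto
    also have "\<dots> = \<one>" using \<gamma>c \<tau> ratio_K[of \<one>] K_subring(3) by simp
    finally have "ratio \<gamma> \<tau> \<otimes> ratio (inv \<gamma>) \<tau> \<in> K" using K_subring(3) by simp
    then show "ratio (inv \<gamma>) \<tau> \<in> K"
      using subfield_m_inv_simprule[OF subfield kummer_ratio[OF \<gamma> \<tau>]] ratio_closed[of "inv \<gamma>" \<tau>] \<gamma>c \<tau> by auto
  qed (use \<gamma>c in auto)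
  then show "inv\<^bsub>Lx\<^esub> \<gamma> \<in> kummer" using \<gamma>c m_inv_mult_of by simp
next
  fix \<gamma> \<delta> assume \<gamma>\<delta>: "\<gamma> \<in> kummer" "\<delta> \<in> kummer"
  have "\<gamma> \<otimes> \<delta> \<in> kummer"
  proof (rule kummerI)
    show "\<gamma> \<otimes> \<delta> \<in> carrier L - {\<zero>}" using kummer_closed \<gamma>\<delta> by (auto simp: integral_iff)
    fix \<tau> assume "\<tau> \<in> Gal"
    then show "ratio (\<gamma> \<otimes> \<delta>) \<tau> \<in> K"
      using ratio_mult[OF kummer_closed[OF \<gamma>\<delta>(1)] kummer_closed[OF \<gamma>\<delta>(2)]] kummer_ratio \<gamma>\<delta> K_subring(6) by simp
  qed
  then show "\<gamma> \<otimes>\<^bsub>Lx\<^esub> \<delta> \<in> kummer" by simp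
qed

text \<open>\<open>ratio \<gamma> \<tau>\<close> lies in K and is fixed by \<pi>, which turns the
  cocycle rule into multiplicativity.\<close>

lemma ratio_comp:
  assumes \<gamma>: "\<gamma> \<in> kummer" and "\<pi> \<in> Gal" "\<tau> \<in> Gal"
  shows "ratio \<gamma> (\<pi> \<otimes>\<^bsub>galois_group L K\<^esub> \<tau>) = ratio \<gamma> \<pi> \<otimes> ratio \<gamma> \<tau>"
proof (rule ratio_eqI[OF kummer_closed[OF \<gamma>]])
  have \<gamma>c: "\<gamma> \<in> carrier L - {\<zero>}" using \<gamma> by (rule kummer_closed)
  have r: "ratio \<gamma> \<tau> \<in> K" "ratio \<gamma> \<pi> \<in> K" using kummer_ratio \<gamma> assms by auto
  have "\<pi> (\<tau> \<gamma>) = \<pi> (ratio \<gamma> \<tau> \<otimes> \<gamma>)" using ratio_mult_self[OF \<gamma>c] assms by simp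
  also have "\<dots> = ratio \<gamma> \<tau> \<otimes> (ratio \<gamma> \<pi> \<otimes> \<gamma>)" using r \<gamma>c assms(2) ratio_mult_self[OF \<gamma>c assms(2)] by simp
  finally show "(\<pi> \<otimes>\<^bsub>galois_group L K\<^esub> \<tau>) \<gamma> = ratio \<gamma> \<pi> \<otimes> ratio \<gamma> \<tau> \<otimes> \<gamma>"
    using r \<gamma>c assms by (simp add: m_ac)
  show "ratio \<gamma> \<pi> \<otimes> ratio \<gamma> \<tau> \<in> carrier L" using r by simp
qed (use assms in simp)

lemma kummer_mult_conj_independent:
  assumes \<gamma>: "\<gamma> \<in> kummer" and x: "conj_independent x"
  shows "conj_independent (\<gamma> \<otimes> x)"
proof (rule conj_independentI)
  have xc: "x \<in> carrier L" and \<gamma>c: "\<gamma> \<in> carrier L" "\<gamma> \<noteq> \<zero>"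
    using conj_independent_closed[OF x] kummer_closed[OF \<gamma>] by auto
  show "\<gamma> \<otimes> x \<in> carrier L" using xc \<gamma>c by simp
  fix c assume c: "c \<in> Gal \<rightarrow> K" and zero: "(\<Oplus>\<tau>\<in>Gal. c \<tau> \<otimes> \<tau> (\<gamma> \<otimes> x)) = \<zero>"
  have cK: "c \<tau> \<in> K" if "\<tau> \<in> Gal" for \<tau> using c that by auto
  have rK: "ratio \<gamma> \<tau> \<in> K - {\<zero>}" if "\<tau> \<in> Gal" for \<tau> using kummer_ratio[OF \<gamma> that] .
  have rc: "ratio \<gamma> \<tau> \<in> carrier L" if "\<tau> \<in> Gal" for \<tau> using rK[OF that] by simp
  have "(\<Oplus>\<tau>\<in>Gal. c \<tau> \<otimes> \<tau> (\<gamma> \<otimes> x)) = (\<Oplus>\<tau>\<in>Gal. \<gamma> \<otimes> ((c \<tau> \<otimes> ratio \<gamma> \<tau>) \<otimes> \<tau> x))"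
  proof (rule finsum_cong')
    fix \<tau> assume \<tau>: "\<tau> \<in> Gal"
    have "c \<tau> \<otimes> \<tau> (\<gamma> \<otimes> x) = c \<tau> \<otimes> ((ratio \<gamma> \<tau> \<otimes> \<gamma>) \<otimes> \<tau> x)"
      using \<tau> \<gamma>c xc ratio_mult_self[of \<gamma> \<tau>] by simp
    then show "c \<tau> \<otimes> \<tau> (\<gamma> \<otimes> x) = \<gamma> \<otimes> ((c \<tau> \<otimes> ratio \<gamma> \<tau>) \<otimes> \<tau> x)"
      using \<tau> \<gamma>c(1) xc rc[OF \<tau>] cK[OF \<tau>] by (simp add: m_ac)
  qed (use \<gamma>c xc rc cK in auto)
  also have "\<dots> = \<gamma> \<otimes> (\<Oplus>\<tau>\<in>Gal. (c \<tau> \<otimes> ratio \<gamma> \<tau>) \<otimes> \<tau> x)"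
    using \<gamma>c xc rc cK by (intro finsum_rdistr[symmetric]) auto
  finally have "\<gamma> \<otimes> (\<Oplus>\<tau>\<in>Gal. (c \<tau> \<otimes> ratio \<gamma> \<tau>) \<otimes> \<tau> x) = \<zero>" using zero by simp
  moreover have "(\<Oplus>\<tau>\<in>Gal. (c \<tau> \<otimes> ratio \<gamma> \<tau>) \<otimes> \<tau> x) \<in> carrier L"
    using xc rc cK by (intro finsum_closed) auto
  ultimately have s0: "(\<Oplus>\<tau>\<in>Gal. (c \<tau> \<otimes> ratio \<gamma> \<tau>) \<otimes> \<tau> x) = \<zero>" using \<gamma>c by (simp add: integral_iff)
  have "(\<lambda>\<tau>. c \<tau> \<otimes> ratio \<gamma> \<tau>) \<in> Gal \<rightarrow> K" using cK rK K_subring(6) by auto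
  from conj_independentD[OF x this s0] have z: "\<And>\<tau>. \<tau> \<in> Gal \<Longrightarrow> c \<tau> \<otimes> ratio \<gamma> \<tau> = \<zero>" .
  show "\<forall>\<tau>\<in>Gal. c \<tau> = \<zero>"
  proof
    fix \<tau> assume \<tau>: "\<tau> \<in> Gal"
    show "c \<tau> = \<zero>" using z[OF \<tau>] rK[OF \<tau>] cK[OF \<tau>] by (simp add: integral_iff)
  qed
qed

lemma kummer_if_translates_basis_elements:
  assumes \<gamma>: "\<gamma> \<in> carrier L - {\<zero>}" and B: "\<And>x. conj_independent x \<Longrightarrow> conj_independent (\<gamma> \<otimes> x)"
  shows "\<gamma> \<in> kummer"
proof (rule kummerI[OF \<gamma>])
  fix \<tau> assume \<tau>: "\<tau> \<in> Gal"
  have "\<exists>k\<in>K. \<tau> \<gamma> = k \<otimes> \<gamma>"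
  proof (cases "finite K")
    case True
    show ?thesis by (rule proportional_conjugate_finite[OF True]) (use \<gamma> \<tau> B trace_nonzero in auto)
  next
    case False
    show ?thesis by (rule proportional_conjugate_infinite[OF False]) (use \<gamma> \<tau> B trace_nonzero in auto)
  qed
  then obtain k where k: "k \<in> K" "\<tau> \<gamma> = k \<otimes> \<gamma>" by blast
  then show "ratio \<gamma> \<tau> \<in> K" using ratio_eqI[OF \<gamma> \<tau> K_closed[OF k(1)] k(2)] by simp
qed

lemma kummer_translation:
  assumes \<gamma>: "\<gamma> \<in> kummer"
  shows "\<gamma> <# normal_basis_elements L K = normal_basis_elements L K"
proof
  have \<gamma>c: "\<gamma> \<in> carrier L" "\<gamma> \<noteq> \<zero>" using kummer_closed[OF \<gamma>] by auto
  \<comment> \<open>Closure of \<open>kummer\<close> under inverses supplies the reverse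
    inclusion.\<close>
  have i: "inv \<gamma> \<in> kummer"
    using subgroup.m_inv_closed[OF subgroup_kummer \<gamma>] \<gamma>c m_inv_mult_of by simp
  show "\<gamma> <# normal_basis_elements L K \<subseteq> normal_basis_elements L K"
    using kummer_mult_conj_independent[OF \<gamma>] by (auto simp: l_coset_def normal_basis_elements_eq)
  show "normal_basis_elements L K \<subseteq> \<gamma> <# normal_basis_elements L K"
  proof
    fix x assume "x \<in> normal_basis_elements L K"
    then have x: "conj_independent x" by (simp add: normal_basis_elements_eq)
    have "conj_independent (inv \<gamma> \<otimes> x)" using kummer_mult_conj_independent[OF i x] .
    moreover have "x = \<gamma> \<otimes> (inv \<gamma> \<otimes> x)"
      using \<gamma>c conj_independent_closed[OF x] by (simp add: m_assoc[symmetric])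
    ultimately show "x \<in> \<gamma> <# normal_basis_elements L K"
      by (auto simp: l_coset_def normal_basis_elements_eq)
  qed
qed

lemma kummer_iff_translation_subset:
  assumes \<gamma>: "\<gamma> \<in> carrier L - {\<zero>}"
  shows "\<gamma> \<in> kummer \<longleftrightarrow> \<gamma> <# normal_basis_elements L K \<subseteq> normal_basis_elements L K"
proof
  assume "\<gamma> <# normal_basis_elements L K \<subseteq> normal_basis_elements L K"
  then have "conj_independent (\<gamma> \<otimes> x)" if "conj_independent x" for x
    using that by (auto simp: l_coset_def normal_basis_elements_eq)
  then show "\<gamma> \<in> kummer" using kummer_if_translates_basis_elements[OF \<gamma>] by blast
qed (use kummer_translation in simp)

section \<open>Roots of unity and condition (iv)\<close>

definition roots_of_unity_K :: "'a set" where
  "roots_of_unity_K = {x \<in> K - {\<zero>}. x [^] order (galois_group L K) = \<one>}"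

lemma finite_roots_of_unity_K: "finite roots_of_unity_K"
proof -
  have "order (galois_group L K) > 0" using Gal.order_gt_0_iff_finite by simp
  from card_roots_of_unity_le(1)[OF this] show ?thesis
    by (rule rev_finite_subset) (auto simp: roots_of_unity_K_def)
qed

text \<open>Lagrange's theorem in the group formed by these roots; it makes the exponent
  \<open>w\<close> work in place of |G|.\<close>

lemma roots_of_unity_K_pow_card:
  assumes x: "x \<in> roots_of_unity_K" shows "x [^] card roots_of_unity_K = \<one>"
proof -
  have "subgroup roots_of_unity_K Lx"
  proof (rule Lx.subgroupI)
    show "roots_of_unity_K \<subseteq> carrier Lx" by (auto simp: roots_of_unity_K_def)
    show "roots_of_unity_K \<noteq> {}" using x by blast
    fix a assume a: "a \<in> roots_of_unity_K"
    then have aK: "a \<in> K - {\<zero>}" "a [^] order (galois_group L K) = \<one>" by (auto simp: roots_of_unity_K_def)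
    have ia: "inv a \<in> K - {\<zero>}" "inv a \<otimes> a = \<one>" using subfield_m_inv[OF subfield aK(1)] by auto
    have "(inv a \<otimes> a) [^] order (galois_group L K)
        = inv a [^] order (galois_group L K) \<otimes> a [^] order (galois_group L K)"
      using ia(1) aK by (intro nat_pow_distrib) auto
    then have "inv a [^] order (galois_group L K) = \<one>" using ia aK by simp
    then show "inv\<^bsub>Lx\<^esub> a \<in> roots_of_unity_K" using ia aK m_inv_mult_of[of a] by (simp add: roots_of_unity_K_def)
    fix b assume b: "b \<in> roots_of_unity_K"
    then show "a \<otimes>\<^bsub>Lx\<^esub> b \<in> roots_of_unity_K"
      using aK K_subring(6) by (auto simp: roots_of_unity_K_def nat_pow_distrib integral_iff)
  qed
  then interpret H: group "Lx\<lparr>carrier := roots_of_unity_K\<rparr>" by (rule Lx.subgroup_imp_group)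
  have "x [^]\<^bsub>Lx\<lparr>carrier := roots_of_unity_K\<rparr>\<^esub> order (Lx\<lparr>carrier := roots_of_unity_K\<rparr>) = \<one>"
    using H.pow_order_eq_1[of x] x by simp
  then show ?thesis
    by (simp add: order_def Lx.nat_pow_consistent[symmetric] Multiplicative_Group.nat_pow_mult_of)
qed

lemma Gal_pow: "\<tau> \<in> Gal \<Longrightarrow> x \<in> carrier L \<Longrightarrow> \<tau> (x [^] (i::nat)) = \<tau> x [^] i"
  by (induction i) auto

text \<open>As \<tau> multiplies \<gamma>^w by the w-th power of
  \<open>ratio \<gamma> \<tau>\<close>, both sides say that all these powers are 1.\<close>

lemma kummer_iff_pow:
  assumes \<gamma>: "\<gamma> \<in> carrier L - {\<zero>}"
  shows "\<gamma> \<in> kummer \<longleftrightarrow> \<gamma> [^] card roots_of_unity_K \<in> K - {\<zero>}"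
proof
  let ?w = "card roots_of_unity_K"
  have \<gamma>c: "\<gamma> \<in> carrier L" using \<gamma> by simp
  have pow_nz: "\<gamma> [^] i \<noteq> \<zero>" for i :: nat
    using \<gamma> by (induction i) (auto simp: integral_iff)
  have ratio_pow: "ratio \<gamma> \<tau> [^] ?w \<otimes> \<gamma> [^] ?w = \<tau> (\<gamma> [^] ?w)" if \<tau>: "\<tau> \<in> Gal" for \<tau>
  proof -
    have "ratio \<gamma> \<tau> \<in> carrier L" using ratio_closed[OF \<gamma> \<tau>] by simp
    then have "ratio \<gamma> \<tau> [^] ?w \<otimes> \<gamma> [^] ?w = (ratio \<gamma> \<tau> \<otimes> \<gamma>) [^] ?w"
      using \<gamma>c by (simp add: nat_pow_distrib)
    then show ?thesis using ratio_mult_self[OF \<gamma> \<tau>] Gal_pow[OF \<tau> \<gamma>c] by simp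
  qed
  {
    assume k: "\<gamma> \<in> kummer"
    have "\<gamma> [^] ?w \<in> K"
    proof (rule in_K_if_fixed)
      fix \<tau> assume \<tau>: "\<tau> \<in> Gal"
      have r: "ratio \<gamma> \<tau> \<in> K - {\<zero>}" using kummer_ratio[OF k \<tau>] .
      \<comment> \<open>A character of G takes values that are killed by |G|.\<close>
      have "ratio \<gamma> (\<tau> [^]\<^bsub>galois_group L K\<^esub> i) = ratio \<gamma> \<tau> [^] i" for i :: nat
      proof (induction i)
        case 0
        have "ratio \<gamma> \<one>\<^bsub>galois_group L K\<^esub> = \<one>" by (rule ratio_eqI[OF \<gamma>]) (use \<gamma>c in auto)
        then show ?case by simp
      next
        case (Suc i)
        then show ?case using ratio_comp[OF k, of "\<tau> [^]\<^bsub>galois_group L K\<^esub> i" \<tau>] \<tau> by simp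
      qed
      from this[of "order (galois_group L K)"]
      have "ratio \<gamma> \<tau> [^] order (galois_group L K) = ratio \<gamma> \<one>\<^bsub>galois_group L K\<^esub>"
        using \<tau> by (simp add: Gal.pow_order_eq_1)
      also have "\<dots> = \<one>" by (rule ratio_eqI[OF \<gamma>]) (use \<gamma>c in auto)
      finally have "ratio \<gamma> \<tau> \<in> roots_of_unity_K" using r by (simp add: roots_of_unity_K_def)
      then show "\<tau> (\<gamma> [^] ?w) = \<gamma> [^] ?w"
        using ratio_pow[OF \<tau>] roots_of_unity_K_pow_card \<gamma>c by simp
    qed (use \<gamma>c in simp)
    then show "\<gamma> [^] ?w \<in> K - {\<zero>}" using pow_nz by simp
  }
  {
    assume p: "\<gamma> [^] ?w \<in> K - {\<zero>}"
    have one: "\<one> \<in> roots_of_unity_K" using K_subring(3) by (simp add: roots_of_unity_K_def)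
    then have w: "?w > 0" using finite_roots_of_unity_K by (auto simp: card_gt_0_iff)
    have "roots_of_unity_K \<subseteq> {x \<in> carrier L. x [^] ?w = \<one>}"
      using roots_of_unity_K_pow_card by (auto simp: roots_of_unity_K_def)
    \<comment> \<open>K already contains \<open>w\<close> such roots, as many as X^w - 1 can have in
      L.\<close>
    then have eq: "roots_of_unity_K = {x \<in> carrier L. x [^] ?w = \<one>}"
      using card_roots_of_unity_le[OF w] by (intro card_seteq) auto
    show "\<gamma> \<in> kummer"
    proof (rule kummerI[OF \<gamma>])
      fix \<tau> assume \<tau>: "\<tau> \<in> Gal"
      have r: "ratio \<gamma> \<tau> \<in> carrier L" using ratio_closed[OF \<gamma> \<tau>] by simp
      have "ratio \<gamma> \<tau> [^] ?w \<otimes> \<gamma> [^] ?w = \<one> \<otimes> \<gamma> [^] ?w"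
        using ratio_pow[OF \<tau>] p \<tau> \<gamma>c by simp
      then have "ratio \<gamma> \<tau> [^] ?w = \<one>"
        using m_rcancel[of "\<gamma> [^] ?w" "ratio \<gamma> \<tau> [^] ?w" \<one>] pow_nz r \<gamma>c by simp
      then have "ratio \<gamma> \<tau> \<in> roots_of_unity_K" using r by (subst eq) simp
      then show "ratio \<gamma> \<tau> \<in> K" by (simp add: roots_of_unity_K_def)
    qed
  }
qed

text \<open>Hilbert 90 for a cocycle with values in the fixed field: the Lagrange resolvent of a suitable
  element is nonzero by Dedekind independence.\<close>

lemma exists_kummer_with_ratio:
  assumes \<chi>: "\<chi> \<in> hom (galois_group L K) Kx"
  shows "\<exists>\<gamma>\<in>kummer. \<forall>\<tau>\<in>Gal. ratio \<gamma> \<tau> = \<chi> \<tau>"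
proof -
  let ?G = "galois_group L K"
  have \<chi>K: "\<chi> \<tau> \<in> K - {\<zero>}" if "\<tau> \<in> Gal" for \<tau> using hom_in_carrier[OF \<chi> that] by simp
  have \<chi>m: "\<chi> (\<pi> \<otimes>\<^bsub>?G\<^esub> \<tau>) = \<chi> \<pi> \<otimes> \<chi> \<tau>" if "\<pi> \<in> Gal" "\<tau> \<in> Gal" for \<pi> \<tau>
    using hom_mult[OF \<chi> that] by simp
  have \<chi>c: "\<chi> \<tau> \<in> carrier L" if "\<tau> \<in> Gal" for \<tau> using \<chi>K[OF that] by simp
  have \<chi>1: "\<chi> \<one>\<^bsub>?G\<^esub> = \<one>" using hom_one[OF \<chi> Gal.is_group Kx.is_group] by simp
  \<comment> \<open>The inverse inside \<chi> makes \<tau> multiply the resolvent by \<chi> \<tau>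
    rather than by its inverse.\<close>
  define res where "res = (\<lambda>y. \<Oplus>\<pi>\<in>Gal. \<chi> (inv\<^bsub>?G\<^esub> \<pi>) \<otimes> \<pi> y)"
  have "\<exists>y\<in>carrier L. res y \<noteq> \<zero>"
  proof (rule ccontr)
    assume "\<not> ?thesis"
    then have "\<forall>\<pi>\<in>Gal. \<chi> (inv\<^bsub>?G\<^esub> \<pi>) = \<zero>"
      using \<chi>c by (intro dedekind_independence) (auto simp: res_def)
    then show False using \<chi>K[OF Gal.inv_closed[OF Gal.one_closed]] Gal.one_closed by blast
  qed
  then obtain y where y: "y \<in> carrier L" "res y \<noteq> \<zero>" by blast
  have rc: "res y \<in> carrier L" unfolding res_def using \<chi>c y by (intro finsum_closed) auto
  have r: "res y \<in> carrier L - {\<zero>}" using rc y by simp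
  have act: "\<tau> (res y) = \<chi> \<tau> \<otimes> res y" if \<tau>: "\<tau> \<in> Gal" for \<tau>
  proof -
    let ?f = "\<lambda>\<pi>. \<chi> \<tau> \<otimes> (\<chi> (inv\<^bsub>?G\<^esub> \<pi>) \<otimes> \<pi> y)"
    have "\<tau> (res y) = (\<Oplus>\<pi>\<in>Gal. \<tau> (\<chi> (inv\<^bsub>?G\<^esub> \<pi>) \<otimes> \<pi> y))"
      unfolding res_def using \<tau> \<chi>c y by (intro Gal_finsum) auto
    \<comment> \<open>Passing to the product with \<tau> brings in \<chi> of the inverse of \<tau>,
      which the factor \<chi> \<tau> in \<open>?f\<close> cancels.\<close>
    also have "\<dots> = (\<Oplus>\<pi>\<in>Gal. ?f (\<tau> \<otimes>\<^bsub>?G\<^esub> \<pi>))"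
    proof (rule finsum_cong')
      fix \<pi> assume \<pi>: "\<pi> \<in> Gal"
      let ?p = "inv\<^bsub>?G\<^esub> \<pi>" and ?t = "inv\<^bsub>?G\<^esub> \<tau>"
      have pt: "?p \<in> Gal" "?t \<in> Gal" using \<pi> \<tau> by auto
      have "\<chi> \<tau> \<otimes> \<chi> ?t = \<one>" using \<chi>m[OF \<tau> pt(2)] \<chi>1 \<tau> by simp
      moreover have "\<chi> (inv\<^bsub>?G\<^esub> (\<tau> \<otimes>\<^bsub>?G\<^esub> \<pi>)) = \<chi> ?p \<otimes> \<chi> ?t"
        using \<chi>m[OF pt] \<pi> \<tau> by (simp add: Gal.inv_mult_group)
      moreover have "\<chi> \<tau> \<otimes> (\<chi> ?p \<otimes> \<chi> ?t \<otimes> \<tau> (\<pi> y)) = (\<chi> \<tau> \<otimes> \<chi> ?t) \<otimes> (\<chi> ?p \<otimes> \<tau> (\<pi> y))"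
        using \<chi>c[OF \<tau>] \<chi>c[OF pt(1)] \<chi>c[OF pt(2)] \<pi> \<tau> y(1) by (simp add: m_ac)
      ultimately have "?f (\<tau> \<otimes>\<^bsub>?G\<^esub> \<pi>) = \<chi> ?p \<otimes> \<tau> (\<pi> y)"
        using \<chi>c[OF pt(1)] \<pi> \<tau> y(1) by simp
      then show "\<tau> (\<chi> ?p \<otimes> \<pi> y) = ?f (\<tau> \<otimes>\<^bsub>?G\<^esub> \<pi>)"
        using \<chi>K[OF pt(1)] \<pi> \<tau> y(1) by simp
    qed (use \<chi>c \<tau> y in auto)
    also have "\<dots> = (\<Oplus>\<pi>\<in>Gal. ?f \<pi>)"
      using \<chi>c \<tau> y by (intro finsum_Gal_mult_left) auto
    also have "\<dots> = \<chi> \<tau> \<otimes> res y"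
      unfolding res_def using \<chi>c \<tau> y by (intro finsum_rdistr[symmetric]) auto
    finally show ?thesis .
  qed
  have "ratio (res y) \<tau> = \<chi> \<tau>" if "\<tau> \<in> Gal" for \<tau>
    using ratio_eqI[OF r that \<chi>c[OF that] act[OF that]] .
  moreover from this have "res y \<in> kummer" using \<chi>K by (intro kummerI[OF r]) auto
  ultimately show ?thesis by blast
qed

text \<open>The map from \<gamma> to its character has kernel K* because K is the whole fixed field,
  and it is onto by Hilbert 90; the homomorphism theorem does the rest.\<close>

lemma kummer_quotient_iso:
  "(Lx\<lparr>carrier := kummer\<rparr>) Mod (K - {\<zero>}) \<cong> hom_group (galois_group L K) Kx"
proof -
  let ?G = "galois_group L K"
  \<comment> \<open>The restriction makes the character extensional, as the elements of
    \<open>hom_group\<close> are.\<close>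
  define h where "h = (\<lambda>\<gamma>. \<lambda>\<tau>\<in>Gal. ratio \<gamma> \<tau>)"
  have grp: "group (Lx\<lparr>carrier := kummer\<rparr>)" using Lx.subgroup_imp_group[OF subgroup_kummer] .
  have hH: "h \<gamma> \<in> carrier (hom_group ?G Kx)" if \<gamma>: "\<gamma> \<in> kummer" for \<gamma>
    using kummer_ratio[OF \<gamma>] ratio_comp[OF \<gamma>] by (auto simp: h_def hom_group_def hom_def)
  have "h \<in> hom (Lx\<lparr>carrier := kummer\<rparr>) (hom_group ?G Kx)"
  proof (rule homI)
    fix \<gamma> \<delta> assume "\<gamma> \<in> carrier (Lx\<lparr>carrier := kummer\<rparr>)" "\<delta> \<in> carrier (Lx\<lparr>carrier := kummer\<rparr>)"
    then have "\<gamma> \<in> carrier L - {\<zero>}" "\<delta> \<in> carrier L - {\<zero>}" using kummer_closed by auto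
    then show "h (\<gamma> \<otimes>\<^bsub>Lx\<lparr>carrier := kummer\<rparr>\<^esub> \<delta>) = h \<gamma> \<otimes>\<^bsub>hom_group ?G Kx\<^esub> h \<delta>"
      using ratio_mult by (auto simp: h_def hom_group_def intro!: restrict_ext)
  qed (use hH in simp)
  then interpret h: group_hom "Lx\<lparr>carrier := kummer\<rparr>" "hom_group ?G Kx" h
    by (intro group_hom.intro group_hom_axioms.intro grp group_hom_group Gal.is_group comm_group_Kx)
  have ker: "kernel (Lx\<lparr>carrier := kummer\<rparr>) (hom_group ?G Kx) h = K - {\<zero>}"
  proof (intro equalityI subsetI)
    fix \<gamma> assume "\<gamma> \<in> kernel (Lx\<lparr>carrier := kummer\<rparr>) (hom_group ?G Kx) h"
    then have \<gamma>: "\<gamma> \<in> kummer" and h1: "h \<gamma> = (\<lambda>\<tau>\<in>Gal. \<one>)" by (auto simp: kernel_def hom_group_def)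
    have \<gamma>c: "\<gamma> \<in> carrier L - {\<zero>}" using \<gamma> by (rule kummer_closed)
    have "\<gamma> \<in> K"
    proof (rule in_K_if_fixed)
      fix \<tau> assume \<tau>: "\<tau> \<in> Gal"
      have "h \<gamma> \<tau> = \<one>" using h1 \<tau> by simp
      then have "ratio \<gamma> \<tau> = \<one>" using \<tau> by (simp add: h_def)
      then show "\<tau> \<gamma> = \<gamma>" using ratio_mult_self[OF \<gamma>c \<tau>] \<gamma>c by simp
    qed (use \<gamma>c in simp)
    then show "\<gamma> \<in> K - {\<zero>}" using \<gamma>c by simp
  next
    fix \<gamma> assume \<gamma>: "\<gamma> \<in> K - {\<zero>}"
    then have "h \<gamma> = (\<lambda>\<tau>\<in>Gal. \<one>)" using ratio_K by (auto simp: h_def intro!: restrict_ext)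
    then show "\<gamma> \<in> kernel (Lx\<lparr>carrier := kummer\<rparr>) (hom_group ?G Kx) h"
      using \<gamma> K_subset_kummer by (auto simp: kernel_def hom_group_def)
  qed
  have "h ` carrier (Lx\<lparr>carrier := kummer\<rparr>) = carrier (hom_group ?G Kx)"
  proof
    show "carrier (hom_group ?G Kx) \<subseteq> h ` carrier (Lx\<lparr>carrier := kummer\<rparr>)"
    proof
      fix \<chi> assume "\<chi> \<in> carrier (hom_group ?G Kx)"
      then have \<chi>: "\<chi> \<in> hom ?G Kx" "\<chi> \<in> extensional Gal" by (auto simp: hom_group_def)
      obtain \<gamma> where \<gamma>: "\<gamma> \<in> kummer" "\<forall>\<tau>\<in>Gal. ratio \<gamma> \<tau> = \<chi> \<tau>"
        using exists_kummer_with_ratio[OF \<chi>(1)] by blast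
      have "\<chi> = h \<gamma>" unfolding h_def using \<gamma>(2) \<chi>(2) by (intro extensionalityI) auto
      then show "\<chi> \<in> h ` carrier (Lx\<lparr>carrier := kummer\<rparr>)" using \<gamma>(1) by simp
    qed
  qed (use hH in auto)
  from h.FactGroup_iso[OF this] show ?thesis unfolding ker .
qed

end

theorem theorem1:
  fixes L :: "('a, 'm) ring_scheme" (structure) and K :: "'a set"
  assumes "finite_galois_extension L K"
  shows "let
      G = galois_group L K;
      B = normal_basis_elements L K;
      Lx = Multiplicative_Group.mult_of L;
      Kx = Multiplicative_Group.mult_of (L\<lparr>carrier := K\<rparr>);
      w = card {x \<in> carrier Kx. x [^] Coset.order G = \<one>};
      cond1 = (\<lambda>\<gamma>. \<gamma> <# B \<subseteq> B);
      cond2 = (\<lambda>\<gamma>. \<gamma> <# B = B);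
      cond3 = (\<lambda>\<gamma>. \<forall>\<tau> \<in> carrier G. \<tau> \<gamma> \<otimes> inv \<gamma> \<in> carrier Kx);
      cond4 = (\<lambda>\<gamma>. \<gamma> [^] w \<in> carrier Kx);
      C = {\<gamma> \<in> carrier Lx. cond1 \<gamma> \<and> cond2 \<gamma> \<and> cond3 \<gamma> \<and> cond4 \<gamma>}
    in (\<forall>\<gamma> \<in> carrier Lx. (cond1 \<gamma> \<longleftrightarrow> cond2 \<gamma>) \<and> (cond2 \<gamma> \<longleftrightarrow> cond3 \<gamma>) \<and> (cond3 \<gamma> \<longleftrightarrow> cond4 \<gamma>)) \<and>
       subgroup C Lx \<and>
       carrier Kx \<subseteq> C \<and>
       (Lx\<lparr>carrier := C\<rparr>) Mod carrier Kx \<cong> hom_group G Kx"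
proof -
  interpret finite_galois_extension L K by (rule assms)
  let ?B = "normal_basis_elements L K"
  let ?w = "card {x \<in> carrier Kx. x [^] Coset.order (galois_group L K) = \<one>}"
  have Kx: "carrier Kx = K - {\<zero>}" by simp
  have w: "?w = card roots_of_unity_K" by (simp add: roots_of_unity_K_def)
  have c1: "\<gamma> <# ?B \<subseteq> ?B \<longleftrightarrow> \<gamma> \<in> kummer" if "\<gamma> \<in> carrier Lx" for \<gamma>
    using kummer_iff_translation_subset that by simp
  have c2: "\<gamma> <# ?B = ?B \<longleftrightarrow> \<gamma> \<in> kummer" if "\<gamma> \<in> carrier Lx" for \<gamma>
    using c1[OF that] kummer_translation by blast
  have c3: "(\<forall>\<tau>\<in>Gal. \<tau> \<gamma> \<otimes> inv \<gamma> \<in> carrier Kx) \<longleftrightarrow> \<gamma> \<in> kummer" if "\<gamma> \<in> carrier Lx" for \<gamma>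
    using that by (simp add: kummer_def ratio_def)
  have c4: "\<gamma> [^] ?w \<in> carrier Kx \<longleftrightarrow> \<gamma> \<in> kummer" if "\<gamma> \<in> carrier Lx" for \<gamma>
    using kummer_iff_pow that unfolding w by simp
  \<comment> \<open>Each of the four conditions describes \<open>kummer\<close>, hence so does their
    conjunction.\<close>
  have C: "{\<gamma> \<in> carrier Lx. \<gamma> <# ?B \<subseteq> ?B \<and> \<gamma> <# ?B = ?B \<and>
      (\<forall>\<tau>\<in>Gal. \<tau> \<gamma> \<otimes> inv \<gamma> \<in> carrier Kx) \<and> \<gamma> [^] ?w \<in> carrier Kx} = kummer"
  proof (rule Set.set_eqI, rule iffI)
    fix \<gamma> assume \<gamma>: "\<gamma> \<in> kummer"
    have "\<gamma> \<in> carrier Lx" using kummer_closed[OF \<gamma>] by simp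
    then show "\<gamma> \<in> {\<gamma> \<in> carrier Lx. \<gamma> <# ?B \<subseteq> ?B \<and> \<gamma> <# ?B = ?B \<and>
      (\<forall>\<tau>\<in>Gal. \<tau> \<gamma> \<otimes> inv \<gamma> \<in> carrier Kx) \<and> \<gamma> [^] ?w \<in> carrier Kx}"
      unfolding mem_Collect_eq by (simp only: c1 c2 c3 c4 \<gamma> simp_thms)
  next
    fix \<gamma> assume "\<gamma> \<in> {\<gamma> \<in> carrier Lx. \<gamma> <# ?B \<subseteq> ?B \<and> \<gamma> <# ?B = ?B \<and>
      (\<forall>\<tau>\<in>Gal. \<tau> \<gamma> \<otimes> inv \<gamma> \<in> carrier Kx) \<and> \<gamma> [^] ?w \<in> carrier Kx}"
    then have "\<gamma> \<in> carrier Lx" "\<gamma> <# ?B \<subseteq> ?B" unfolding mem_Collect_eq by simp_all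
    then show "\<gamma> \<in> kummer" by (simp only: c1)
  qed
  show ?thesis
    unfolding Let_def C
  proof (intro conjI ballI)
    show "subgroup kummer Lx" by (rule subgroup_kummer)
    show "carrier Kx \<subseteq> kummer" unfolding Kx by (rule K_subset_kummer)
    show "(Lx\<lparr>carrier := kummer\<rparr>) Mod carrier Kx \<cong> hom_group (galois_group L K) Kx"
      unfolding Kx by (rule kummer_quotient_iso)
  qed (simp_all only: c1 c2 c3 c4)
qed

end
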